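(* Let $a_n$ be the number of admissible sign patterns on a ground set of size $n$. Then $\log_2 a_n = 2^{n-1} + O(1)$ as $n \to \infty$.
   Context: Let $N$ be a finite set of size $n$. A sign pattern on $N$ is a function $s: 2^N \to \{+,-\}$. It is admissible if $s(\emptyset) = +$ and, for all $i \neq j$ in $N$ and all $K \subseteq N \setminus \{i,j\}$, the implication $[s(K\cup\{i\}) \neq s(K \cup\{j\})] \implies [s(K) \neq s(K\cup\{i,j\})]$ holds. *)

theory Defs
  imports Complex_Main "HOL-Library.FuncSet" "HOL-Library.Landau_Symbols"
begin

datatype sign = Plus | Minus

text \<open>The extensional function space makes a sign pattern on \<open>N\<close> determined by its values on
  the subsets of \<open>N\<close>, so that sign patterns can be counted.\<close>

definition sign_patterns :: "'a set \<Rightarrow> ('a set \<Rightarrow> sign) set" where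
  "sign_patterns N = Pow N \<rightarrow>\<^sub>E UNIV"

definition admissible :: "'a set \<Rightarrow> ('a set \<Rightarrow> sign) \<Rightarrow> bool" where
  "admissible N s \<longleftrightarrow>
     s {} = Plus \<and>
     (\<forall>i\<in>N. \<forall>j\<in>N. i \<noteq> j \<longrightarrow>
        (\<forall>K. K \<subseteq> N - {i, j} \<longrightarrow>
           s (K \<union> {i}) \<noteq> s (K \<union> {j}) \<longrightarrow> s K \<noteq> s (K \<union> {i, j})))"

definition admissible_patterns :: "'a set \<Rightarrow> ('a set \<Rightarrow> sign) set" where
  "admissible_patterns N = {s \<in> sign_patterns N. admissible N s}"

text \<open>The ground set is taken to be \<open>{..<n}\<close>; the lemma \<open>card_admissible_patterns\<close> below shows
  that every ground set of size \<open>n\<close> gives the same number.\<close>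

definition num_admissible :: "nat \<Rightarrow> nat" where
  "num_admissible n = card (admissible_patterns {..<n})"

lemma finite_admissible_patterns:
  assumes "finite N"
  shows "finite (admissible_patterns N)"
proof -
  have "(UNIV :: sign set) = {Plus, Minus}"
    using sign.exhaust by auto
  then have "finite (UNIV :: sign set)"
    by (metis finite.emptyI finite_insert)
  then have "finite (sign_patterns N)"
    using assms by (simp add: sign_patterns_def finite_PiE)
  then show ?thesis
    by (simp add: admissible_patterns_def)
qed

lemma card_admissible_patterns_le:
  assumes f: "bij_betw f M N" and M: "finite M"
  shows "card (admissible_patterns N) \<le> card (admissible_patterns M)"
proof (rule card_inj_on_le)
  let ?\<Phi> = "\<lambda>s. restrict (\<lambda>A. s (f ` A)) (Pow M)"
  have inj: "inj_on f M" and img: "f ` M = N"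
    using f by (auto simp: bij_betw_def)
  show "inj_on ?\<Phi> (admissible_patterns N)"
  proof (rule inj_onI)
    fix s t assume s: "s \<in> admissible_patterns N" and t: "t \<in> admissible_patterns N"
      and eq: "?\<Phi> s = ?\<Phi> t"
    have "s B = t B" if "B \<in> Pow N" for B
    proof -
      obtain A where A: "A \<subseteq> M" "B = f ` A"
        using \<open>B \<in> Pow N\<close> img by (metis PowD subset_imageE)
      then show ?thesis using fun_cong[OF eq, of A] by simp
    qed
    then show "s = t"
      using s t unfolding admissible_patterns_def sign_patterns_def
      by (intro PiE_ext[where k = "Pow N" and s = "\<lambda>_. UNIV"]) auto
  qed
  show "?\<Phi> ` admissible_patterns N \<subseteq> admissible_patterns M"
  proof (intro image_subsetI)
    fix s assume "s \<in> admissible_patterns N"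
    then have adm: "admissible N s" by (simp add: admissible_patterns_def)
    have "admissible M (?\<Phi> s)"
      unfolding admissible_def
    proof (intro conjI ballI allI impI)
      show "?\<Phi> s {} = Plus" using adm by (simp add: admissible_def)
    next
      fix i j K
      assume ij: "i \<in> M" "j \<in> M" "i \<noteq> j" and K: "K \<subseteq> M - {i, j}"
        and ne: "?\<Phi> s (K \<union> {i}) \<noteq> ?\<Phi> s (K \<union> {j})"
      have sub: "K \<subseteq> M" "K \<union> {i} \<subseteq> M" "K \<union> {j} \<subseteq> M" "K \<union> {i, j} \<subseteq> M"
        using ij K by auto
      have "f i \<in> N" "f j \<in> N" using ij img by auto
      moreover have "f i \<noteq> f j" using ij inj by (auto dest: inj_onD)
      moreover have "f ` K \<subseteq> N - {f i, f j}"
        using K ij inj img by (auto dest: inj_onD)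
      moreover have "s (f ` K \<union> {f i}) \<noteq> s (f ` K \<union> {f j})"
        using ne sub by (simp add: image_Un)
      ultimately have "s (f ` K) \<noteq> s (f ` K \<union> {f i, f j})"
        using adm unfolding admissible_def by blast
      then show "?\<Phi> s K \<noteq> ?\<Phi> s (K \<union> {i, j})"
        using sub by (simp add: image_Un)
    qed
    then show "?\<Phi> s \<in> admissible_patterns M"
      by (simp add: admissible_patterns_def sign_patterns_def)
  qed
  show "finite (admissible_patterns M)"
    using M by (rule finite_admissible_patterns)
qed

lemma card_admissible_patterns:
  assumes "finite N" "card N = n"
  shows "card (admissible_patterns N) = num_admissible n"
proof -
  obtain f where f: "bij_betw f N {..<n}"
    using assms by (metis bij_betw_iff_card card_lessThan finite_lessThan)
  show ?thesis
    unfolding num_admissible_def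
    using card_admissible_patterns_le[OF f \<open>finite N\<close>]
      card_admissible_patterns_le[OF bij_betw_inv_into[OF f]]
    by simp
qed

end

theory Submission
  imports Defs "HOL-Library.Numeral_Type" "HOL-Real_Asymp.Real_Asymp" "HOL-Analysis.Convex"
begin

text \<open>After a periodic change of signs, admissibility says that every square of the cube has a
  constant diagonal, so a pattern is the residue mod 4 of a height function changing by one along
  edges, and its heights mod 3 form a proper 3-colouring of the cube.  Hence it suffices to show
  that the \<open>n\<close>-cube has \<open>O(2 ^ 2 ^ (n - 1))\<close> proper 3-colourings.  There are six phases: one of
  the parity classes is coloured constantly and the other one freely with the other two colours.

  Colourings close to a phase are counted by a polymer expansion over the components of the set
  of vertices that deviate from the phase.  A component \<open>A\<close> is determined up to few choices by a
  small connected subset whose neighbourhood nearly contains that of \<open>A\<close>, and edge isoperimetry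
  together with Finner's inequality shows that the components have total weight \<open>O(1)\<close>.

  Colourings far from every phase are rare.  Split the cube as \<open>D \<times> M\<close> with \<open>2 ^ |M|\<close> about
  \<open>n / 100\<close>.  Finner's inequality over the neighbourhoods in \<open>D\<close> bounds the number of
  colourings weighted by rewards for defects: for a vertex \<open>w\<close> of \<open>D\<close> whose neighbouring slices
  show no dominant phase and for a slice that is nearly compatible with two phases.  Without
  such defects the dominant phase cannot change along an edge of \<open>D\<close>, and isoperimetry in \<open>D\<close>
  turns a phase minority into many defects.\<close>

section \<open>Finner's inequality\<close>

text \<open>The two counts must meet at an exponentially small density of deviations. For a set of
  relative size \<open>2 powr (- q)\<close>, isoperimetry saves about \<open>q / n\<close> bits per
  neighbour of a polymer, while naming its container costs about \<open>log n / q\<close> bits per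
  neighbour. So the polymer sum is controlled only for \<open>q\<close> above the order of the
  square root of \<open>n log n\<close>, and excluding a positive fraction of deviations would not
  suffice: the count of far colourings has to reach down to density \<open>2 powr (- L / 2)\<close>
  with \<open>L = n / (log n)\<^sup>2\<close>. This is what slicing is for. Finner's inequality over
  the base cube \<open>D\<close> loses a constant factor per star, to the power
  \<open>1 / card D\<close>, and rewards for defects must recover it. A label of a slice without
  dominant phase loses a factor exponential in about \<open>n / log n\<close>, which leaves room for
  a reward of \<open>2 powr L\<close> per defect. The slices cannot be made larger: a star has up to
  \<open>6 ^ (2 ^ card M)\<close> labels, and this number must be beaten by a factor exponentially
  small in \<open>card D\<close>.\<close>

lemma sum_PiE_insert:
  fixes g :: "('v \<Rightarrow> 'b) \<Rightarrow> real"
  assumes "v \<notin> V"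
  shows "(\<Sum>c\<in>PiE (insert v V) L. g c) = (\<Sum>c\<in>PiE V L. \<Sum>a\<in>L v. g (c(v := a)))"
proof -
  have "(\<Sum>c\<in>PiE (insert v V) L. g c) = (\<Sum>(a, c)\<in>L v \<times> PiE V L. g (c(v := a)))"
    unfolding PiE_insert_eq
    by (subst sum.reindex[OF inj_combinator[OF assms]]) (simp add: case_prod_unfold comp_def)
  also have "\<dots> = (\<Sum>a\<in>L v. \<Sum>c\<in>PiE V L. g (c(v := a)))"
    by (simp add: sum.cartesian_product)
  finally show ?thesis by (simp add: sum.swap[of _ "PiE V L"])
qed

text \<open>The inequality of arithmetic and geometric means for \<open>n\<close> numbers,
  \<open>n - card K\<close> of which equal \<open>t0\<close>. The equal ones will stand for constant
  functions that fill up Hoelder's inequality to \<open>n\<close> factors.\<close>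

lemma am_gm_padded:
  fixes t :: "'j \<Rightarrow> real"
  assumes fin: "finite K" and k: "card K \<le> n" and n: "n > 0"
    and t: "\<And>j. j \<in> K \<Longrightarrow> t j \<ge> 0" and t0: "t0 \<ge> 0"
    and x: "x ^ n = (\<Prod>j\<in>K. t j) * t0 ^ (n - card K)"
  shows "real n * x \<le> (\<Sum>j\<in>K. t j) + real (n - card K) * t0"
proof -
  define M where "M = ((\<Sum>j\<in>K. t j) + real (n - card K) * t0) / n"
  have M0: "M \<ge> 0" unfolding M_def using t t0 by (simp add: sum_nonneg)
  show ?thesis
  proof (cases "M = 0")
    case True
    then have z: "(\<Sum>j\<in>K. t j) = 0" "real (n - card K) * t0 = 0"
      using n t t0 unfolding M_def
      by (auto simp: add_nonneg_eq_0_iff sum_nonneg)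
    have "x ^ n = 0"
    proof (cases "K = {}")
      case True
      then show ?thesis using z n x by simp
    next
      case False
      then obtain j where j: "j \<in> K" by blast
      then have "t j = 0" using z(1) t fin by (simp add: sum_nonneg_eq_0_iff)
      then show ?thesis using x j fin by (simp add: prod_zero_iff) blast
    qed
    then show ?thesis using n t0 z by (simp del: of_nat_diff)
  next
    case False
    then have Mp: "M > 0" using M0 by simp
    have "(x / M) ^ n = (\<Prod>j\<in>K. t j / M) * (t0 / M) ^ (n - card K)"
    proof -
      have "M ^ n = M ^ card K * M ^ (n - card K)"
        using k by (simp add: power_add[symmetric])
      then show ?thesis using x by (simp add: power_divide prod_dividef)
    qed
    \<comment> \<open>Polya's argument: each number divided by the mean \<open>M\<close> satisfies
      \<open>y \<le> exp (y - 1)\<close>, and the exponents sum to 0.\<close>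
    also have "\<dots> \<le> (\<Prod>j\<in>K. exp (t j / M - 1)) * exp (t0 / M - 1) ^ (n - card K)"
    proof -
      have e: "y \<le> exp (y - 1)" for y :: real using exp_ge_add_one_self[of "y - 1"] by simp
      show ?thesis
        using t t0 Mp by (intro mult_mono prod_mono power_mono conjI e) (auto intro!: prod_nonneg)
    qed
    also have "\<dots> = exp ((\<Sum>j\<in>K. t j / M - 1) + real (n - card K) * (t0 / M - 1))"
      using fin by (simp add: exp_sum exp_add exp_of_nat_mult)
    also have "(\<Sum>j\<in>K. t j / M - 1) + real (n - card K) * (t0 / M - 1)
      = ((\<Sum>j\<in>K. t j) + real (n - card K) * t0) / M - n"
      using k by (simp add: sum_subtractf sum_divide_distrib[symmetric] add_divide_distrib diff_divide_distrib algebra_simps of_nat_diff)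
    also have "(\<Sum>j\<in>K. t j) + real (n - card K) * t0 = real n * M"
      unfolding M_def using n by simp
    also have "real n * M / M - n = 0" using Mp by simp
    finally have "(x / M) ^ n \<le> 1" by simp
    then have "x / M \<le> 1"
      using n by (meson linorder_not_le one_less_power)
    then have "x \<le> M" using Mp by (simp add: field_simps)
    then show ?thesis using n unfolding M_def by (simp add: field_simps)
  qed
qed

text \<open>Divide each function by its norm, apply \<open>am_gm_padded\<close> at every point and
  sum over \<open>L\<close>. The last factor is the product of the norms of
  \<open>n - card K\<close> constant functions 1. A function of norm 0 is treated separately, since
  it cannot be normalised.\<close>

lemma Hoelder_sum_padded:
  fixes f :: "'j \<Rightarrow> 'b \<Rightarrow> real"
  assumes finK: "finite K" and k: "card K \<le> n" and n: "n > 0" and finL: "finite L"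
    and f: "\<And>j a. j \<in> K \<Longrightarrow> a \<in> L \<Longrightarrow> f j a \<ge> 0"
  shows "(\<Sum>a\<in>L. \<Prod>j\<in>K. f j a)
    \<le> (\<Prod>j\<in>K. root n (\<Sum>a\<in>L. f j a ^ n)) * root n (card L) ^ (n - card K)"
proof -
  define F where "F j = (\<Sum>a\<in>L. f j a ^ n)" for j
  have F0: "F j \<ge> 0" if "j \<in> K" for j unfolding F_def using f that by (simp add: sum_nonneg)
  show ?thesis
  proof (cases "L = {} \<or> (\<exists>j\<in>K. F j = 0)")
    case True
    have "(\<Sum>a\<in>L. \<Prod>j\<in>K. f j a) = 0"
    proof (cases "L = {}")
      case False
      with True obtain j where j: "j \<in> K" "F j = 0" by blast
      have "f j a = 0" if "a \<in> L" for a
        using j that f finL n unfolding F_def by (simp add: sum_nonneg_eq_0_iff)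
      then show ?thesis using j(1) finK by (intro sum.neutral) (auto simp: prod_zero_iff)
    qed simp
    moreover have "0 \<le> (\<Prod>j\<in>K. root n (\<Sum>a\<in>L. f j a ^ n)) * root n (card L) ^ (n - card K)"
      using F0 unfolding F_def by (intro mult_nonneg_nonneg prod_nonneg zero_le_power ballI real_root_ge_zero) auto
    ultimately show ?thesis by linarith
  next
    case False
    then have L: "L \<noteq> {}" and Fp: "\<And>j. j \<in> K \<Longrightarrow> F j > 0" using F0 by force+
    define l where "l = real (card L)"
    have lp: "l > 0" unfolding l_def using L finL by (simp add: card_gt_0_iff)
    define P where "P = (\<Prod>j\<in>K. root n (F j)) * root n l ^ (n - card K)"
    have Pp: "P > 0" unfolding P_def using Fp lp n by (intro mult_pos_pos prod_pos) auto
    have pt: "real n * ((\<Prod>j\<in>K. f j a) / P) \<le> (\<Sum>j\<in>K. f j a ^ n / F j) + real (n - card K) * (1 / l)"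
      if a: "a \<in> L" for a
    proof (rule am_gm_padded[OF finK k n])
      have "P ^ n = (\<Prod>j\<in>K. F j) * l ^ (n - card K)"
      proof -
        have "P ^ n = (\<Prod>j\<in>K. root n (F j) ^ n) * (root n l ^ n) ^ (n - card K)"
          unfolding P_def by (simp add: power_mult_distrib prod_power_distrib power_mult[symmetric] mult.commute)
        then show ?thesis using Fp lp n by (simp add: less_imp_le)
      qed
      then show "((\<Prod>j\<in>K. f j a) / P) ^ n = (\<Prod>j\<in>K. f j a ^ n / F j) * (1 / l) ^ (n - card K)"
        by (simp add: power_divide prod_power_distrib prod_dividef)
    qed (use f a Fp lp in \<open>auto simp: less_imp_le\<close>)
    have "real n * ((\<Sum>a\<in>L. \<Prod>j\<in>K. f j a) / P) = (\<Sum>a\<in>L. real n * ((\<Prod>j\<in>K. f j a) / P))"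
      by (simp add: sum_distrib_left sum_divide_distrib)
    also have "\<dots> \<le> (\<Sum>a\<in>L. (\<Sum>j\<in>K. f j a ^ n / F j) + real (n - card K) * (1 / l))"
      by (intro sum_mono pt)
    also have "\<dots> = (\<Sum>j\<in>K. (\<Sum>a\<in>L. f j a ^ n) / F j) + real (n - card K)"
      using lp by (simp add: sum.distrib sum.swap[of _ K] sum_divide_distrib l_def)
    also have "\<dots> = (\<Sum>j\<in>K. 1) + real (n - card K)"
      unfolding F_def[symmetric] using Fp by (intro arg_cong2[where f = "(+)"] sum.cong) force+
    also have "\<dots> = real n" using k by simp
    finally have "real n * ((\<Sum>a\<in>L. \<Prod>j\<in>K. f j a) / P) \<le> real n * 1" by simp
    then have "(\<Sum>a\<in>L. \<Prod>j\<in>K. f j a) / P \<le> 1"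
      using n by (simp only: mult_le_cancel_left_pos of_nat_0_less_iff)
    then have "(\<Sum>a\<in>L. \<Prod>j\<in>K. f j a) \<le> P" using Pp by (simp add: field_simps)
    then show ?thesis unfolding P_def F_def l_def .
  qed
qed

text \<open>Induction on \<open>V\<close>: the coordinate \<open>v\<close> is summed out by
  Hoelder's inequality among the factors that depend on it. A vertex in fewer than \<open>n\<close>
  of the sets pays \<open>root n (card (L v))\<close> for each missing set, as if singletons
  carrying the constant function 1 had been added.\<close>

lemma Finner_root:
  fixes \<phi> :: "'j \<Rightarrow> ('v \<Rightarrow> 'b) \<Rightarrow> real"
  assumes V: "finite V" and J: "finite J" and n: "n > 0"
    and L: "\<And>v. v \<in> V \<Longrightarrow> finite (L v)"
    and S: "\<And>j. j \<in> J \<Longrightarrow> S j \<subseteq> V"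
    and pos: "\<And>j c. j \<in> J \<Longrightarrow> \<phi> j c \<ge> 0"
    and dep: "\<And>j c c'. j \<in> J \<Longrightarrow> (\<forall>v\<in>S j. c v = c' v) \<Longrightarrow> \<phi> j c = \<phi> j c'"
    and deg: "\<And>v. v \<in> V \<Longrightarrow> card {j\<in>J. v \<in> S j} \<le> n"
  shows "(\<Sum>c\<in>PiE V L. \<Prod>j\<in>J. \<phi> j c)
    \<le> (\<Prod>j\<in>J. root n (\<Sum>c\<in>PiE (S j) L. \<phi> j c ^ n)) *
      (\<Prod>v\<in>V. root n (card (L v)) ^ (n - card {j\<in>J. v \<in> S j}))"
  using V L S pos dep deg
proof (induction V arbitrary: S \<phi> rule: finite_induct)
  case empty
  have "root n (\<phi> j (\<lambda>x. undefined) ^ n) = \<phi> j (\<lambda>x. undefined)" if "j \<in> J" for j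
    using n empty.prems(3)[OF that] by (simp add: real_root_power_cancel)
  moreover have "S j = {}" if "j \<in> J" for j using empty.prems(2)[OF that] by simp
  ultimately show ?case by simp
next
  case (insert v V)
  define J1 where "J1 = {j\<in>J. v \<in> S j}"
  \<comment> \<open>A factor that depends on \<open>v\<close> is replaced by its norm in that
    coordinate; its norm over the remaining coordinates is then the full norm over
    \<open>S j\<close>.\<close>
  define \<phi>' where "\<phi>' j c = (if v \<in> S j then root n (\<Sum>a\<in>L v. \<phi> j (c(v := a)) ^ n) else \<phi> j c)" for j c
  define S' where "S' j = S j - {v}" for j
  define l where "l = root n (card (L v)) ^ (n - card J1)"
  have finL: "finite (L v)" using insert.prems(1) by simp
  have J1: "finite J1" "J1 \<subseteq> J" unfolding J1_def using J by auto
  have l0: "l \<ge> 0" unfolding l_def by (simp add: real_root_ge_zero)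
  have inner: "(\<Sum>a\<in>L v. \<Prod>j\<in>J. \<phi> j (c(v := a))) \<le> l * (\<Prod>j\<in>J. \<phi>' j c)" for c
  proof -
    have "(\<Sum>a\<in>L v. \<Prod>j\<in>J. \<phi> j (c(v := a)))
      = (\<Sum>a\<in>L v. (\<Prod>j\<in>J1. \<phi> j (c(v := a))) * (\<Prod>j\<in>J - J1. \<phi> j c))"
    proof (intro sum.cong refl)
      fix a
      have "(\<Prod>j\<in>J - J1. \<phi> j (c(v := a))) = (\<Prod>j\<in>J - J1. \<phi> j c)"
        by (intro prod.cong refl insert.prems(4)) (auto simp: J1_def)
      then show "(\<Prod>j\<in>J. \<phi> j (c(v := a))) = (\<Prod>j\<in>J1. \<phi> j (c(v := a))) * (\<Prod>j\<in>J - J1. \<phi> j c)"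
        using prod.subset_diff[OF J1(2) J, of "\<lambda>j. \<phi> j (c(v := a))"] by (simp add: mult.commute)
    qed
    also have "\<dots> = (\<Sum>a\<in>L v. \<Prod>j\<in>J1. \<phi> j (c(v := a))) * (\<Prod>j\<in>J - J1. \<phi> j c)"
      by (simp add: sum_distrib_right)
    also have "\<dots> \<le> ((\<Prod>j\<in>J1. root n (\<Sum>a\<in>L v. \<phi> j (c(v := a)) ^ n)) * l) * (\<Prod>j\<in>J - J1. \<phi> j c)"
      unfolding l_def
      using insert.prems(3,5)[of _] J1 finL n
      by (intro mult_right_mono Hoelder_sum_padded prod_nonneg) (auto simp: J1_def)
    also have "(\<Prod>j\<in>J1. root n (\<Sum>a\<in>L v. \<phi> j (c(v := a)) ^ n)) = (\<Prod>j\<in>J1. \<phi>' j c)"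
      by (intro prod.cong refl) (simp add: \<phi>'_def J1_def)
    also have "(\<Prod>j\<in>J - J1. \<phi> j c) = (\<Prod>j\<in>J - J1. \<phi>' j c)"
      by (intro prod.cong refl) (auto simp add: \<phi>'_def J1_def)
    also have "(\<Prod>j\<in>J1. \<phi>' j c) * l * (\<Prod>j\<in>J - J1. \<phi>' j c)
      = l * ((\<Prod>j\<in>J1. \<phi>' j c) * (\<Prod>j\<in>J - J1. \<phi>' j c))"
      by (simp add: mult_ac)
    also have "(\<Prod>j\<in>J1. \<phi>' j c) * (\<Prod>j\<in>J - J1. \<phi>' j c) = (\<Prod>j\<in>J. \<phi>' j c)"
      using prod.subset_diff[OF J1(2) J, of "\<lambda>j. \<phi>' j c"] by (simp add: mult.commute)
    finally show ?thesis .
  qed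
  have IH: "(\<Sum>c\<in>PiE V L. \<Prod>j\<in>J. \<phi>' j c)
    \<le> (\<Prod>j\<in>J. root n (\<Sum>c\<in>PiE (S' j) L. \<phi>' j c ^ n)) *
      (\<Prod>w\<in>V. root n (card (L w)) ^ (n - card {j\<in>J. w \<in> S' j}))"
  proof (rule insert.IH)
    fix j c c' assume j: "j \<in> J" and e: "\<forall>v\<in>S' j. c v = (c' v :: 'b)"
    have "\<phi> j (c(v := a)) = \<phi> j (c'(v := a))" for a
      using j e by (intro insert.prems(4)) (auto simp: S'_def)
    moreover have "\<phi> j c = \<phi> j c'" if "v \<notin> S j"
      using j e that by (intro insert.prems(4)) (auto simp: S'_def)
    ultimately show "\<phi>' j c = \<phi>' j c'" by (simp add: \<phi>'_def)
  next
    fix w assume "w \<in> V"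
    then have "{j\<in>J. w \<in> S' j} = {j\<in>J. w \<in> S j}" using insert.hyps by (auto simp: S'_def)
    then show "card {j\<in>J. w \<in> S' j} \<le> n" using insert.prems(5)[of w] \<open>w \<in> V\<close> by simp
  qed (use insert.prems in \<open>auto simp: S'_def \<phi>'_def intro!: sum_nonneg real_root_ge_zero zero_le_power\<close>)
  have "(\<Sum>c\<in>PiE (S' j) L. \<phi>' j c ^ n) = (\<Sum>c\<in>PiE (S j) L. \<phi> j c ^ n)" if j: "j \<in> J" for j
  proof (cases "v \<in> S j")
    case True
    have "(\<Sum>c\<in>PiE (S' j) L. \<phi>' j c ^ n) = (\<Sum>c\<in>PiE (S' j) L. \<Sum>a\<in>L v. \<phi> j (c(v := a)) ^ n)"
      using n True insert.prems(3)[OF j]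
      by (intro sum.cong refl) (simp add: \<phi>'_def sum_nonneg)
    also have "\<dots> = (\<Sum>c\<in>PiE (insert v (S' j)) L. \<phi> j c ^ n)"
      by (subst sum_PiE_insert) (auto simp: S'_def)
    finally show ?thesis using True by (simp add: S'_def insert_absorb)
  qed (simp add: \<phi>'_def S'_def)
  moreover have "{j\<in>J. w \<in> S' j} = {j\<in>J. w \<in> S j}" if "w \<in> V" for w
    using insert.hyps that by (auto simp: S'_def)
  ultimately have IH': "(\<Sum>c\<in>PiE V L. \<Prod>j\<in>J. \<phi>' j c)
    \<le> (\<Prod>j\<in>J. root n (\<Sum>c\<in>PiE (S j) L. \<phi> j c ^ n)) *
      (\<Prod>w\<in>V. root n (card (L w)) ^ (n - card {j\<in>J. w \<in> S j}))"
    using IH by (simp cong: prod.cong)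
  have "(\<Sum>c\<in>PiE (insert v V) L. \<Prod>j\<in>J. \<phi> j c) = (\<Sum>c\<in>PiE V L. \<Sum>a\<in>L v. \<Prod>j\<in>J. \<phi> j (c(v := a)))"
    using insert.hyps by (simp add: sum_PiE_insert)
  also have "\<dots> \<le> l * (\<Sum>c\<in>PiE V L. \<Prod>j\<in>J. \<phi>' j c)"
    unfolding sum_distrib_left by (intro sum_mono inner)
  also have "\<dots> \<le> l * ((\<Prod>j\<in>J. root n (\<Sum>c\<in>PiE (S j) L. \<phi> j c ^ n)) *
      (\<Prod>w\<in>V. root n (card (L w)) ^ (n - card {j\<in>J. w \<in> S j})))"
    by (intro mult_left_mono IH' l0)
  finally show ?case using insert.hyps by (simp add: l_def J1_def mult_ac)
qed

lemma Finner:
  fixes \<phi> :: "'j \<Rightarrow> ('v \<Rightarrow> 'b) \<Rightarrow> real"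
  assumes V: "finite V" and J: "finite J" and n: "n > 0"
    and L: "\<And>v. v \<in> V \<Longrightarrow> finite (L v)"
    and S: "\<And>j. j \<in> J \<Longrightarrow> S j \<subseteq> V"
    and pos: "\<And>j c. j \<in> J \<Longrightarrow> \<phi> j c \<ge> 0"
    and dep: "\<And>j c c'. j \<in> J \<Longrightarrow> (\<forall>v\<in>S j. c v = c' v) \<Longrightarrow> \<phi> j c = \<phi> j c'"
    and deg: "\<And>v. v \<in> V \<Longrightarrow> card {j\<in>J. v \<in> S j} \<le> n"
  shows "(\<Sum>c\<in>PiE V L. \<Prod>j\<in>J. \<phi> j c) ^ n
    \<le> (\<Prod>j\<in>J. \<Sum>c\<in>PiE (S j) L. \<phi> j c ^ n) *
      (\<Prod>v\<in>V. real (card (L v)) ^ (n - card {j\<in>J. v \<in> S j}))"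
proof -
  have "(\<Sum>c\<in>PiE V L. \<Prod>j\<in>J. \<phi> j c) ^ n \<le>
    ((\<Prod>j\<in>J. root n (\<Sum>c\<in>PiE (S j) L. \<phi> j c ^ n)) *
      (\<Prod>v\<in>V. root n (card (L v)) ^ (n - card {j\<in>J. v \<in> S j}))) ^ n"
    by (intro power_mono Finner_root assms sum_nonneg prod_nonneg) (use pos in auto)
  also have "\<dots> = (\<Prod>j\<in>J. root n (\<Sum>c\<in>PiE (S j) L. \<phi> j c ^ n) ^ n) *
      (\<Prod>v\<in>V. (root n (card (L v)) ^ n) ^ (n - card {j\<in>J. v \<in> S j}))"
    by (simp add: power_mult_distrib prod_power_distrib power_mult[symmetric] mult.commute)
  also have "\<dots> = (\<Prod>j\<in>J. \<Sum>c\<in>PiE (S j) L. \<phi> j c ^ n) *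
      (\<Prod>v\<in>V. real (card (L v)) ^ (n - card {j\<in>J. v \<in> S j}))"
    using n pos by (simp add: sum_nonneg)
  finally show ?thesis .
qed

section \<open>Edge isoperimetry in the cube\<close>

definition flip :: "'a \<Rightarrow> 'a set \<Rightarrow> 'a set" where
  "flip i x = (if i \<in> x then x - {i} else insert i x)"

lemma flip_flip [simp]: "flip i (flip i x) = x"
  by (auto simp: flip_def)

lemma flip_subset [simp]: "i \<in> N \<Longrightarrow> flip i x \<subseteq> N \<longleftrightarrow> x \<subseteq> N"
  by (auto simp: flip_def)

lemma flip_commute: "flip i (flip j x) = flip j (flip i x)"
  by (auto simp: flip_def)

lemma flip_neq [simp]: "flip i x \<noteq> x" "x \<noteq> flip i x"
  by (auto simp: flip_def)

lemma flip_eq_iff [simp]: "flip i x = flip j x \<longleftrightarrow> i = j"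
  by (auto simp: flip_def split: if_splits)

lemma flip_inj [simp]: "flip i x = flip i y \<longleftrightarrow> x = y"
  by (metis flip_flip)

lemma finite_flip [simp]: "finite (flip i x) \<longleftrightarrow> finite x"
  by (auto simp: flip_def)

lemma even_card_flip: "finite x \<Longrightarrow> even (card (flip i x)) \<longleftrightarrow> odd (card x)"
  by (cases "i \<in> x") (auto simp: flip_def card_gt_0_iff dest: card_Suc_Diff1)

text \<open>The inductive step of edge isoperimetry: at most \<open>b\<close> edges join two
  half-cube parts of sizes \<open>a\<close> and \<open>b\<close>, counted from both ends as
  \<open>2 * b\<close>. One \<open>b\<close> comes from \<open>log 2 (1 + t) \<ge> t\<close> on the
  unit interval, by concavity, the other from \<open>2 * b \<le> a + b\<close>.\<close>

lemma log_superadd: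
  fixes a b :: real
  assumes "0 < b" "b \<le> a"
  shows "a * log 2 a + b * log 2 b + 2 * b \<le> (a + b) * log 2 (a + b)"
proof -
  define t where "t = b / a"
  have t: "0 < t" "t \<le> 1" using assms by (auto simp: t_def)
  have "ln (1 + t) \<ge> t * ln 2"
  proof -
    have "concave_on {0<..} ln" by (rule ln_concave)
    then have "(1 - t) * ln 1 + t * ln 2 \<le> ln ((1 - t) *\<^sub>R 1 + t *\<^sub>R (2::real))"
      using t by (intro concave_onD) auto
    then show ?thesis by (simp add: algebra_simps)
  qed
  then have "log 2 (1 + t) \<ge> t" by (simp add: log_def field_simps)
  moreover have "log 2 (a + b) = log 2 a + log 2 (1 + t)"
  proof -
    have "a + b = a * (1 + t)" using assms by (simp add: t_def field_simps)
    then show ?thesis using assms t by (simp add: log_mult)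
  qed
  ultimately have "a * (log 2 (a + b) - log 2 a) \<ge> a * t"
    using assms by (simp add: mult_left_mono)
  then have 1: "a * log 2 (a + b) \<ge> a * log 2 a + b" using assms by (simp add: t_def algebra_simps)
  have "log 2 (2 * b) \<le> log 2 (a + b)" using assms by (subst log_le_cancel_iff) auto
  then have "1 + log 2 b \<le> log 2 (a + b)" using assms by (simp add: log_mult)
  then have "b * (1 + log 2 b) \<le> b * log 2 (a + b)" using assms by (intro mult_left_mono) auto
  with 1 show ?thesis by (simp add: algebra_simps)
qed

text \<open>The sum counts every edge inside \<open>S\<close> from both ends. Split \<open>S\<close>
  by the coordinate \<open>k\<close>; the upper part is moved down to \<open>T\<close> so that the
  induction hypothesis applies to both parts, and the edges in direction \<open>k\<close> number at
  most the size of the smaller part.\<close>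

lemma edge_isoperimetry:
  assumes "finite D" "S \<subseteq> Pow D" "S \<noteq> {}"
  shows "(\<Sum>i\<in>D. real (card {x\<in>S. flip i x \<in> S})) \<le> card S * log 2 (card S)"
  using assms
proof (induction D arbitrary: S rule: finite_induct)
  case empty
  then have "S = {{}}" by auto
  then show ?case by simp
next
  case (insert k D)
  define S0 where "S0 = {x\<in>S. k \<notin> x}"
  define S1 where "S1 = {x\<in>S. k \<in> x}"
  define T where "T = flip k ` S1"
  have finS: "finite S" using insert.prems(1) insert.hyps(1)
    by (meson finite_Pow_iff finite_insert finite_subset)
  have fin: "finite S0" "finite S1" "finite T" using finS by (auto simp: S0_def S1_def T_def)
  have S: "S = S0 \<union> S1" "S0 \<inter> S1 = {}" by (auto simp: S0_def S1_def)
  have cT: "card T = card S1" unfolding T_def by (intro card_image inj_onI) simp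
  have S0D: "S0 \<subseteq> Pow D" using insert.prems(1) by (auto simp: S0_def)
  have TD: "T \<subseteq> Pow D" using insert.prems(1) by (auto simp: T_def S1_def flip_def)
  have cS: "card S = card S0 + card S1" using S fin by (simp add: card_Un_disjoint)
  have main: "(\<Sum>i\<in>D. real (card {x\<in>S. flip i x \<in> S}))
    = (\<Sum>i\<in>D. real (card {x\<in>S0. flip i x \<in> S0})) + (\<Sum>i\<in>D. real (card {x\<in>T. flip i x \<in> T}))"
  proof -
    have "card {x\<in>S. flip i x \<in> S} = card {x\<in>S0. flip i x \<in> S0} + card {x\<in>T. flip i x \<in> T}"
      if "i \<in> D" for i
    proof -
      have ik: "i \<noteq> k" using that insert.hyps by auto
      have kf: "k \<in> flip i x \<longleftrightarrow> k \<in> x" for x using ik by (auto simp: flip_def)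
      have "{x\<in>T. flip i x \<in> T} = flip k ` {x\<in>S1. flip i x \<in> S1}"
        by (auto simp: T_def image_iff flip_commute[of i k])
      then have "card {x\<in>T. flip i x \<in> T} = card {x\<in>S1. flip i x \<in> S1}"
        by (simp add: card_image inj_on_def)
      moreover have "{x\<in>S. flip i x \<in> S} = {x\<in>S0. flip i x \<in> S0} \<union> {x\<in>S1. flip i x \<in> S1}"
        by (auto simp: S0_def S1_def kf)
      moreover have "card ({x\<in>S0. flip i x \<in> S0} \<union> {x\<in>S1. flip i x \<in> S1})
        = card {x\<in>S0. flip i x \<in> S0} + card {x\<in>S1. flip i x \<in> S1}"
        using fin S by (intro card_Un_disjoint) auto
      ultimately show ?thesis by simp
    qed
    then show ?thesis by (simp add: sum.distrib)
  qed
  have k: "card {x\<in>S. flip k x \<in> S} \<le> 2 * min (card S0) (card S1)"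
  proof -
    let ?A = "{x\<in>S0. flip k x \<in> S1}" and ?B = "{x\<in>S1. flip k x \<in> S0}"
    have e: "{x\<in>S. flip k x \<in> S} = ?A \<union> ?B" by (auto simp: S0_def S1_def flip_def split: if_splits)
    have AB: "?B = flip k ` ?A" by (auto simp: image_iff) (metis flip_flip)
    have "card ?B = card ?A" unfolding AB by (simp add: card_image inj_on_def)
    moreover have "card ?A \<le> card S0" "card ?B \<le> card S1" using fin by (auto intro: card_mono)
    ultimately show ?thesis unfolding e using card_Un_le[of ?A ?B] by linarith
  qed
  have bd: "(\<Sum>i\<in>D. real (card {x\<in>X. flip i x \<in> X})) \<le> card X * log 2 (card X)"
    if "X \<subseteq> Pow D" for X
    using insert.IH[OF that] by (cases "X = {}") auto
  have "(\<Sum>i\<in>insert k D. real (card {x\<in>S. flip i x \<in> S}))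
    \<le> card S0 * log 2 (card S0) + card S1 * log 2 (card S1) + 2 * min (real (card S0)) (card S1)"
    using bd[OF S0D] bd[OF TD] k insert.hyps main cT by simp
  also have "\<dots> \<le> card S * log 2 (card S)"
  proof -
    consider "card S0 = 0" | "card S1 = 0" | "0 < card S1" "card S1 \<le> card S0"
      | "0 < card S0" "card S0 \<le> card S1" by linarith
    then show ?thesis
    proof cases
      case 3 then show ?thesis using log_superadd[of "card S1" "card S0"] cS by (simp add: min.absorb2)
    next
      case 4 then show ?thesis using log_superadd[of "card S0" "card S1"] cS by (simp add: min.absorb1 add_ac)
    qed (simp_all add: cS)
  qed
  finally show ?case .
qed

text \<open>A set of at most half the cube has \<open>log 2 (card S) \<le> card D - 1\<close>, so on
  average each of its points has at least one neighbour outside. Both the boundaries of phases in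
  \<open>D\<close> and the changes of labels in \<open>M\<close> are estimated in this form.\<close>

lemma card_sub_cube_le:
  assumes "finite D" "S \<subseteq> Pow D" "card S \<le> 2 ^ card D / (2::real)"
  shows "real (card S) \<le> (\<Sum>i\<in>D. real (card {x\<in>S. flip i x \<notin> S}))"
proof (cases "S = {}")
  case False
  have finS: "finite S" using assms by (meson finite_Pow_iff finite_subset)
  have c: "real (card {x\<in>S. flip i x \<notin> S}) = card S - real (card {x\<in>S. flip i x \<in> S})" for i
  proof -
    have "card S = card ({x\<in>S. flip i x \<notin> S} \<union> {x\<in>S. flip i x \<in> S})" by (rule arg_cong[of _ _ card]) auto
    also have "\<dots> = card {x\<in>S. flip i x \<notin> S} + card {x\<in>S. flip i x \<in> S}"
      using finS by (intro card_Un_disjoint) auto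
    finally show ?thesis by simp
  qed
  have cS: "card S > 0" using False finS by (simp add: card_gt_0_iff)
  have "log 2 (card S) \<le> log 2 (2 ^ card D / 2)"
    using cS assms(3) by (subst log_le_cancel_iff) auto
  also have "\<dots> = real (card D) - 1" by (simp add: log_divide log_nat_power)
  finally have "card S * log 2 (card S) \<le> card S * (real (card D) - 1)" by (intro mult_left_mono) auto
  then show ?thesis
    using edge_isoperimetry[OF assms(1,2) False] by (simp add: c sum_subtractf algebra_simps)
qed simp

section \<open>Connected sets and polymer sums\<close>

text \<open>Formulated by cuts instead of paths, because connectivity is obtained from a minimal
  closed set in \<open>ex_component\<close> and passed from a set to its container in
  \<open>container_connected_by\<close>.\<close>

definition connected_by :: "('a \<Rightarrow> 'a \<Rightarrow> bool) \<Rightarrow> 'a set \<Rightarrow> bool" where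
  "connected_by R A \<longleftrightarrow> (\<forall>B. B \<subseteq> A \<longrightarrow> B \<noteq> {} \<longrightarrow> B \<noteq> A \<longrightarrow> (\<exists>b\<in>B. \<exists>x\<in>A - B. R b x))"

text \<open>A new vertex \<open>x\<close> adjacent to a visited \<open>b\<close> is reached by the
  detour \<open>b, x, b\<close>, which adds two entries to the walk and one vertex to its
  range.\<close>

lemma connected_by_walk:
  assumes v: "v \<in> A" and conn: "connected_by R A" and sym: "\<And>x y. R x y \<Longrightarrow> R y x"
    and k: "1 \<le> k" "k \<le> card A"
  shows "\<exists>xs. length xs = 2 * k - 1 \<and> xs \<noteq> [] \<and> hd xs = v \<and> set xs \<subseteq> A \<and> card (set xs) = k \<and> successively R xs"
  using k
proof (induction k rule: dec_induct)
  case base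
  show ?case using v by (intro exI[of _ "[v]"]) auto
next
  case (step k)
  then obtain xs where xs: "length xs = 2 * k - 1" "xs \<noteq> []" "hd xs = v" "set xs \<subseteq> A"
    "card (set xs) = k" "successively R xs" by auto
  have "set xs \<noteq> A" using xs step by auto
  then obtain b x where b: "b \<in> set xs" and x: "x \<in> A - set xs" and R: "R b x"
    using conn xs unfolding connected_by_def by (metis set_empty)
  obtain ys zs where e: "xs = ys @ b # zs" using b by (meson split_list)
  let ?xs = "ys @ b # x # b # zs"
  have "successively R ?xs"
    using xs(6) R sym unfolding e by (auto simp: successively_append_iff successively_Cons)
  moreover have "length ?xs = 2 * Suc k - 1" using xs(1) step.hyps unfolding e by simp
  moreover have "set ?xs = insert x (set xs)" unfolding e by auto
  moreover have "card (insert x (set xs)) = Suc k" using x xs(5) by simp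
  moreover have "hd ?xs = v" using xs(3) unfolding e by (cases ys) auto
  ultimately show ?case using x xs(4) by (intro exI[of _ ?xs]) auto
qed

lemma card_walks_le:
  assumes fin: "finite V" and deg: "\<And>x. x \<in> V \<Longrightarrow> card {y\<in>V. R x y} \<le> \<Delta>"
  shows "v \<in> V \<Longrightarrow> card {xs. length xs = Suc l \<and> hd xs = v \<and> set xs \<subseteq> V \<and> successively R xs} \<le> \<Delta> ^ l"
proof (induction l arbitrary: v)
  case 0
  have "{xs. length xs = Suc 0 \<and> hd xs = v \<and> set xs \<subseteq> V \<and> successively R xs} \<subseteq> {[v]}"
    by (auto simp: length_Suc_conv)
  from card_mono[OF _ this] show ?case by simp
next
  case (Suc l)
  let ?W = "\<lambda>v l. {xs. length xs = Suc l \<and> hd xs = v \<and> set xs \<subseteq> V \<and> successively R xs}"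
  have finW: "finite (?W w l)" for w
    by (rule finite_subset[OF _ finite_lists_length_eq[OF fin, of "Suc l"]]) auto
  have sub: "?W v (Suc l) \<subseteq> (\<Union>w\<in>{y\<in>V. R v y}. (#) v ` ?W w l)"
  proof
    fix xs assume "xs \<in> ?W v (Suc l)"
    then have xs: "length xs = Suc (Suc l)" "hd xs = v" "set xs \<subseteq> V" "successively R xs" by auto
    then obtain w ys where e: "xs = v # w # ys" by (auto simp: length_Suc_conv)
    then have "w # ys \<in> ?W w l" "R v w" "w \<in> V" using xs by (auto simp: successively_Cons)
    then show "xs \<in> (\<Union>w\<in>{y\<in>V. R v y}. (#) v ` ?W w l)" using e by blast
  qed
  have "card (?W v (Suc l)) \<le> card (\<Union>w\<in>{y\<in>V. R v y}. (#) v ` ?W w l)"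
    using finW fin by (intro card_mono sub) auto
  also have "\<dots> \<le> (\<Sum>w\<in>{y\<in>V. R v y}. card ((#) v ` ?W w l))"
    using fin by (intro card_UN_le) auto
  also have "\<dots> \<le> (\<Sum>w\<in>{y\<in>V. R v y}. \<Delta> ^ l)"
    using Suc.IH finW by (intro sum_mono order.trans[OF card_image_le]) auto
  also have "\<dots> \<le> \<Delta> * \<Delta> ^ l" using deg[OF Suc.prems] by simp
  finally show ?case by simp
qed

text \<open>A connected set of size \<open>k\<close> is the range of a walk with \<open>2 k - 2\<close> steps.\<close>

lemma card_connected_by_le:
  assumes fin: "finite V" and deg: "\<And>x. x \<in> V \<Longrightarrow> card {y\<in>V. R x y} \<le> \<Delta>"
    and sym: "\<And>x y. R x y \<Longrightarrow> R y x" and k: "k > 0"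
  shows "card {A. A \<subseteq> V \<and> connected_by R A \<and> card A = k} \<le> card V * \<Delta> ^ (2 * k - 2)"
proof -
  let ?W = "\<lambda>v. {xs. length xs = Suc (2 * k - 2) \<and> hd xs = v \<and> set xs \<subseteq> V \<and> successively R xs}"
  have finW: "finite (?W w)" for w
    by (rule finite_subset[OF _ finite_lists_length_eq[OF fin, of "Suc (2 * k - 2)"]]) auto
  have sub: "{A. A \<subseteq> V \<and> connected_by R A \<and> card A = k} \<subseteq> (\<Union>v\<in>V. set ` ?W v)"
  proof
    fix A assume "A \<in> {A. A \<subseteq> V \<and> connected_by R A \<and> card A = k}"
    then have A: "A \<subseteq> V" "connected_by R A" "card A = k" by auto
    then obtain v where v: "v \<in> A" using k by (metis card.empty ex_in_conv less_numeral_extra(3))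
    have finA: "finite A" using A fin finite_subset by blast
    obtain xs where xs: "length xs = 2 * k - 1" "hd xs = v" "set xs \<subseteq> A" "card (set xs) = k" "successively R xs"
      using connected_by_walk[OF v A(2) sym, of k] k A(3) by (metis One_nat_def Suc_leI order_refl)
    then have "set xs = A" using A(3) finA by (metis card_subset_eq)
    moreover have "2 * k - 1 = Suc (2 * k - 2)" using k by simp
    ultimately have "xs \<in> ?W v" "A = set xs" using xs A(1) by auto
    moreover have "v \<in> V" using v A(1) by auto
    ultimately show "A \<in> (\<Union>v\<in>V. set ` ?W v)" by (intro UN_I image_eqI)
  qed
  have "card {A. A \<subseteq> V \<and> connected_by R A \<and> card A = k} \<le> card (\<Union>v\<in>V. set ` ?W v)"
    using finW fin by (intro card_mono sub) auto
  also have "\<dots> \<le> (\<Sum>v\<in>V. card (set ` ?W v))"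
    using fin by (intro card_UN_le) auto
  also have "\<dots> \<le> (\<Sum>v\<in>V. \<Delta> ^ (2 * k - 2))"
    using finW card_walks_le[OF fin deg, where l = "2 * k - 2"]
    by (intro sum_mono order.trans[OF card_image_le]) auto
  finally show ?thesis by simp
qed

text \<open>The component is a smallest set that contains \<open>v\<close> and has no edge to the
  rest of \<open>A\<close>. If some \<open>B\<close> cut it without an edge, then \<open>B\<close>
  or \<open>C - B\<close>, whichever contains \<open>v\<close>, would be a smaller such set.\<close>

lemma ex_component:
  assumes fin: "finite A" and v: "v \<in> A" and sym: "\<And>x y. R x y \<Longrightarrow> R y x"
  obtains C where "C \<subseteq> A" "v \<in> C" "connected_by R C" "\<And>b x. b \<in> C \<Longrightarrow> x \<in> A - C \<Longrightarrow> \<not> R b x"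
proof -
  define P where "P C \<longleftrightarrow> C \<subseteq> A \<and> v \<in> C \<and> (\<forall>b\<in>C. \<forall>x\<in>A - C. \<not> R b x)" for C
  have "P A" using v by (simp add: P_def)
  then obtain C where C: "P C" and min: "\<And>B. P B \<Longrightarrow> card C \<le> card B"
    using arg_min_nat_lemma[of P A card] by metis
  have "connected_by R C"
    unfolding connected_by_def
  proof (intro allI impI, rule ccontr)
    fix B assume B: "B \<subseteq> C" "B \<noteq> {}" "B \<noteq> C" and no: "\<not> (\<exists>b\<in>B. \<exists>x\<in>C - B. R b x)"
    have finC: "finite C" using C fin finite_subset unfolding P_def by blast
    show False
    proof (cases "v \<in> B")
      case True
      then have "P B" using C B no unfolding P_def by blast
      then show False using min[of B] psubset_card_mono[OF finC, of B] B by auto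
    next
      case False
      have "P (C - B)"
        using C False B no sym unfolding P_def by blast
      then show False using min[of "C - B"] psubset_card_mono[OF finC, of "C - B"] B by auto
    qed
  qed
  then show ?thesis using that C unfolding P_def by blast
qed

text \<open>Induction on \<open>X\<close>. A set containing \<open>v\<close> splits into the
  component \<open>C\<close> of \<open>v\<close> and a rest that does not touch \<open>C\<close>.
  Letting the rest range over all admissible subsets of \<open>X\<close> only enlarges the sum, so
  the new vertex costs a factor of 1 plus the weight of all polymers through \<open>v\<close>, which
  is at most the exponential of that weight.\<close>

lemma polymer_sum_le:
  fixes W :: "'a set \<Rightarrow> real"
  assumes fin: "finite X" and sym: "\<And>x y. R x y \<Longrightarrow> R y x"
    and pos: "\<And>A. W A \<ge> 0" and empty: "W {} \<le> 1"
    and mult: "\<And>C B. C \<subseteq> X \<Longrightarrow> B \<subseteq> X \<Longrightarrow> C \<inter> B = {} \<Longrightarrow> (\<And>b x. b \<in> C \<Longrightarrow> x \<in> B \<Longrightarrow> \<not> R b x) \<Longrightarrow>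
      W (C \<union> B) \<le> W C * W B"
  shows "(\<Sum>A | A \<subseteq> X \<and> card A \<le> \<Theta>. W A) \<le> exp (\<Sum>C | C \<subseteq> X \<and> C \<noteq> {} \<and> connected_by R C \<and> card C \<le> \<Theta>. W C)"
  using fin mult
proof (induction X rule: finite_induct)
  case empty
  have 1: "{A. A \<subseteq> {} \<and> card A \<le> \<Theta>} = {{}}" by auto
  have 2: "{C. C \<subseteq> {} \<and> C \<noteq> {} \<and> connected_by R C \<and> card C \<le> \<Theta>} = {}" by auto
  show ?case unfolding 1 2 using assms(4) by simp
next
  case (insert v X)
  let ?Z = "\<lambda>X. {A. A \<subseteq> X \<and> card A \<le> \<Theta>}"
  let ?S = "\<lambda>X. {C. C \<subseteq> X \<and> C \<noteq> {} \<and> connected_by R C \<and> card C \<le> \<Theta>}"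
  let ?T = "{C. C \<subseteq> insert v X \<and> v \<in> C \<and> connected_by R C \<and> card C \<le> \<Theta>}"
  have finZ: "finite (?Z Y)" "finite (?S Y)" if "finite Y" for Y :: "'a set"
    using that by (auto intro: finite_subset[of _ "Pow Y"])
  have finT: "finite ?T" using insert.hyps(1) by (auto intro: finite_subset[of _ "Pow (insert v X)"])
  have IH: "(\<Sum>A\<in>?Z X. W A) \<le> exp (\<Sum>C\<in>?S X. W C)"
    using insert.prems by (intro insert.IH) auto
  have "(\<Sum>A\<in>?Z (insert v X). W A) = (\<Sum>A\<in>?Z X. W A) + (\<Sum>A | A \<in> ?Z (insert v X) \<and> v \<in> A. W A)"
    using insert.hyps finZ(1)[of "insert v X"] finZ(1)[of X]
    by (subst sum.union_disjoint[symmetric]) (auto intro!: sum.cong)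
  also have "(\<Sum>A | A \<in> ?Z (insert v X) \<and> v \<in> A. W A) \<le> (\<Sum>(C, B)\<in>?T \<times> ?Z X. W C * W B)"
  proof (rule sum_le_included[where i = "\<lambda>(C, B). C \<union> B"])
    show "\<forall>A\<in>{A. A \<in> ?Z (insert v X) \<and> v \<in> A}. \<exists>y\<in>?T \<times> ?Z X.
      (case y of (C, B) \<Rightarrow> C \<union> B) = A \<and> W A \<le> (case y of (C, B) \<Rightarrow> W C * W B)"
    proof
      fix A assume "A \<in> {A. A \<in> ?Z (insert v X) \<and> v \<in> A}"
      then have A: "A \<subseteq> insert v X" "card A \<le> \<Theta>" "v \<in> A" by auto
      have finA: "finite A" using A(1) insert.hyps(1) by (meson finite_insert finite_subset)
      obtain C where C: "C \<subseteq> A" "v \<in> C" "connected_by R C" "\<And>b x. b \<in> C \<Longrightarrow> x \<in> A - C \<Longrightarrow> \<not> R b x"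
        using ex_component[OF finA A(3), where R = R] sym by metis
      have "card C \<le> \<Theta>" "card (A - C) \<le> \<Theta>"
        using card_mono[OF finA C(1)] card_mono[OF finA, of "A - C"] A(2) by auto
      moreover have "W A \<le> W C * W (A - C)"
        using insert.prems[of C "A - C"] C A(1) by (auto simp: Un_absorb1)
      ultimately show "\<exists>y\<in>?T \<times> ?Z X. (case y of (C, B) \<Rightarrow> C \<union> B) = A \<and> W A \<le> (case y of (C, B) \<Rightarrow> W C * W B)"
        using C A(1) by (intro bexI[of _ "(C, A - C)"]) auto
    qed
  next
    show "finite {A. A \<in> ?Z (insert v X) \<and> v \<in> A}"
      using finZ(1)[of "insert v X"] insert.hyps(1) by simp
    show "finite (?T \<times> ?Z X)" using finT finZ(1)[of X] insert.hyps(1) by blast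
    show "\<forall>y\<in>?T \<times> ?Z X. 0 \<le> (case y of (C, B) \<Rightarrow> W C * W B)" using pos by auto
  qed
  also have "\<dots> = (\<Sum>C\<in>?T. W C) * (\<Sum>A\<in>?Z X. W A)"
    by (simp add: sum_product sum.cartesian_product)
  also have "(\<Sum>A\<in>?Z X. W A) + (\<Sum>C\<in>?T. W C) * (\<Sum>A\<in>?Z X. W A)
    = (1 + (\<Sum>C\<in>?T. W C)) * (\<Sum>A\<in>?Z X. W A)" by (simp add: algebra_simps)
  also have "\<dots> \<le> exp (\<Sum>C\<in>?T. W C) * exp (\<Sum>C\<in>?S X. W C)"
    using pos by (intro mult_mono IH exp_ge_add_one_self) (auto intro!: sum_nonneg)
  also have "\<dots> = exp ((\<Sum>C\<in>?T. W C) + (\<Sum>C\<in>?S X. W C))" by (simp add: exp_add)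
  also have "(\<Sum>C\<in>?T. W C) + (\<Sum>C\<in>?S X. W C) = (\<Sum>C\<in>?S (insert v X). W C)"
    using insert.hyps finT finZ(2)[of X] by (subst sum.union_disjoint[symmetric]) (auto intro!: sum.cong)
  finally show ?case by simp
qed

section \<open>Sparse deviations from a phase\<close>

lemma card_UNIV3 [simp]: "card (UNIV :: 3 set) = 3" by simp

lemma card_Compl3: "card (- A :: 3 set) = 3 - card A"
  by (simp add: Compl_eq_Diff_UNIV card_Diff_subset)

text \<open>This is the factor that one vertex contributes to Finner's inequality. For each colour
  \<open>e\<close>, the colouring constantly \<open>e\<close> has weight 1, and the at most
  \<open>2 ^ card X\<close> colourings avoiding \<open>e\<close> have weight
  \<open>(1 / 2) ^ card X\<close> when a single choice remains. This gives 3 + 3, one unit for each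
  phase.\<close>

lemma sum_free_colours_le:
  fixes X :: "'a set"
  assumes X: "finite X" "X \<noteq> {}"
  shows "(\<Sum>c\<in>PiE X (\<lambda>_. UNIV :: 3 set). (real (card (- c ` X)) / 2) ^ card X) \<le> 6"
proof -
  let ?P = "PiE X (\<lambda>_. UNIV :: 3 set)"
  let ?n = "card X"
  have finP: "finite ?P" using X by (simp add: finite_PiE)
  have n: "?n > 0" using X by (simp add: card_gt_0_iff)
  have pt: "(real (card (- c ` X)) / 2) ^ ?n \<le>
    (\<Sum>e\<in>(UNIV::3 set). (if c ` X = {e} then 1 else 0) + (if e \<notin> c ` X then (1 / 2) ^ ?n else 0))" for c :: "'a \<Rightarrow> 3"
  proof -
    have ne: "c ` X \<noteq> {}" "finite (c ` X)" using X by auto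
    have "card (c ` X) \<ge> 1" using ne by (simp add: Suc_le_eq card_gt_0_iff)
    then have le: "card (- c ` X) \<le> 2" by (simp add: card_Compl3)
    consider "card (- c ` X) = 0" | "card (- c ` X) = 1" | "card (- c ` X) = 2" using le by linarith
    then show ?thesis
    proof cases
      case 1
      then show ?thesis using n by (simp add: sum_nonneg zero_power)
    next
      case 2
      then obtain e where "e \<notin> c ` X" by (metis card.empty equals0I one_neq_zero ComplD)
      then have "(1 / 2 :: real) ^ ?n \<le> (if c ` X = {e} then 1 else 0) + (if e \<notin> c ` X then (1 / 2) ^ ?n else 0)"
        by simp
      also have "\<dots> \<le> (\<Sum>e\<in>(UNIV::3 set). (if c ` X = {e} then 1 else 0) + (if e \<notin> c ` X then (1 / 2) ^ ?n else 0))"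
        by (rule member_le_sum) auto
      finally show ?thesis using 2 by simp
    next
      case 3
      then have "card (c ` X) = 1" by (simp add: card_Compl3)
      then obtain e where e: "c ` X = {e}" by (auto simp: card_1_singleton_iff)
      have "(1::real) \<le> (if c ` X = {e} then 1 else 0) + (if e \<notin> c ` X then (1 / 2) ^ ?n else 0)"
        using e by simp
      also have "\<dots> \<le> (\<Sum>e\<in>(UNIV::3 set). (if c ` X = {e} then 1 else 0) + (if e \<notin> c ` X then (1 / 2) ^ ?n else 0))"
        by (rule member_le_sum) auto
      finally show ?thesis using 3 by simp
    qed
  qed
  have s1: "(\<Sum>c\<in>?P. if c ` X = {e} then 1 else 0) \<le> (1 :: real)" for e
  proof -
    have "{c\<in>?P. c ` X = {e}} \<subseteq> {\<lambda>x\<in>X. e}" by (fastforce simp: PiE_iff extensional_def fun_eq_iff)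
    then have "card {c\<in>?P. c ` X = {e}} \<le> card {\<lambda>x\<in>X. e}" by (rule card_mono[rotated]) simp
    then show ?thesis using finP by (simp add: sum.If_cases Int_def)
  qed
  have s2: "(\<Sum>c\<in>?P. if e \<notin> c ` X then (1 / 2) ^ ?n else 0) \<le> (1 :: real)" for e
  proof -
    have "{c\<in>?P. e \<notin> c ` X} \<subseteq> PiE X (\<lambda>_. - {e})" by (auto simp: PiE_iff extensional_def)
    then have "card {c\<in>?P. e \<notin> c ` X} \<le> card (PiE X (\<lambda>_. - {e}))"
      using X by (intro card_mono finite_PiE) auto
    also have "\<dots> = 2 ^ ?n" using X by (simp add: card_PiE card_Compl3)
    finally have "real (card {c\<in>?P. e \<notin> c ` X}) \<le> real (2 ^ ?n)" by (simp only: of_nat_le_iff)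
    then have "real (card {c\<in>?P. e \<notin> c ` X}) \<le> 2 ^ ?n" by simp
    then show ?thesis using finP by (simp add: sum.If_cases Int_def power_divide divide_le_eq)
  qed
  have "(\<Sum>c\<in>?P. (real (card (- c ` X)) / 2) ^ ?n) \<le>
    (\<Sum>c\<in>?P. \<Sum>e\<in>(UNIV::3 set). (if c ` X = {e} then 1 else 0) + (if e \<notin> c ` X then (1 / 2) ^ ?n else 0))"
    by (intro sum_mono pt)
  also have "\<dots> = (\<Sum>e\<in>(UNIV::3 set). (\<Sum>c\<in>?P. if c ` X = {e} then 1 else 0) + (\<Sum>c\<in>?P. if e \<notin> c ` X then (1 / 2) ^ ?n else 0))"
    by (subst sum.swap) (simp add: sum.distrib)
  also have "\<dots> \<le> (\<Sum>e\<in>(UNIV::3 set). 1 + 1)"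
    using s1 s2 by (intro sum_mono add_mono) auto
  finally show ?thesis by simp
qed

text \<open>Used for two graphs: the whole cube, with \<open>V\<close> the class that the phase
  colours constantly and \<open>U\<close> the free class, and later the cube over \<open>D\<close>,
  whose vertices carry entire slices.\<close>

locale bip_graph =
  fixes V U :: "'a set" and nb :: "'a \<Rightarrow> 'a set" and n :: nat
  assumes finV: "finite V" and finU: "finite U" and disj: "V \<inter> U = {}"
    and nbV: "v \<in> V \<Longrightarrow> nb v \<subseteq> U" and nbU: "u \<in> U \<Longrightarrow> nb u \<subseteq> V"
    and nb_sym: "v \<in> V \<Longrightarrow> u \<in> U \<Longrightarrow> u \<in> nb v \<longleftrightarrow> v \<in> nb u"
    and deg: "x \<in> V \<union> U \<Longrightarrow> card (nb x) = n" and npos: "n > 0"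
begin

lemma fin_nb: "x \<in> V \<union> U \<Longrightarrow> finite (nb x)"
  using deg npos by (metis card.infinite less_numeral_extra(3))

lemma sum_deg:
  assumes "S \<subseteq> V" "F \<subseteq> U"
  shows "(\<Sum>v\<in>S. card (nb v \<inter> F)) = (\<Sum>u\<in>F. card (nb u \<inter> S))"
proof -
  have fin: "finite S" "finite F" using assms finV finU finite_subset by auto
  have "(\<Sum>v\<in>S. card (nb v \<inter> F)) = (\<Sum>v\<in>S. \<Sum>u\<in>F. if u \<in> nb v then 1 else 0)"
    using fin by (intro sum.cong refl) (simp add: sum.If_cases Int_commute)
  also have "\<dots> = (\<Sum>u\<in>F. \<Sum>v\<in>S. if v \<in> nb u then 1 else 0)"
    using nb_sym assms by (subst sum.swap) (intro sum.cong refl, auto)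
  also have "\<dots> = (\<Sum>u\<in>F. card (nb u \<inter> S))"
    using fin by (intro sum.cong refl) (simp add: sum.If_cases Int_commute)
  finally show ?thesis .
qed

definition Nbs :: "'a set \<Rightarrow> 'a set" where "Nbs A = (\<Union>v\<in>A. nb v)"

text \<open>Deviations at two vertices influence each other only through a common neighbour, whose
  choices both restrict. Hence the polymers are the components for this relation.\<close>

definition R2 :: "'a \<Rightarrow> 'a \<Rightarrow> bool" where
  "R2 v w \<longleftrightarrow> v \<in> V \<and> w \<in> V \<and> nb v \<inter> nb w \<noteq> {}"

text \<open>A container retains only some vertices of its polymer; retained vertices on the two
  sides of a cut can be joined within three steps of \<open>R2\<close>.\<close>

definition R6 :: "'a \<Rightarrow> 'a \<Rightarrow> bool" where
  "R6 v w \<longleftrightarrow> (\<exists>x y. R2 v x \<and> R2 x y \<and> R2 y w)"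

lemma R2_sym: "R2 v w \<Longrightarrow> R2 w v" by (auto simp: R2_def)

lemma R6_sym: "R6 v w \<Longrightarrow> R6 w v" using R2_sym unfolding R6_def by blast

lemma R2_refl: "v \<in> V \<Longrightarrow> R2 v v"
  using deg[of v] npos by (auto simp: R2_def)

lemma card_R2_le: "card {w. R2 v w} \<le> n\<^sup>2"
proof (cases "v \<in> V")
  case True
  have "{w. R2 v w} \<subseteq> (\<Union>u\<in>nb v. nb u)"
    using nb_sym nbV unfolding R2_def by blast
  moreover have fin: "finite (\<Union>u\<in>nb v. nb u)" using True nbV fin_nb by blast
  ultimately have "card {w. R2 v w} \<le> card (\<Union>u\<in>nb v. nb u)" by (simp add: card_mono)
  also have "\<dots> \<le> (\<Sum>u\<in>nb v. card (nb u))" using True fin_nb by (intro card_UN_le) auto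
  also have "\<dots> = (\<Sum>u\<in>nb v. n)" using True nbV[OF True] deg by (intro sum.cong) auto
  also have "\<dots> = n\<^sup>2" using deg True by (simp add: power2_eq_square)
  finally show ?thesis .
qed (simp add: R2_def)

lemma finite_R2: "finite {w. R2 v w}"
  by (rule finite_subset[OF _ finV]) (auto simp: R2_def)

lemma card_R6_le: "card {w\<in>V. R6 v w} \<le> n ^ 6"
proof -
  have "{w\<in>V. R6 v w} \<subseteq> (\<Union>x\<in>{x. R2 v x}. \<Union>y\<in>{y. R2 x y}. {w. R2 y w})"
    by (auto simp: R6_def)
  then have "card {w\<in>V. R6 v w} \<le> card (\<Union>x\<in>{x. R2 v x}. \<Union>y\<in>{y. R2 x y}. {w. R2 y w})"
    using finite_R2 by (intro card_mono) auto
  also have "\<dots> \<le> (\<Sum>x\<in>{x. R2 v x}. card (\<Union>y\<in>{y. R2 x y}. {w. R2 y w}))"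
    using finite_R2 by (intro card_UN_le) auto
  also have "\<dots> \<le> (\<Sum>x\<in>{x. R2 v x}. \<Sum>y\<in>{y. R2 x y}. card {w. R2 y w})"
    using finite_R2 by (intro sum_mono card_UN_le) auto
  also have "\<dots> \<le> (\<Sum>x\<in>{x. R2 v x}. \<Sum>y\<in>{y. R2 x y}. n\<^sup>2)"
    using card_R2_le by (intro sum_mono)
  also have "\<dots> \<le> (\<Sum>x\<in>{x. R2 v x}. n\<^sup>2 * n\<^sup>2)"
  proof (intro sum_mono)
    fix x
    show "(\<Sum>y\<in>{y. R2 x y}. n\<^sup>2) \<le> n\<^sup>2 * n\<^sup>2"
      using mult_le_mono1[OF card_R2_le[of x], of "n\<^sup>2"] by simp
  qed
  also have "\<dots> \<le> n\<^sup>2 * (n\<^sup>2 * n\<^sup>2)"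
    using mult_le_mono1[OF card_R2_le[of v], of "n\<^sup>2 * n\<^sup>2"] by simp
  finally show ?thesis by (simp add: power_add[symmetric])
qed

text \<open>Outside \<open>A\<close> the vertices of \<open>V\<close> have the colour \<open>k\<close> of the phase; \<open>half_choices\<close> compares the number of
  colours left for \<open>u\<close> with the two colours that are left in the pure phase.\<close>

definition ext :: "3 \<Rightarrow> 'a set \<Rightarrow> ('a \<Rightarrow> 3) \<Rightarrow> 'a \<Rightarrow> 3" where
  "ext k A a v = (if v \<in> A then a v else k)"

definition half_choices :: "3 \<Rightarrow> 'a set \<Rightarrow> ('a \<Rightarrow> 3) \<Rightarrow> 'a \<Rightarrow> real" where
  "half_choices k A a u = real (card (- ext k A a ` nb u)) / 2"

text \<open>The number of ways to colour the graph with deviation set exactly \<open>A\<close>,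
  relative to the \<open>2 ^ card U\<close> colourings of the pure phase.\<close>

definition polymer_weight :: "3 \<Rightarrow> 'a set \<Rightarrow> real" where
  "polymer_weight k A = (\<Sum>a\<in>PiE A (\<lambda>_. - {k}). \<Prod>u\<in>U. half_choices k A a u)"

lemma half_choices_nonneg: "half_choices k A a u \<ge> 0" by (simp add: half_choices_def)

lemma nb_ne: "x \<in> V \<union> U \<Longrightarrow> nb x \<noteq> {}"
  using deg npos by (metis card.empty less_numeral_extra(3))

lemma half_choices_le_1: "u \<in> U \<Longrightarrow> half_choices k A a u \<le> 1"
proof -
  assume u: "u \<in> U"
  have "ext k A a ` nb u \<noteq> {}" "finite (ext k A a ` nb u)" using nb_ne u fin_nb by auto
  then have "card (ext k A a ` nb u) \<ge> 1" by (simp add: Suc_le_eq card_gt_0_iff)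
  then show ?thesis by (simp add: half_choices_def card_Compl3)
qed

lemma half_choices_outside: "u \<in> U \<Longrightarrow> nb u \<inter> A = {} \<Longrightarrow> half_choices k A a u = 1"
proof -
  assume u: "u \<in> U" "nb u \<inter> A = {}"
  have "ext k A a ` nb u = {k}" using nb_ne[of u] u by (auto simp: ext_def)
  then show ?thesis by (simp add: half_choices_def card_Compl3)
qed

lemma half_choices_cong:
  assumes "\<And>v. v \<in> nb u \<Longrightarrow> ext k A a v = ext k B b v"
  shows "half_choices k A a u = half_choices k B b u"
  unfolding half_choices_def using assms by (metis (no_types, lifting) image_cong)

lemma polymer_weight_nonneg: "polymer_weight k A \<ge> 0"
  unfolding polymer_weight_def by (intro sum_nonneg prod_nonneg) (simp add: half_choices_nonneg)

lemma polymer_weight_empty: "polymer_weight k {} = 1"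
proof -
  have "(\<Prod>u\<in>U. half_choices k {} a u) = 1" for a
    by (intro prod.neutral ballI half_choices_outside) auto
  then show ?thesis unfolding polymer_weight_def by simp
qed

text \<open>No vertex of \<open>U\<close> has neighbours in both sets. Its factor is therefore the
  one for \<open>C\<close> or the one for \<open>B\<close>, while the other of the two equals
  1.\<close>

lemma polymer_weight_mult:
  assumes C: "C \<subseteq> V" and B: "B \<subseteq> V"
    and R: "\<And>b x. b \<in> C \<Longrightarrow> x \<in> B \<Longrightarrow> \<not> R2 b x"
  shows "polymer_weight k (C \<union> B) \<le> polymer_weight k C * polymer_weight k B"
proof -
  have fin: "finite C" "finite B" using C B finV finite_subset by auto
  have sep: "nb u \<inter> C = {} \<or> nb u \<inter> B = {}" if "u \<in> U" for u
  proof (rule ccontr)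
    assume "\<not> (nb u \<inter> C = {} \<or> nb u \<inter> B = {})"
    then obtain x y where "x \<in> nb u" "x \<in> C" "y \<in> nb u" "y \<in> B" by blast
    then have "R2 x y" using that C B nb_sym unfolding R2_def by blast
    then show False using R \<open>x \<in> C\<close> \<open>y \<in> B\<close> by blast
  qed
  have "polymer_weight k (C \<union> B) \<le> (\<Sum>(a, b)\<in>PiE C (\<lambda>_. - {k}) \<times> PiE B (\<lambda>_. - {k}). (\<Prod>u\<in>U. half_choices k C a u) * (\<Prod>u\<in>U. half_choices k B b u))"
    unfolding polymer_weight_def
  proof (rule sum_le_included[where i = "\<lambda>(a, b) x. if x \<in> C then a x else b x"])
    show "finite (PiE (C \<union> B) (\<lambda>_. - {k}))" using fin by (intro finite_PiE) auto
    show "finite (PiE C (\<lambda>_. - {k}) \<times> PiE B (\<lambda>_. - {k}))" using fin by (intro finite_cartesian_product finite_PiE) auto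
    show "\<forall>y\<in>PiE C (\<lambda>_. - {k}) \<times> PiE B (\<lambda>_. - {k}). 0 \<le> (case y of (a, b) \<Rightarrow> (\<Prod>u\<in>U. half_choices k C a u) * (\<Prod>u\<in>U. half_choices k B b u))"
      using half_choices_nonneg by (auto intro!: mult_nonneg_nonneg prod_nonneg)
    show "\<forall>c\<in>PiE (C \<union> B) (\<lambda>_. - {k}). \<exists>y\<in>PiE C (\<lambda>_. - {k}) \<times> PiE B (\<lambda>_. - {k}).
      (case y of (a, b) \<Rightarrow> \<lambda>x. if x \<in> C then a x else b x) = c \<and>
      (\<Prod>u\<in>U. half_choices k (C \<union> B) c u) \<le> (case y of (a, b) \<Rightarrow> (\<Prod>u\<in>U. half_choices k C a u) * (\<Prod>u\<in>U. half_choices k B b u))"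
    proof
      fix c assume c: "c \<in> PiE (C \<union> B) (\<lambda>_. - {k})"
      let ?y = "(restrict c C, restrict c B)"
      have "half_choices k (C \<union> B) c u = half_choices k C (restrict c C) u * half_choices k B (restrict c B) u" if u: "u \<in> U" for u
      proof -
        consider "nb u \<inter> C = {}" | "nb u \<inter> B = {}" using sep[OF u] by blast
        then show ?thesis
        proof cases
          case 1
          then have "half_choices k (C \<union> B) c u = half_choices k B (restrict c B) u"
            by (intro half_choices_cong) (auto simp: ext_def)
          then show ?thesis using half_choices_outside[OF u 1] by simp
        next
          case 2
          then have "half_choices k (C \<union> B) c u = half_choices k C (restrict c C) u"
            by (intro half_choices_cong) (auto simp: ext_def)
          then show ?thesis using half_choices_outside[OF u 2] by simp
        qed
      qed
      then have "(\<Prod>u\<in>U. half_choices k (C \<union> B) c u) = (\<Prod>u\<in>U. half_choices k C (restrict c C) u) * (\<Prod>u\<in>U. half_choices k B (restrict c B) u)"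
        by (simp add: prod.distrib)
      moreover have "(\<lambda>x. if x \<in> C then restrict c C x else restrict c B x) = c"
        using c by (auto simp: fun_eq_iff PiE_iff extensional_def)
      moreover have "?y \<in> PiE C (\<lambda>_. - {k}) \<times> PiE B (\<lambda>_. - {k})" using c by (auto simp: PiE_iff)
      ultimately show "\<exists>y\<in>PiE C (\<lambda>_. - {k}) \<times> PiE B (\<lambda>_. - {k}).
        (case y of (a, b) \<Rightarrow> \<lambda>x. if x \<in> C then a x else b x) = c \<and>
        (\<Prod>u\<in>U. half_choices k (C \<union> B) c u) \<le> (case y of (a, b) \<Rightarrow> (\<Prod>u\<in>U. half_choices k C a u) * (\<Prod>u\<in>U. half_choices k B b u))"
        by (intro bexI[of _ ?y]) auto
    qed
  qed
  also have "\<dots> = polymer_weight k C * polymer_weight k B"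
    unfolding polymer_weight_def by (simp add: sum_product sum.cartesian_product)
  finally show ?thesis .
qed

section \<open>Containers of connected deviation sets\<close>

definition mostly_covered :: "nat \<Rightarrow> 'a set \<Rightarrow> 'a set" where
  "mostly_covered \<psi> A = {v\<in>V. card (nb v - Nbs A) \<le> \<psi>}"

lemma Nbs_subset: "A \<subseteq> V \<Longrightarrow> Nbs A \<subseteq> U"
  using nbV by (auto simp: Nbs_def)

text \<open>Greedily add vertices of \<open>A\<close> that contribute more than \<open>\<psi>\<close> new neighbours.\<close>

lemma ex_container:
  assumes A: "A \<subseteq> V" "A \<noteq> {}"
  obtains A' where "A' \<subseteq> A" "A' \<noteq> {}" "A \<subseteq> mostly_covered \<psi> A'"
    "card (Nbs A') \<ge> n + \<psi> * (card A' - 1)"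
proof -
  have finA: "finite A" using A finV finite_subset by auto
  \<comment> \<open>A largest set with this property is where the greedy procedure stops. The first
    vertex brings \<open>n\<close> neighbours, each later one at least \<open>\<psi>\<close> new
    ones.\<close>
  define P where "P B \<longleftrightarrow> B \<subseteq> A \<and> B \<noteq> {} \<and> card (Nbs B) \<ge> n + \<psi> * (card B - 1)" for B
  obtain v where v: "v \<in> A" using A by blast
  have "P {v}" using v A deg by (auto simp: P_def Nbs_def)
  moreover have "card B \<le> card A" if "P B" for B using card_mono[OF finA] that by (auto simp: P_def)
  ultimately have "\<exists>B. P B \<and> (\<forall>C. P C \<longrightarrow> card C \<le> card B)"
    by (intro ex_has_greatest_nat[of P "{v}" card "Suc (card A)"]) (auto simp: less_Suc_eq_le)
  then obtain B where B: "P B" and max: "\<And>C. P C \<Longrightarrow> card C \<le> card B" by auto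
  have BA: "B \<subseteq> A" "B \<noteq> {}" "finite B" using B finA finite_subset unfolding P_def by auto
  have "A \<subseteq> mostly_covered \<psi> B"
  proof
    fix x assume x: "x \<in> A"
    show "x \<in> mostly_covered \<psi> B"
    proof (rule ccontr)
      assume "x \<notin> mostly_covered \<psi> B"
      then have big: "card (nb x - Nbs B) > \<psi>" using x A by (auto simp: mostly_covered_def)
      have xB: "x \<notin> B"
      proof
        assume "x \<in> B"
        then have "nb x - Nbs B = {}" by (auto simp: Nbs_def)
        with big show False by simp
      qed
      have fB: "finite (Nbs B)" using Nbs_subset[of B] BA A finU finite_subset by (meson subset_trans)
      have "Nbs (insert x B) = Nbs B \<union> (nb x - Nbs B)" by (auto simp: Nbs_def)
      then have "card (Nbs (insert x B)) = card (Nbs B) + card (nb x - Nbs B)"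
        using fB x A fin_nb[of x] by (subst card_Un_disjoint[symmetric]) auto
      also have "\<dots> \<ge> n + \<psi> * (card B - 1) + \<psi>" using B big unfolding P_def by simp
      finally have "card (Nbs (insert x B)) \<ge> n + \<psi> * (card (insert x B) - 1)"
        using xB BA by (cases "card B") (auto simp: algebra_simps)
      then have "P (insert x B)" using x BA by (auto simp: P_def)
      then show False using max xB BA by fastforce
    qed
  qed
  then show ?thesis using that B unfolding P_def by blast
qed

lemma mostly_covered_R2:
  assumes "v \<in> mostly_covered \<psi> B" "B \<subseteq> V" "\<psi> < n"
  shows "\<exists>b\<in>B. R2 v b"
proof -
  have "\<not> nb v \<subseteq> nb v - Nbs B"
  proof
    assume "nb v \<subseteq> nb v - Nbs B"
    then have "card (nb v) \<le> card (nb v - Nbs B)" using assms(1) fin_nb by (intro card_mono) (auto simp: mostly_covered_def)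
    then show False using assms deg by (auto simp: mostly_covered_def)
  qed
  then show ?thesis using assms by (auto simp: Nbs_def R2_def mostly_covered_def)
qed

text \<open>Every vertex of \<open>A\<close> is one \<open>R2\<close> step from \<open>B\<close>.
  The vertices of \<open>A\<close> near a part \<open>D\<close> of \<open>B\<close> form a cut of
  \<open>A\<close>, unless they are all of \<open>A\<close>; an \<open>R2\<close> edge across this
  cut, prolonged by one step into \<open>B\<close> at either end, is an \<open>R6\<close> edge
  leaving \<open>D\<close>.\<close>

lemma container_connected_by:
  assumes A: "A \<subseteq> V" "connected_by R2 A" and B: "B \<subseteq> A" and S: "A \<subseteq> mostly_covered \<psi> B" and \<psi>: "\<psi> < n"
  shows "connected_by R6 B"
  unfolding connected_by_def
proof (intro allI impI)
  fix D assume D: "D \<subseteq> B" "D \<noteq> {}" "D \<noteq> B"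
  have near: "\<exists>b\<in>B. R2 v b" if "v \<in> A" for v using mostly_covered_R2[of v \<psi> B] that S B A \<psi> by blast
  define E where "E = {v\<in>A. \<exists>b\<in>D. R2 v b}"
  have DE: "D \<subseteq> E" using D B A R2_refl unfolding E_def by blast
  show "\<exists>b\<in>D. \<exists>x\<in>B - D. R6 b x"
  proof (cases "E = A")
    case True
    obtain x where x: "x \<in> B" "x \<notin> D" using D by blast
    then obtain b where "b \<in> D" "R2 x b" using True B unfolding E_def by blast
    moreover from this have "R6 b x" unfolding R6_def using R2_sym R2_refl unfolding R2_def by blast
    ultimately show ?thesis using x by blast
  next
    case False
    then obtain v w where vw: "v \<in> E" "w \<in> A - E" "R2 v w"
      using A(2) DE D unfolding connected_by_def E_def by (metis (no_types, lifting) mem_Collect_eq subsetI subset_empty)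
    obtain b where b: "b \<in> D" "R2 v b" using vw unfolding E_def by blast
    obtain x where x: "x \<in> B" "R2 w x" using near vw by blast
    have "x \<notin> D" using x vw unfolding E_def by blast
    moreover have "R6 b x" unfolding R6_def using b vw x R2_sym by blast
    ultimately show ?thesis using b x by blast
  qed
qed

end

section \<open>Total weight of the polymers with a given container\<close>

context bip_graph begin

text \<open>Extending the colours of \<open>A\<close> by the phase colour \<open>k\<close> gives a
  colouring of \<open>S\<close> from which \<open>A\<close> is recovered as the set of other
  colours. The sum over deviation sets thus becomes a single sum over colourings, to which Finner's
  inequality applies.\<close>

lemma sum_polymer_weight_le_colourings:
  assumes S: "S \<subseteq> V" and B: "B \<subseteq> S"
  shows "(\<Sum>A | B \<subseteq> A \<and> A \<subseteq> S. polymer_weight k A)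
    \<le> (\<Sum>c | c \<in> PiE S (\<lambda>_. UNIV) \<and> (\<forall>v\<in>B. c v \<noteq> k). \<Prod>u\<in>U. half_choices k S c u)"
proof -
  have finS: "finite S" using S finV finite_subset by auto
  have fA: "finite {A. B \<subseteq> A \<and> A \<subseteq> S}" using finS by (auto intro: finite_subset[of _ "Pow S"])
  have finA: "finite (PiE A (\<lambda>_. - {k}))" if "A \<subseteq> S" for A
    using that finS finite_subset by (intro finite_PiE) auto
  have "(\<Sum>A | B \<subseteq> A \<and> A \<subseteq> S. polymer_weight k A) =
    (\<Sum>(A, a)\<in>(SIGMA A:{A. B \<subseteq> A \<and> A \<subseteq> S}. PiE A (\<lambda>_. - {k})). \<Prod>u\<in>U. half_choices k A a u)"
    unfolding polymer_weight_def using fA finA by (subst sum.Sigma) auto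
  also have "\<dots> \<le> (\<Sum>c | c \<in> PiE S (\<lambda>_. UNIV) \<and> (\<forall>v\<in>B. c v \<noteq> k). \<Prod>u\<in>U. half_choices k S c u)"
  proof (rule sum_le_included[where i = "\<lambda>c. ({v\<in>S. c v \<noteq> k}, restrict c {v\<in>S. c v \<noteq> k})"])
    show "finite (SIGMA A:{A. B \<subseteq> A \<and> A \<subseteq> S}. PiE A (\<lambda>_. - {k}))"
      using fA finA by (intro finite_SigmaI) auto
    show "finite {c \<in> PiE S (\<lambda>_. UNIV). \<forall>v\<in>B. c v \<noteq> k}"
      using finS by (simp add: finite_PiE)
    show "\<forall>c\<in>{c \<in> PiE S (\<lambda>_. UNIV). \<forall>v\<in>B. c v \<noteq> k}. 0 \<le> (\<Prod>u\<in>U. half_choices k S c u)"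
      by (simp add: prod_nonneg half_choices_nonneg)
    show "\<forall>x\<in>SIGMA A:{A. B \<subseteq> A \<and> A \<subseteq> S}. PiE A (\<lambda>_. - {k}).
      \<exists>c\<in>{c \<in> PiE S (\<lambda>_. UNIV). \<forall>v\<in>B. c v \<noteq> k}.
        ({v\<in>S. c v \<noteq> k}, restrict c {v\<in>S. c v \<noteq> k}) = x \<and>
        (case x of (A, a) \<Rightarrow> \<Prod>u\<in>U. half_choices k A a u) \<le> (\<Prod>u\<in>U. half_choices k S c u)"
    proof
      fix x assume "x \<in> (SIGMA A:{A. B \<subseteq> A \<and> A \<subseteq> S}. PiE A (\<lambda>_. - {k}))"
      then obtain A a where x: "x = (A, a)" and A: "B \<subseteq> A" "A \<subseteq> S" and a: "a \<in> PiE A (\<lambda>_. - {k})" by auto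
      let ?c = "restrict (ext k A a) S"
      have s: "{v\<in>S. ?c v \<noteq> k} = A" using A a by (auto simp: ext_def PiE_iff)
      have "restrict ?c A = a" using A a by (auto simp: ext_def fun_eq_iff PiE_iff extensional_def)
      then have 1: "({v\<in>S. ?c v \<noteq> k}, restrict ?c {v\<in>S. ?c v \<noteq> k}) = x" using s x by simp
      have "half_choices k A a u = half_choices k S ?c u" for u
        using A by (intro half_choices_cong) (auto simp: ext_def)
      then have 2: "(\<Prod>u\<in>U. half_choices k A a u) = (\<Prod>u\<in>U. half_choices k S ?c u)" by simp
      have "\<forall>v\<in>B. ?c v \<noteq> k" using A s by blast
      then have "?c \<in> {c \<in> PiE S (\<lambda>_. UNIV). \<forall>v\<in>B. c v \<noteq> k}" by auto
      then show "\<exists>c\<in>{c \<in> PiE S (\<lambda>_. UNIV). \<forall>v\<in>B. c v \<noteq> k}.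
        ({v\<in>S. c v \<noteq> k}, restrict c {v\<in>S. c v \<noteq> k}) = x \<and>
        (case x of (A, a) \<Rightarrow> \<Prod>u\<in>U. half_choices k A a u) \<le> (\<Prod>u\<in>U. half_choices k S c u)"
        using 1 2 x by (intro bexI[of _ ?c]) auto
    qed
  qed
  finally show ?thesis .
qed

text \<open>If \<open>mostly_covered \<psi> B\<close> is coloured with \<open>B\<close> fixed, every \<open>u\<close> in \<open>Nbs B\<close> with a
  neighbour outside sees two colours, so its colour is forced and its neighbours have only two
  possible colours; the vertices all of whose neighbours lie inside are handled by Finner's
  inequality.\<close>

lemma container_inner_le:
  fixes L :: "'a \<Rightarrow> 3 set"
  assumes S: "S \<subseteq> V" and I: "I = {u\<in>U. nb u \<subseteq> S}" and Fo: "Fo \<subseteq> U" "Fo \<inter> I = {}"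
    and L: "\<And>v. v \<in> S \<Longrightarrow> card (L v) \<le> 2 \<or> card (nb v - I) \<le> \<psi>"
  shows "(\<Sum>c\<in>PiE S L. \<Prod>u\<in>I. half_choices k S c u)
    \<le> 2 powr (real (card S) - card I + (real \<psi> + 3) * card S / n)"
    and "card I \<le> card S"
proof -
  have finS: "finite S" and finI: "finite I" using S finV finU I finite_subset by auto
  have IU: "I \<subseteq> U" using I by auto
  have degI: "{u\<in>I. v \<in> nb u} = nb v \<inter> I" if "v \<in> S" for v
    using nb_sym S IU that by blast
  have degle: "card (nb v \<inter> I) \<le> n" if "v \<in> S" for v
    using card_mono[OF fin_nb, of v "nb v \<inter> I"] deg[of v] S that by auto
  have sumdeg: "(\<Sum>v\<in>S. card (nb v \<inter> I)) = n * card I"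
  proof -
    have "(\<Sum>v\<in>S. card (nb v \<inter> I)) = (\<Sum>u\<in>I. card (nb u \<inter> S))" using S IU by (rule sum_deg)
    also have "\<dots> = (\<Sum>u\<in>I. n)" using I deg by (intro sum.cong) (auto simp: Int_absorb2)
    finally show ?thesis by simp
  qed
  have "n * card I \<le> (\<Sum>v\<in>S. n)" unfolding sumdeg[symmetric] by (intro sum_mono degle)
  then show IS: "card I \<le> card S" using npos by simp
  let ?T = "\<Sum>c\<in>PiE S L. \<Prod>u\<in>I. half_choices k S c u"
  have T0: "?T \<ge> 0" by (intro sum_nonneg prod_nonneg) (simp add: half_choices_nonneg)
  have "?T ^ n \<le> (\<Prod>u\<in>I. \<Sum>c\<in>PiE (nb u) L. half_choices k S c u ^ n) *
      (\<Prod>v\<in>S. real (card (L v)) ^ (n - card {u\<in>I. v \<in> nb u}))"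
  proof (rule Finner[OF finS finI npos])
    show "nb u \<subseteq> S" if "u \<in> I" for u using that I by auto
    show "half_choices k S c u = half_choices k S c' u" if "u \<in> I" "\<forall>v\<in>nb u. c v = c' v" for u c c'
      using that by (intro half_choices_cong) (auto simp: ext_def)
    show "card {u\<in>I. v \<in> nb u} \<le> n" if "v \<in> S" for v using degI degle that by simp
  qed (auto simp: half_choices_nonneg)
  \<comment> \<open>The 6 is \<open>sum_free_colours_le\<close>. A vertex with two colours pays 2
    per missing set; one with all three colours misses some \<open>x \<le> \<psi>\<close> sets and
    pays \<open>3 ^ x \<le> 2 ^ (2 * x) \<le> 2 ^ (x + \<psi>)\<close>.\<close>
  also have "\<dots> \<le> (\<Prod>u\<in>I. 6) * (\<Prod>v\<in>S. 2 ^ (n - card (nb v \<inter> I) + \<psi>))"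
  proof (intro mult_mono prod_mono conjI)
    fix u assume u: "u \<in> I"
    then have uU: "u \<in> U" using IU by auto
    have "(\<Sum>c\<in>PiE (nb u) L. half_choices k S c u ^ n) \<le> (\<Sum>c\<in>PiE (nb u) (\<lambda>_. UNIV). half_choices k S c u ^ n)"
      using fin_nb uU by (intro sum_mono2 finite_PiE) (auto simp: half_choices_nonneg)
    also have "\<dots> = (\<Sum>c\<in>PiE (nb u) (\<lambda>_. UNIV :: 3 set). (real (card (- c ` nb u)) / 2) ^ card (nb u))"
    proof (intro sum.cong refl)
      fix c :: "'a \<Rightarrow> 3"
      have "ext k S c ` nb u = c ` nb u" using u I by (intro image_cong) (auto simp: ext_def)
      then show "half_choices k S c u ^ n = (real (card (- c ` nb u)) / 2) ^ card (nb u)"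
        using deg[of u] uU by (simp add: half_choices_def)
    qed
    also have "\<dots> \<le> 6" using fin_nb nb_ne uU by (intro sum_free_colours_le) auto
    finally show "(\<Sum>c\<in>PiE (nb u) L. half_choices k S c u ^ n) \<le> 6" .
  next
    fix v assume v: "v \<in> S"
    show "real (card (L v)) ^ (n - card {u\<in>I. v \<in> nb u}) \<le> 2 ^ (n - card (nb v \<inter> I) + \<psi>)"
      unfolding degI[OF v]
    proof (cases "card (L v) \<le> 2")
      case True
      then have "real (card (L v)) ^ (n - card (nb v \<inter> I)) \<le> 2 ^ (n - card (nb v \<inter> I))"
        by (intro power_mono) auto
      also have "\<dots> \<le> 2 ^ (n - card (nb v \<inter> I) + \<psi>)" by (intro power_increasing) auto
      finally show "real (card (L v)) ^ (n - card (nb v \<inter> I)) \<le> 2 ^ (n - card (nb v \<inter> I) + \<psi>)" .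
    next
      case False
      then have c: "card (nb v - I) \<le> \<psi>" using L[OF v] by simp
      have vV: "v \<in> V \<union> U" using v S by auto
      have e: "card (nb v - I) = n - card (nb v \<inter> I)"
        using fin_nb[OF vV] deg[OF vV] by (simp add: card_Diff_subset_Int)
      have "card (L v) \<le> card (UNIV :: 3 set)" by (intro card_mono) auto
      then have "real (card (L v)) \<le> 2 ^ 2" by simp
      then have "real (card (L v)) ^ (n - card (nb v \<inter> I)) \<le> (2 ^ 2) ^ (n - card (nb v \<inter> I))"
        by (intro power_mono) auto
      also have "\<dots> = 2 ^ (2 * (n - card (nb v \<inter> I)))" by (simp add: power_mult)
      also have "\<dots> \<le> 2 ^ (n - card (nb v \<inter> I) + \<psi>)" using c e by (intro power_increasing) auto
      finally show "real (card (L v)) ^ (n - card (nb v \<inter> I)) \<le> 2 ^ (n - card (nb v \<inter> I) + \<psi>)" .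
    qed
  qed (auto intro!: sum_nonneg prod_nonneg simp: half_choices_nonneg)
  also have "(\<Prod>v\<in>S. 2 ^ (n - card (nb v \<inter> I) + \<psi>)) = (2::real) ^ (n * card S - n * card I + \<psi> * card S)"
  proof -
    have "(\<Sum>v\<in>S. n - card (nb v \<inter> I) + \<psi>) = n * card S - n * card I + \<psi> * card S"
      unfolding sum.distrib using degle sumdeg by (subst sum_subtractf_nat) (auto simp: mult.commute)
    then show ?thesis by (simp only: power_sum[symmetric])
  qed
  \<comment> \<open>Rounding 6 up to \<open>8 = 2 ^ 3\<close> produces the 3 in the exponent; after
    the \<open>n\<close>-th root it costs only \<open>3 * card S / n\<close>.\<close>
  also have "(\<Prod>u\<in>I. 6) * (2::real) ^ (n * card S - n * card I + \<psi> * card S)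
    \<le> 8 ^ card S * 2 ^ (n * card S - n * card I + \<psi> * card S)"
  proof -
    have "(6::real) ^ card I \<le> 8 ^ card I" by (intro power_mono) auto
    also have "\<dots> \<le> 8 ^ card S" using IS by (intro power_increasing) auto
    finally show ?thesis by simp
  qed
  also have "(8::real) ^ card S = 2 ^ (3 * card S)" by (simp add: power_mult)
  also have "2 ^ (3 * card S) * (2::real) ^ (n * card S - n * card I + \<psi> * card S)
    = 2 powr (real (3 * card S + (n * card S - n * card I + \<psi> * card S)))"
    by (subst powr_realpow) (simp_all only: power_add[symmetric] zero_less_numeral)
  also have "real (3 * card S + (n * card S - n * card I + \<psi> * card S))
    = real n * (real (card S) - card I + (real \<psi> + 3) * card S / n)"
  proof -
    have e: "real (n * card S - n * card I) = real n * card S - real n * card I"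
      using of_nat_diff[OF mult_le_mono2[OF IS, of n], where 'a = real] by simp
    show ?thesis unfolding of_nat_add e using npos by (simp add: field_simps)
  qed
  also have "2 powr (real n * (real (card S) - card I + (real \<psi> + 3) * card S / n))
    = (2 powr (real (card S) - card I + (real \<psi> + 3) * card S / n)) ^ n"
    by (simp add: powr_powr mult.commute flip: powr_realpow)
  finally show "?T \<le> 2 powr (real (card S) - card I + (real \<psi> + 3) * card S / n)"
    using npos T0 by (subst (asm) power_mono_iff) auto
qed

text \<open>The balance of the exponent: the vertices of \<open>B\<close> have two colours each,
  every vertex of \<open>Fo\<close> has a forced colour and saves a factor 2, and
  \<open>container_inner_le\<close> saves one for every vertex of \<open>I\<close>. Since
  \<open>Nbs B\<close> is covered by \<open>Fo\<close> and \<open>I\<close>, the total saving is at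
  least \<open>card (Nbs B)\<close>.\<close>

lemma container_weight_le:
  fixes \<psi> :: nat
  assumes B: "B \<subseteq> V"
  defines "S \<equiv> mostly_covered \<psi> B"
  shows "(\<Sum>A | B \<subseteq> A \<and> A \<subseteq> S. polymer_weight k A)
    \<le> 2 powr (real (card B) - card (Nbs B) + card S + (real \<psi> + 3) * card S / n)"
proof -
  define F where "F = Nbs B"
  define I where "I = {u\<in>U. nb u \<subseteq> S}"
  define Fo where "Fo = F - I"
  have SV: "S \<subseteq> V" unfolding S_def mostly_covered_def by auto
  have BS: "B \<subseteq> S"
  proof
    fix x assume x: "x \<in> B"
    then have "nb x - Nbs B = {}" by (auto simp: Nbs_def)
    then have "card (nb x - Nbs B) = 0" by (simp only: card.empty)
    then show "x \<in> S" using x B unfolding S_def mostly_covered_def by auto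
  qed
  have fin: "finite S" "finite F" "finite I" "finite B"
    using SV BS B finV finU Nbs_subset[OF B] finite_subset unfolding F_def I_def by auto
  have FU: "F \<subseteq> U" using Nbs_subset[OF B] by (simp add: F_def)
  have FoU: "Fo \<subseteq> U" using FU by (auto simp: Fo_def)
  \<comment> \<open>A neighbour of \<open>u\<close> in \<open>B\<close>, whose colour is not
    \<open>k\<close>. If \<open>u\<close> also has a neighbour outside \<open>S\<close>, of colour
    \<open>k\<close>, these two leave a single colour for \<open>u\<close>.\<close>
  define \<alpha> where "\<alpha> u = (SOME v. v \<in> B \<and> v \<in> nb u)" for u
  have \<alpha>: "\<alpha> u \<in> B \<and> \<alpha> u \<in> nb u" if "u \<in> F" for u
  proof -
    have "\<exists>v. v \<in> B \<and> v \<in> nb u" using that FU B nb_sym unfolding F_def Nbs_def by blast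
    then show ?thesis unfolding \<alpha>_def by (rule someI_ex)
  qed
  \<comment> \<open>The possible colours once \<open>B\<close> is coloured by \<open>a\<close>: next
    to a vertex \<open>u\<close> of \<open>Fo\<close>, a colour other than the two already seen from
    \<open>u\<close> would leave none for \<open>u\<close> and make the product vanish.\<close>
  define L where "L a v = (if v \<in> B then {a v} else if nb v \<inter> Fo \<noteq> {} then {k, a (\<alpha> (SOME u. u \<in> nb v \<inter> Fo))} else UNIV)"
    for a :: "'a \<Rightarrow> 3" and v
  let ?PB = "PiE B (\<lambda>_. - {k} :: 3 set)"
  have forced: "card (- ext k S c ` nb u) \<le> 1" and two: "{k, c (\<alpha> u)} \<subseteq> ext k S c ` nb u"
    if c: "\<forall>v\<in>B. c v \<noteq> k" and u: "u \<in> Fo" for c u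
  proof -
    obtain x where x: "x \<in> nb u" "x \<notin> S" using u FU unfolding Fo_def I_def by blast
    have a: "\<alpha> u \<in> B" "\<alpha> u \<in> nb u" using \<alpha> u unfolding Fo_def by auto
    have "ext k S c x = k" "ext k S c (\<alpha> u) = c (\<alpha> u)" using x a BS by (auto simp: ext_def)
    then show two: "{k, c (\<alpha> u)} \<subseteq> ext k S c ` nb u" using x a by force
    have "card {k, c (\<alpha> u)} = 2" using c a by auto
    then have "2 \<le> card (ext k S c ` nb u)" using card_mono[OF _ two] by simp
    then show "card (- ext k S c ` nb u) \<le> 1" by (simp add: card_Compl3)
  qed
  have prod_le: "(\<Prod>u\<in>U. half_choices k S c u) \<le> (1 / 2) ^ card Fo * (\<Prod>u\<in>I. half_choices k S c u)"
    if c: "\<forall>v\<in>B. c v \<noteq> k" for c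
  proof -
    have "U = (U - (Fo \<union> I)) \<union> (Fo \<union> I)" using FoU I_def by auto
    then have "(\<Prod>u\<in>U. half_choices k S c u) = (\<Prod>u\<in>U - (Fo \<union> I). half_choices k S c u) * (\<Prod>u\<in>Fo \<union> I. half_choices k S c u)"
      using finU fin by (subst prod.union_disjoint[symmetric]) (auto simp: Fo_def)
    also have "(\<Prod>u\<in>Fo \<union> I. half_choices k S c u) = (\<Prod>u\<in>Fo. half_choices k S c u) * (\<Prod>u\<in>I. half_choices k S c u)"
      using fin by (intro prod.union_disjoint) (auto simp: Fo_def)
    also have "(\<Prod>u\<in>U - (Fo \<union> I). half_choices k S c u) * ((\<Prod>u\<in>Fo. half_choices k S c u) * (\<Prod>u\<in>I. half_choices k S c u))
      \<le> 1 * ((\<Prod>u\<in>Fo. 1 / 2) * (\<Prod>u\<in>I. half_choices k S c u))"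
    proof (intro mult_mono prod_le_1 prod_mono)
      show "0 \<le> half_choices k S c u \<and> half_choices k S c u \<le> 1 / 2" if "u \<in> Fo" for u
        using forced[OF c that] by (simp add: half_choices_def)
    qed (auto simp: half_choices_nonneg half_choices_le_1 intro!: prod_nonneg mult_nonneg_nonneg)
    finally show ?thesis by simp
  qed
  have in_L: "c v \<in> L c v" if c: "\<forall>v\<in>B. c v \<noteq> k" and nz: "(\<Prod>u\<in>U. half_choices k S c u) \<noteq> 0" and v: "v \<in> S" for c v
  proof -
    have "c v \<in> {k, c (\<alpha> u)}" if u: "u \<in> nb v \<inter> Fo" for u
    proof (rule ccontr)
      assume n: "c v \<notin> {k, c (\<alpha> u)}"
      have uF: "u \<in> Fo" "u \<in> U" using u FoU by auto
      have vu: "v \<in> nb u" using nb_sym u v SV uF by blast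
      have "c v \<in> ext k S c ` nb u" using vu v by (force simp: ext_def)
      then have sub: "insert (c v) {k, c (\<alpha> u)} \<subseteq> ext k S c ` nb u" using two[OF c uF(1)] by auto
      have "k \<noteq> c (\<alpha> u)" using c \<alpha> uF unfolding Fo_def by fastforce
      then have "card (insert (c v) {k, c (\<alpha> u)}) = 3" using n by auto
      then have "3 \<le> card (ext k S c ` nb u)" using card_mono[OF _ sub] by simp
      then have "half_choices k S c u = 0" by (simp add: half_choices_def card_Compl3)
      then show False using nz finU uF by (simp add: prod_zero_iff)
    qed
    moreover have "(SOME u. u \<in> nb v \<inter> Fo) \<in> nb v \<inter> Fo" if "nb v \<inter> Fo \<noteq> {}"
      using that by (subst some_in_eq)
    ultimately show ?thesis by (auto simp: L_def)
  qed
  have card_L: "card (L a v) \<le> 2 \<or> card (nb v - I) \<le> \<psi>" if v: "v \<in> S" for a v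
  proof (cases "v \<in> B \<or> nb v \<inter> Fo \<noteq> {}")
    case True
    then have "card (L a v) \<le> 2" by (auto simp: L_def card_insert_if)
    then show ?thesis ..
  next
    case False
    then have "nb v - I \<subseteq> nb v - F" by (auto simp: Fo_def)
    then have "card (nb v - I) \<le> card (nb v - F)" using fin_nb v SV by (intro card_mono) auto
    then show ?thesis using v by (simp add: S_def mostly_covered_def F_def)
  qed
  let ?X = "2 powr (real (card S) - card I + (real \<psi> + 3) * card S / n)"
  let ?C = "{c. c \<in> PiE S (\<lambda>_. UNIV) \<and> (\<forall>v\<in>B. c v \<noteq> k)}"
  have finC: "finite ?C" using fin by (simp add: finite_PiE)
  have "(\<Sum>A | B \<subseteq> A \<and> A \<subseteq> S. polymer_weight k A) \<le> (\<Sum>c\<in>?C. \<Prod>u\<in>U. half_choices k S c u)"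
    by (rule sum_polymer_weight_le_colourings[OF SV BS])
  also have "\<dots> = (\<Sum>c\<in>{c\<in>?C. (\<Prod>u\<in>U. half_choices k S c u) \<noteq> 0}. \<Prod>u\<in>U. half_choices k S c u)"
    using finC by (intro sum.mono_neutral_right) auto
  also have "\<dots> \<le> (\<Sum>(a, c)\<in>(SIGMA a:?PB. PiE S (L a)). (1 / 2) ^ card Fo * (\<Prod>u\<in>I. half_choices k S c u))"
  proof (rule sum_le_included[where i = snd])
    show "finite (SIGMA a:?PB. PiE S (L a))" using fin by (intro finite_SigmaI finite_PiE) auto
    show "\<forall>c\<in>{c\<in>?C. (\<Prod>u\<in>U. half_choices k S c u) \<noteq> 0}. \<exists>y\<in>SIGMA a:?PB. PiE S (L a). snd y = c \<and>
      (\<Prod>u\<in>U. half_choices k S c u) \<le> (case y of (a, c) \<Rightarrow> (1 / 2) ^ card Fo * (\<Prod>u\<in>I. half_choices k S c u))"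
    proof
      fix c assume "c \<in> {c\<in>?C. (\<Prod>u\<in>U. half_choices k S c u) \<noteq> 0}"
      then have c: "c \<in> PiE S (\<lambda>_. UNIV)" "\<forall>v\<in>B. c v \<noteq> k" "(\<Prod>u\<in>U. half_choices k S c u) \<noteq> 0" by auto
      have "L (restrict c B) v = L c v" for v
      proof -
        have "\<alpha> (SOME u. u \<in> nb v \<inter> Fo) \<in> B" if "nb v \<inter> Fo \<noteq> {}"
          using \<alpha>[of "SOME u. u \<in> nb v \<inter> Fo"] some_in_eq[of "nb v \<inter> Fo"] that by (auto simp: Fo_def)
        then show ?thesis by (simp add: L_def)
      qed
      then have "c \<in> PiE S (L (restrict c B))" using c in_L[OF c(2,3)] by (auto simp: PiE_iff)
      moreover have "restrict c B \<in> ?PB" using c by auto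
      ultimately show "\<exists>y\<in>SIGMA a:?PB. PiE S (L a). snd y = c \<and>
        (\<Prod>u\<in>U. half_choices k S c u) \<le> (case y of (a, c) \<Rightarrow> (1 / 2) ^ card Fo * (\<Prod>u\<in>I. half_choices k S c u))"
        using prod_le[OF c(2)] by (intro bexI[of _ "(restrict c B, c)"]) auto
    qed
    show "finite {c\<in>?C. (\<Prod>u\<in>U. half_choices k S c u) \<noteq> 0}" using finC by (rule finite_subset[rotated]) auto
    show "\<forall>y\<in>SIGMA a:?PB. PiE S (L a). 0 \<le> (case y of (a, c) \<Rightarrow> (1 / 2) ^ card Fo * (\<Prod>u\<in>I. half_choices k S c u))"
      by (auto intro!: mult_nonneg_nonneg prod_nonneg simp: half_choices_nonneg)
  qed
  also have "\<dots> = (\<Sum>a\<in>?PB. (1 / 2) ^ card Fo * (\<Sum>c\<in>PiE S (L a). \<Prod>u\<in>I. half_choices k S c u))"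
    using fin by (subst sum.Sigma[symmetric]) (auto simp: sum_distrib_left finite_PiE)
  also have "\<dots> \<le> (\<Sum>a\<in>?PB. (1 / 2) ^ card Fo * ?X)"
  proof (intro sum_mono mult_left_mono)
    show "(\<Sum>c\<in>PiE S (L a). \<Prod>u\<in>I. half_choices k S c u) \<le> ?X" for a
      by (rule container_inner_le(1)[where Fo = Fo]) (use SV I_def FoU card_L in \<open>auto simp: Fo_def\<close>)
  qed auto
  also have "\<dots> = 2 ^ card B * ((1 / 2) ^ card Fo * ?X)"
    using fin by (simp add: card_PiE card_Compl3)
  also have "\<dots> = 2 powr (real (card B) - card Fo + (real (card S) - card I + (real \<psi> + 3) * card S / n))"
    by (simp add: powr_add powr_diff powr_realpow power_divide)
  also have "\<dots> \<le> 2 powr (real (card B) - card (Nbs B) + card S + (real \<psi> + 3) * card S / n)"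
  proof -
    have "card F \<le> card Fo + card I"
    proof -
      have "F \<subseteq> Fo \<union> I" by (auto simp: Fo_def)
      then have "card F \<le> card (Fo \<union> I)" using fin by (intro card_mono) (auto simp: Fo_def)
      then show ?thesis using card_Un_le[of Fo I] by linarith
    qed
    then show ?thesis by (intro powr_mono) (auto simp: F_def)
  qed
  finally show ?thesis .
qed

end

section \<open>Summing polymers with the help of isoperimetry\<close>

lemma sum_split_pred:
  fixes f :: "'a \<Rightarrow> real"
  assumes "finite A"
  shows "sum f A = sum f {x\<in>A. P x} + sum f {x\<in>A. \<not> P x}"
proof -
  have "A = {x\<in>A. P x} \<union> {x\<in>A. \<not> P x}" by auto
  then have "sum f A = sum f ({x\<in>A. P x} \<union> {x\<in>A. \<not> P x})" by (rule arg_cong)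
  also have "\<dots> = sum f {x\<in>A. P x} + sum f {x\<in>A. \<not> P x}"
    by (rule sum.union_disjoint) (use assms in auto)
  finally show ?thesis .
qed

text \<open>The properties of the cube that enter the polymer sum. \<open>iso\<close> is edge
  isoperimetry for the union of \<open>S\<close> and \<open>F\<close>, with every edge counted from
  both ends; \<open>codeg\<close> serves the containers with one vertex.\<close>

locale iso_graph = bip_graph +
  assumes codeg: "v \<in> V \<Longrightarrow> w \<in> V \<Longrightarrow> v \<noteq> w \<Longrightarrow> card (nb v \<inter> nb w) \<le> 2"
    and cardV: "card V \<le> 2 ^ n"
    and iso: "S \<subseteq> V \<Longrightarrow> F \<subseteq> U \<Longrightarrow>
      2 * real (\<Sum>v\<in>S. card (nb v \<inter> F)) \<le> (real (card S) + card F) * log 2 (real (card S) + card F)"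
begin

lemma mostly_covered_V: "mostly_covered \<psi> B \<subseteq> V" by (auto simp: mostly_covered_def)

lemma mostly_covered_edges:
  assumes B: "B \<subseteq> V" and \<psi>: "\<psi> \<le> n"
  defines "S \<equiv> mostly_covered \<psi> B"
  shows "(n - \<psi>) * card S \<le> (\<Sum>v\<in>S. card (nb v \<inter> Nbs B))"
    and "(\<Sum>v\<in>S. card (nb v \<inter> Nbs B)) \<le> n * card (Nbs B)"
proof -
  have SV: "S \<subseteq> V" unfolding S_def by (rule mostly_covered_V)
  have "(n - \<psi>) * card S = (\<Sum>v\<in>S. n - \<psi>)" by simp
  also have "\<dots> \<le> (\<Sum>v\<in>S. card (nb v \<inter> Nbs B))"
  proof (rule sum_mono)
    fix v assume v: "v \<in> S"
    have "v \<in> V \<union> U" using v SV by auto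
    then have "card (nb v - Nbs B) = n - card (nb v \<inter> Nbs B)"
      using fin_nb deg by (simp add: card_Diff_subset_Int)
    then show "n - \<psi> \<le> card (nb v \<inter> Nbs B)" using v unfolding S_def mostly_covered_def by auto
  qed
  finally show "(n - \<psi>) * card S \<le> (\<Sum>v\<in>S. card (nb v \<inter> Nbs B))" .
  have "(\<Sum>v\<in>S. card (nb v \<inter> Nbs B)) = (\<Sum>u\<in>Nbs B. card (nb u \<inter> S))"
    using SV Nbs_subset[OF B] by (rule sum_deg)
  also have "\<dots> \<le> (\<Sum>u\<in>Nbs B. n)"
  proof (rule sum_mono)
    fix u assume "u \<in> Nbs B"
    then have u: "u \<in> V \<union> U" using Nbs_subset[OF B] by auto
    show "card (nb u \<inter> S) \<le> n" using card_mono[OF fin_nb[OF u], of "nb u \<inter> S"] deg[OF u] by auto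
  qed
  finally show "(\<Sum>v\<in>S. card (nb v \<inter> Nbs B)) \<le> n * card (Nbs B)" by (simp add: mult.commute)
qed

text \<open>For small \<open>\<psi>\<close> this bounds the container by roughly
  \<open>l / (2 * n - l)\<close> times its neighbourhood, which is a gain as soon as
  \<open>l < n\<close>. It is what makes the exponent in \<open>container_weight_le\<close>
  negative.\<close>

lemma mostly_covered_iso:
  assumes B: "B \<subseteq> V" and \<psi>: "\<psi> \<le> n"
    and l: "real (card (mostly_covered \<psi> B)) + card (Nbs B) \<le> 2 powr l" and pos: "card (Nbs B) > 0"
  shows "2 * (real n - \<psi>) * card (mostly_covered \<psi> B) \<le> (real (card (mostly_covered \<psi> B)) + card (Nbs B)) * l"
proof -
  let ?S = "mostly_covered \<psi> B" and ?F = "Nbs B"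
  have "2 * (real n - \<psi>) * card ?S = 2 * real ((n - \<psi>) * card ?S)" using \<psi> by (simp add: of_nat_diff)
  also have "\<dots> \<le> 2 * real (\<Sum>v\<in>?S. card (nb v \<inter> ?F))"
    using mostly_covered_edges(1)[OF B \<psi>] by (simp only: of_nat_le_iff mult_le_cancel_left_pos zero_less_numeral)
  also have "\<dots> \<le> (real (card ?S) + card ?F) * log 2 (real (card ?S) + card ?F)"
    by (intro iso mostly_covered_V Nbs_subset B)
  also have "\<dots> \<le> (real (card ?S) + card ?F) * l"
  proof (rule mult_left_mono)
    have "log 2 (real (card ?S) + card ?F) \<le> log 2 (2 powr l)"
      using l pos by (subst log_le_cancel_iff) auto
    then show "log 2 (real (card ?S) + card ?F) \<le> l" by simp
  qed simp
  finally show ?thesis .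
qed

text \<open>There are at most \<open>2 ^ n * (n ^ 6) ^ (2 * k - 2)\<close> connected sets of size
  \<open>k\<close>, so a factor \<open>1 / n ^ 12\<close> per vertex pays for the choice of the
  container, up to \<open>2 ^ n\<close> for each size.\<close>

lemma sum_connected_by_le:
  assumes n: "n \<ge> 2"
  shows "(\<Sum>B | B \<subseteq> V \<and> B \<noteq> {} \<and> connected_by R6 B \<and> card B \<le> K. 1 / real n ^ (12 * card B)) \<le> real K * 2 ^ n"
proof -
  let ?C = "{B. B \<subseteq> V \<and> B \<noteq> {} \<and> connected_by R6 B \<and> card B \<le> K}"
  have finC: "finite ?C" using finV by (auto intro: finite_subset[of _ "Pow V"])
  have "card ` ?C \<subseteq> {1..K}"
    using finite_subset[OF _ finV] by (auto simp: Suc_le_eq card_gt_0_iff)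
  then have "(\<Sum>B\<in>?C. 1 / real n ^ (12 * card B)) =
    (\<Sum>k\<in>{1..K}. \<Sum>B | B \<in> ?C \<and> card B = k. 1 / real n ^ (12 * card B))"
    using finC by (intro sum.group[symmetric]) auto
  also have "\<dots> \<le> (\<Sum>k\<in>{1..K}. 2 ^ n)"
  proof (rule sum_mono)
    fix k assume k: "k \<in> {1..K}"
    have "{B. B \<in> ?C \<and> card B = k} \<subseteq> {B. B \<subseteq> V \<and> connected_by R6 B \<and> card B = k}" by auto
    then have "card {B. B \<in> ?C \<and> card B = k} \<le> card {B. B \<subseteq> V \<and> connected_by R6 B \<and> card B = k}"
      using finV by (intro card_mono) (auto intro: finite_subset[of _ "Pow V"])
    also have "\<dots> \<le> card V * (n ^ 6) ^ (2 * k - 2)"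
      using k card_R6_le R6_sym by (intro card_connected_by_le finV) auto
    also have "\<dots> \<le> 2 ^ n * n ^ (12 * k)"
      using n cardV by (intro mult_mono) (auto simp: power_mult[symmetric] intro!: power_increasing)
    finally have "real (card {B. B \<in> ?C \<and> card B = k}) \<le> real (2 ^ n * n ^ (12 * k))" by (simp only: of_nat_le_iff)
    moreover have "(\<Sum>B | B \<in> ?C \<and> card B = k. 1 / real n ^ (12 * card B))
      = (\<Sum>B | B \<in> ?C \<and> card B = k. 1 / real n ^ (12 * k))" by (intro sum.cong) auto
    ultimately show "(\<Sum>B | B \<in> ?C \<and> card B = k. 1 / real n ^ (12 * card B)) \<le> 2 ^ n"
      using n by (simp add: divide_le_eq)
  qed
  finally show ?thesis by simp
qed

text \<open>\<open>Q\<close> is what a container inherits from the size restriction \<open>P\<close>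
  on its polymer; it differs between small and large polymers.\<close>

lemma cover_containers:
  assumes \<psi>: "\<psi> < n"
    and Q: "\<And>C B. C \<subseteq> V \<Longrightarrow> C \<noteq> {} \<Longrightarrow> connected_by R2 C \<Longrightarrow> P C \<Longrightarrow> B \<subseteq> C \<Longrightarrow> B \<noteq> {} \<Longrightarrow> C \<subseteq> mostly_covered \<psi> B \<Longrightarrow> Q B"
  shows "(\<Sum>C | C \<subseteq> V \<and> C \<noteq> {} \<and> connected_by R2 C \<and> P C. polymer_weight k C) \<le>
    (\<Sum>B | B \<subseteq> V \<and> B \<noteq> {} \<and> connected_by R6 B \<and> card (Nbs B) \<ge> n + \<psi> * (card B - 1) \<and> Q B.
      2 powr (real (card B) - card (Nbs B) + card (mostly_covered \<psi> B) + (real \<psi> + 3) * card (mostly_covered \<psi> B) / n))"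
proof -
  let ?C = "{C. C \<subseteq> V \<and> C \<noteq> {} \<and> connected_by R2 C \<and> P C}"
  let ?B = "{B. B \<subseteq> V \<and> B \<noteq> {} \<and> connected_by R6 B \<and> card (Nbs B) \<ge> n + \<psi> * (card B - 1) \<and> Q B}"
  let ?A = "\<lambda>B. {A. B \<subseteq> A \<and> A \<subseteq> mostly_covered \<psi> B}"
  have fin: "finite ?C" "finite ?B" using finV by (auto intro: finite_subset[of _ "Pow V"])
  have finA: "finite (?A B)" for B
    using finV mostly_covered_V[of \<psi> B] by (auto intro: finite_subset[of _ "Pow V"])
  have "(\<Sum>C\<in>?C. polymer_weight k C) \<le> (\<Sum>(B, A)\<in>(SIGMA B:?B. ?A B). polymer_weight k A)"
  proof (rule sum_le_included[where i = snd])
    show "\<forall>C\<in>?C. \<exists>y\<in>SIGMA B:?B. ?A B. snd y = C \<and> polymer_weight k C \<le> (case y of (B, A) \<Rightarrow> polymer_weight k A)"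
    proof
      fix C assume "C \<in> ?C"
      then have C: "C \<subseteq> V" "C \<noteq> {}" "connected_by R2 C" "P C" by auto
      obtain B where B: "B \<subseteq> C" "B \<noteq> {}" "C \<subseteq> mostly_covered \<psi> B" "card (Nbs B) \<ge> n + \<psi> * (card B - 1)"
        using ex_container[OF C(1,2)] by metis
      have "Q B" using Q[OF C B(1,2,3)] .
      moreover have "connected_by R6 B" using container_connected_by[OF C(1,3) B(1,3) \<psi>] .
      ultimately show "\<exists>y\<in>SIGMA B:?B. ?A B. snd y = C \<and> polymer_weight k C \<le> (case y of (B, A) \<Rightarrow> polymer_weight k A)"
        using B C by (intro bexI[of _ "(B, C)"]) auto
    qed
  qed (use fin finA polymer_weight_nonneg in auto)
  also have "\<dots> = (\<Sum>B\<in>?B. \<Sum>A\<in>?A B. polymer_weight k A)"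
    using fin finA by (subst sum.Sigma) auto
  also have "\<dots> \<le> (\<Sum>B\<in>?B. 2 powr (real (card B) - card (Nbs B) + card (mostly_covered \<psi> B) + (real \<psi> + 3) * card (mostly_covered \<psi> B) / n))"
    by (intro sum_mono container_weight_le) auto
  finally show ?thesis .
qed

text \<open>Here \<open>card S + card (Nbs B)\<close> is polynomial in \<open>n\<close>, so
  isoperimetry makes the container negligible against its neighbourhood. One-vertex containers
  dominate: up to \<open>2 ^ n\<close> of them, each of weight at most
  \<open>2 powr (3 - n)\<close>, give 8; all others together give at most 1.\<close>

lemma small_polymers:
  assumes n: "n \<ge> 60"
    and n2: "3 + 36 * log 2 n + 4 * log 2 (3 * real n ^ 4) \<le> real n / 10"
    and n3: "real n ^ 4 * 2 ^ n \<le> 2 powr (6 / 5 * n)"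
  shows "(\<Sum>C | C \<subseteq> V \<and> C \<noteq> {} \<and> connected_by R2 C \<and> card (Nbs C) \<le> n ^ 4. polymer_weight k C) \<le> 9"
proof -
  define \<psi> where "\<psi> = n div 2"
  have \<psi>: "\<psi> < n" "\<psi> \<le> n" "real \<psi> \<le> n / 2" "real \<psi> \<ge> n / 2 - 1 / 2" using n by (auto simp: \<psi>_def)
  let ?B = "{B. B \<subseteq> V \<and> B \<noteq> {} \<and> connected_by R6 B \<and> card (Nbs B) \<ge> n + \<psi> * (card B - 1) \<and> card (Nbs B) \<le> n ^ 4}"
  let ?E = "\<lambda>B. real (card B) - card (Nbs B) + card (mostly_covered \<psi> B) + (real \<psi> + 3) * card (mostly_covered \<psi> B) / n"
  let ?B1 = "{B\<in>?B. card B = 1}" and ?B2 = "{B\<in>?B. card B \<noteq> 1}"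
  have finB: "finite ?B" using finV by (auto intro: finite_subset[of _ "Pow V"])
  have "(\<Sum>C | C \<subseteq> V \<and> C \<noteq> {} \<and> connected_by R2 C \<and> card (Nbs C) \<le> n ^ 4. polymer_weight k C) \<le> (\<Sum>B\<in>?B. 2 powr ?E B)"
  proof (rule cover_containers[OF \<psi>(1)])
    fix C B assume C: "C \<subseteq> V" "card (Nbs C) \<le> n ^ 4" and B: "B \<subseteq> C"
    have "card (Nbs B) \<le> card (Nbs C)"
      using Nbs_subset[OF C(1)] finU finite_subset B by (intro card_mono) (auto simp: Nbs_def)
    then show "card (Nbs B) \<le> n ^ 4" using C by simp
  qed
  also have "\<dots> = (\<Sum>B\<in>?B1. 2 powr ?E B) + (\<Sum>B\<in>?B2. 2 powr ?E B)"
    by (rule sum_split_pred[OF finB])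
  also have "(\<Sum>B\<in>?B1. 2 powr ?E B) \<le> (\<Sum>B\<in>?B1. 2 powr (3 - real n))"
  proof (intro sum_mono powr_mono)
    fix B assume B: "B \<in> ?B1"
    then obtain v where v: "B = {v}" "v \<in> V" by (auto simp: card_1_singleton_iff)
    have NBv: "Nbs B = nb v" using v by (simp add: Nbs_def)
    \<comment> \<open>A second vertex shares at most two neighbours with \<open>v\<close>, hence
      misses at least \<open>n - 2\<close>, more than \<open>n div 2\<close>.\<close>
    have "mostly_covered \<psi> B \<subseteq> {v}"
    proof
      fix w assume w: "w \<in> mostly_covered \<psi> B"
      show "w \<in> {v}"
      proof (rule ccontr)
        assume "w \<notin> {v}"
        then have c: "card (nb w \<inter> nb v) \<le> 2" using codeg w v mostly_covered_V by blast
        have wV: "w \<in> V \<union> U" using w mostly_covered_V by blast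
        have "card (nb w - nb v) = n - card (nb w \<inter> nb v)"
          using fin_nb[OF wV] deg[OF wV] by (simp add: card_Diff_subset_Int)
        then have "n - 2 \<le> \<psi>" using w c NBv unfolding mostly_covered_def by auto
        then show False using n unfolding \<psi>_def by linarith
      qed
    qed
    then have s: "card (mostly_covered \<psi> B) \<le> 1" using card_mono[of "{v}"] by fastforce
    have "(real \<psi> + 3) * card (mostly_covered \<psi> B) / n \<le> (real \<psi> + 3) * 1 / n"
      using s by (intro divide_right_mono mult_left_mono) auto
    also have "\<dots> \<le> 1" using \<psi> n by (simp add: field_simps)
    finally show "?E B \<le> 3 - real n" using s v NBv deg[of v] by simp
  qed auto
  also have "(\<Sum>B\<in>?B1. 2 powr (3 - real n)) = card ?B1 * 2 powr (3 - real n)" by simp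
  also have "\<dots> \<le> 2 ^ n * 2 powr (3 - real n)"
  proof (intro mult_right_mono)
    have "?B1 \<subseteq> (\<lambda>v. {v}) ` V" by (auto simp: card_1_singleton_iff)
    then have "card ?B1 \<le> card ((\<lambda>v. {v}) ` V)" using finV by (intro card_mono) auto
    also have "\<dots> \<le> card V" by (rule card_image_le[OF finV])
    finally have "card ?B1 \<le> 2 ^ n" using cardV by simp
    then have "real (card ?B1) \<le> real (2 ^ n)" by (simp only: of_nat_le_iff)
    then show "real (card ?B1) \<le> 2 ^ n" by simp
  qed auto
  also have "\<dots> = 8" by (simp add: powr_diff powr_realpow)
  also have "(\<Sum>B\<in>?B2. 2 powr ?E B) \<le> (\<Sum>B\<in>?B2. 2 powr (- (6 / 5 * n)) * (1 / real n ^ (12 * card B)))"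
  proof (rule sum_mono)
    fix B assume B: "B \<in> ?B2"
    define f where "f = real (card (Nbs B))"
    define s where "s = real (card (mostly_covered \<psi> B))"
    define c where "c = real (card B)"
    define l where "l = log 2 (3 * real n ^ 4)"
    have BV: "B \<subseteq> V" using B by auto
    have finB: "finite B" using BV finV finite_subset by auto
    have c2: "card B \<ge> 2" using B finB by (cases "card B") (auto simp: card_gt_0_iff)
    have f1: "f \<ge> n + \<psi> * (c - 1)"
    proof -
      have "real (n + \<psi> * (card B - 1)) \<le> f" unfolding f_def using B by (simp only: of_nat_le_iff) auto
      then show ?thesis using c2 by (simp add: c_def of_nat_diff)
    qed
    have f4: "f \<le> real n ^ 4"
    proof -
      have "card (Nbs B) \<le> n ^ 4" using B by auto
      then have "real (card (Nbs B)) \<le> real (n ^ 4)" by (simp only: of_nat_le_iff)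
      then show ?thesis by (simp add: f_def)
    qed
    have s0: "s \<ge> 0" by (simp add: s_def)
    have cc: "c \<ge> 2" using c2 by (simp add: c_def)
    have "real \<psi> * (c - 1) \<ge> real \<psi> * 1" using cc by (intro mult_left_mono) auto
    \<comment> \<open>Two vertices in the container already force about \<open>3 / 2 * n\<close>
      neighbours; the excess over \<open>n\<close> absorbs the factor \<open>2 ^ n\<close> of
      \<open>sum_connected_by_le\<close>.\<close>
    then have f15: "f \<ge> 149 / 100 * n" using f1 \<psi> n by linarith
    have fpos: "f > 0" using f15 n by simp
    have s2f: "s \<le> 2 * f"
    proof -
      have "(n - \<psi>) * card (mostly_covered \<psi> B) \<le> n * card (Nbs B)"
        using mostly_covered_edges[OF BV \<psi>(2)] by (rule order.trans)
      then have "real ((n - \<psi>) * card (mostly_covered \<psi> B)) \<le> real (n * card (Nbs B))" by (simp only: of_nat_le_iff)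
      then have "(real n - \<psi>) * s \<le> n * f" using \<psi> by (simp add: s_def f_def of_nat_diff)
      moreover have "n / 2 * s \<le> (real n - \<psi>) * s" using \<psi> s0 by (intro mult_right_mono) auto
      ultimately have "n * s \<le> n * (2 * f)" by simp
      then show ?thesis using n by simp
    qed
    have l: "l \<le> n / 40" "l \<ge> 0" and lg: "log 2 n \<ge> 0"
    proof -
      show "log 2 n \<ge> 0" using n by simp
      then show "l \<le> n / 40" using n2 by (simp add: l_def)
      have "1 \<le> real n ^ 4" using n by simp
      then have "1 \<le> 3 * real n ^ 4" by linarith
      then show "l \<ge> 0" unfolding l_def by (subst zero_le_log_cancel_iff) (use n in auto)
    qed
    have "2 * (real n - \<psi>) * s \<le> (s + f) * l"
      unfolding s_def f_def
    proof (rule mostly_covered_iso[OF BV \<psi>(2)])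
      have "s + f \<le> 3 * real n ^ 4" using s2f f4 by simp
      also have "\<dots> = 2 powr l" unfolding l_def using n by simp
      finally show "real (card (mostly_covered \<psi> B)) + real (card (Nbs B)) \<le> 2 powr l" by (simp add: s_def f_def)
      show "card (Nbs B) > 0" using fpos by (simp add: f_def)
    qed
    moreover have "n * s \<le> 2 * (real n - \<psi>) * s" using \<psi> s0 by (intro mult_right_mono) auto
    ultimately have "n * s \<le> s * l + f * l" by (simp add: algebra_simps)
    moreover have "s * l \<le> s * (n / 2)" using l s0 by (intro mult_left_mono) auto
    ultimately have sn: "s * n \<le> 2 * f * l" by (simp add: algebra_simps)
    have cn: "c * n \<le> 3 * f"
    proof -
      have "n / 3 * (c - 1) \<le> \<psi> * (c - 1)" using \<psi> n cc by (intro mult_right_mono) auto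
      then have "n + n / 3 * (c - 1) \<le> f" using f1 by linarith
      then have "3 * n + (c * n - n) \<le> 3 * f" by (simp add: field_simps)
      then show ?thesis using n by simp
    qed
    have "(c * (1 + 12 * log 2 n) + 2 * s) * n = (c * n) * (1 + 12 * log 2 n) + 2 * (s * n)"
      by (simp add: algebra_simps)
    also have "\<dots> \<le> (3 * f) * (1 + 12 * log 2 n) + 2 * (2 * f * l)"
      using cn sn lg by (intro add_mono mult_right_mono mult_left_mono) auto
    also have "\<dots> = f * (3 + 36 * log 2 n + 4 * l)" by (simp add: algebra_simps)
    also have "\<dots> \<le> f * (n / 10)" using n2 fpos by (intro mult_left_mono) (auto simp: l_def)
    finally have "(c * (1 + 12 * log 2 n) + 2 * s) * real n \<le> (f / 10) * real n" by simp
    then have "c * (1 + 12 * log 2 n) + 2 * s \<le> f / 10" by (rule mult_right_le_imp_le) (use n in simp)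
    then have main: "c - f + 2 * s + 12 * c * log 2 n \<le> - (6 / 5 * n)" using f15 by (simp add: algebra_simps)
    have "(real \<psi> + 3) * s / n \<le> 1 * s"
    proof -
      have "(real \<psi> + 3) * s \<le> n * s" using \<psi> n s0 by (intro mult_right_mono) auto
      then show ?thesis using n by (simp add: field_simps)
    qed
    then have "?E B \<le> - (6 / 5 * n) - 12 * c * log 2 n"
      using main by (simp add: c_def[symmetric] s_def[symmetric] f_def[symmetric])
    then have "2 powr ?E B \<le> 2 powr (- (6 / 5 * n) - 12 * c * log 2 n)" by (intro powr_mono) auto
    also have "\<dots> = 2 powr (- (6 / 5 * n)) / 2 powr (12 * c * log 2 n)" by (simp add: powr_diff)
    also have "2 powr (12 * c * log 2 n) = (2 powr log 2 n) powr (12 * c)" by (simp add: powr_powr mult_ac)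
    also have "\<dots> = n ^ (12 * card B)"
    proof -
      have "real n powr (12 * c) = real n powr real (12 * card B)" by (simp add: c_def)
      also have "\<dots> = real n ^ (12 * card B)" using n by (subst powr_realpow) auto
      finally show ?thesis using n by simp
    qed
    finally show "2 powr ?E B \<le> 2 powr (- (6 / 5 * n)) * (1 / real n ^ (12 * card B))" by simp
  qed
  also have "\<dots> = 2 powr (- (6 / 5 * n)) * (\<Sum>B\<in>?B2. 1 / real n ^ (12 * card B))"
    by (simp add: sum_distrib_left)
  also have "\<dots> \<le> 2 powr (- (6 / 5 * n)) * (real (n ^ 4) * 2 ^ n)"
  proof (rule mult_left_mono)
    have "(\<Sum>B\<in>?B2. 1 / real n ^ (12 * card B)) \<le>
      (\<Sum>B | B \<subseteq> V \<and> B \<noteq> {} \<and> connected_by R6 B \<and> card B \<le> n ^ 4. 1 / real n ^ (12 * card B))"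
    proof (rule sum_mono2)
      show "finite {B. B \<subseteq> V \<and> B \<noteq> {} \<and> connected_by R6 B \<and> card B \<le> n ^ 4}"
        using finV by (auto intro: finite_subset[of _ "Pow V"])
      show "?B2 \<subseteq> {B. B \<subseteq> V \<and> B \<noteq> {} \<and> connected_by R6 B \<and> card B \<le> n ^ 4}"
      proof
        fix B assume B: "B \<in> ?B2"
        have "1 * (card B - 1) \<le> \<psi> * (card B - 1)" using n by (intro mult_right_mono) (auto simp: \<psi>_def)
        then have "card B \<le> n + \<psi> * (card B - 1)" using n by linarith
        then show "B \<in> {B. B \<subseteq> V \<and> B \<noteq> {} \<and> connected_by R6 B \<and> card B \<le> n ^ 4}" using B by auto
      qed
    qed auto
    also have "\<dots> \<le> real (n ^ 4) * 2 ^ n" using n by (intro sum_connected_by_le) auto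
    finally show "(\<Sum>B\<in>?B2. 1 / real n ^ (12 * card B)) \<le> real (n ^ 4) * 2 ^ n" .
  qed auto
  also have "\<dots> \<le> 1" using n3 by (simp add: powr_minus field_simps)
  finally show ?thesis by simp
qed

text \<open>With at most \<open>2 powr (n - q)\<close> vertices involved, isoperimetry saves
  \<open>f * q / n\<close> bits for a neighbourhood of size \<open>f\<close>. Taking
  \<open>\<psi>\<close> about \<open>q / 8\<close> spoils only part of this and keeps the container
  below \<open>16 * f / q\<close> vertices. Naming the container may use half of the saving, and
  this is the condition \<open>32 * n * (1 + 12 * log 2 n) \<le> q\<^sup>2\<close>.\<close>

lemma large_polymers:
  fixes q :: real
  assumes n: "n \<ge> 60" and q: "24 \<le> q" "q \<le> n / 2" and q2: "32 * n * (1 + 12 * log 2 n) \<le> q\<^sup>2"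
    and \<Theta>: "3 * n * real \<Theta> \<le> 2 powr (n - q)"
  shows "(\<Sum>C | C \<subseteq> V \<and> C \<noteq> {} \<and> connected_by R2 C \<and> (card C \<le> \<Theta> \<and> card (Nbs C) > n ^ 4). polymer_weight k C) \<le> 1"
proof -
  define \<psi> where "\<psi> = nat \<lfloor>q / 8\<rfloor>"
  have "real \<psi> = of_int \<lfloor>q / 8\<rfloor>" using q by (simp add: \<psi>_def)
  moreover have "of_int \<lfloor>q / 8\<rfloor> \<le> q / 8" "q / 8 - 1 \<le> of_int \<lfloor>q / 8\<rfloor>" by linarith+
  ultimately have \<psi>q: "real \<psi> \<le> q / 8" "real \<psi> \<ge> q / 16" using q by linarith+
  have \<psi>: "\<psi> < n" "\<psi> \<le> n" "real \<psi> \<le> n / 2" using \<psi>q q n by linarith+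
  let ?B = "{B. B \<subseteq> V \<and> B \<noteq> {} \<and> connected_by R6 B \<and> card (Nbs B) \<ge> n + \<psi> * (card B - 1) \<and>
    (real (card (Nbs B)) \<ge> n ^ 3 / 2 \<and> card B \<le> \<Theta>)}"
  let ?E = "\<lambda>B. real (card B) - card (Nbs B) + card (mostly_covered \<psi> B) + (real \<psi> + 3) * card (mostly_covered \<psi> B) / n"
  have finB: "finite ?B" using finV by (auto intro: finite_subset[of _ "Pow V"])
  have cardNB: "card (Nbs A) \<le> n * card A" if "A \<subseteq> V" for A
  proof -
    have fA: "finite A" using that finV finite_subset by auto
    have "card (Nbs A) \<le> (\<Sum>v\<in>A. card (nb v))" unfolding Nbs_def by (intro card_UN_le fA)
    also have "\<dots> = (\<Sum>v\<in>A. n)" using that deg by (intro sum.cong) auto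
    finally show ?thesis by (simp add: mult.commute)
  qed
  have sf: "real (card (mostly_covered \<psi> B)) \<le> 2 * card (Nbs B)" if B: "B \<subseteq> V" for B
  proof -
    have "(n - \<psi>) * card (mostly_covered \<psi> B) \<le> n * card (Nbs B)"
      using mostly_covered_edges[OF B \<psi>(2)] by (rule order.trans)
    then have "real ((n - \<psi>) * card (mostly_covered \<psi> B)) \<le> real (n * card (Nbs B))" by (simp only: of_nat_le_iff)
    then have "(real n - \<psi>) * card (mostly_covered \<psi> B) \<le> n * real (card (Nbs B))" using \<psi> by (simp add: of_nat_diff)
    moreover have "n / 2 * card (mostly_covered \<psi> B) \<le> (real n - \<psi>) * card (mostly_covered \<psi> B)" using \<psi> by (intro mult_right_mono) auto
    ultimately have "n * real (card (mostly_covered \<psi> B)) \<le> n * (2 * card (Nbs B))" by simp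
    then show ?thesis using n by simp
  qed
  have "(\<Sum>C | C \<subseteq> V \<and> C \<noteq> {} \<and> connected_by R2 C \<and> (card C \<le> \<Theta> \<and> card (Nbs C) > n ^ 4). polymer_weight k C) \<le> (\<Sum>B\<in>?B. 2 powr ?E B)"
  proof (rule cover_containers[OF \<psi>(1)])
    fix C B assume C: "C \<subseteq> V" "card C \<le> \<Theta> \<and> card (Nbs C) > n ^ 4" and B: "B \<subseteq> C" "C \<subseteq> mostly_covered \<psi> B"
    have finC: "finite C" using C finV finite_subset by auto
    have BV: "B \<subseteq> V" using B C by auto
    have "card C \<le> card (mostly_covered \<psi> B)" using B finite_subset[OF mostly_covered_V finV] by (intro card_mono) auto
    then have "real (card C) \<le> 2 * real (card (Nbs B))" using sf[OF BV] by linarith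
    then have "real n * real (card C) \<le> real n * (2 * real (card (Nbs B)))" by (intro mult_left_mono) auto
    moreover have "real (card (Nbs C)) \<le> real (n * card C)" using cardNB[OF C(1)] by (simp only: of_nat_le_iff)
    moreover have "real (n ^ 4) \<le> real (card (Nbs C))" using C(2) by (intro of_nat_mono) auto
    ultimately have "real (n ^ 4) \<le> real n * (2 * real (card (Nbs B)))" unfolding of_nat_mult by linarith
    also have "real (n ^ 4) = n * real (n ^ 3)" by (simp add: power3_eq_cube power4_eq_xxxx)
    finally have "real (n ^ 3) \<le> 2 * card (Nbs B)" using n by simp
    moreover have "card B \<le> \<Theta>" using card_mono[OF finC B(1)] C by simp
    ultimately show "real (card (Nbs B)) \<ge> n ^ 3 / 2 \<and> card B \<le> \<Theta>" by simp
  qed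
  also have "\<dots> \<le> (\<Sum>B\<in>?B. 2 powr (- (real n ^ 2)) * (1 / real n ^ (12 * card B)))"
  proof (rule sum_mono)
    fix B assume B: "B \<in> ?B"
    define f where "f = real (card (Nbs B))"
    define s where "s = real (card (mostly_covered \<psi> B))"
    define c where "c = real (card B)"
    have BV: "B \<subseteq> V" using B by auto
    have finB: "finite B" using BV finV finite_subset by auto
    have c1: "card B \<ge> 1" using B finB by (cases "card B") auto
    have f1: "f \<ge> n + \<psi> * (c - 1)"
    proof -
      have "real (n + \<psi> * (card B - 1)) \<le> f" unfolding f_def using B by (simp only: of_nat_le_iff) auto
      then show ?thesis using c1 by (simp add: c_def of_nat_diff)
    qed
    have f3: "f \<ge> real n ^ 3 / 2" using B by (auto simp: f_def)
    have "0 < real n ^ 3 / 2" using n by simp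
    then have fpos: "f > 0" using f3 by linarith
    have s0: "s \<ge> 0" by (simp add: s_def)
    have s2f: "s \<le> 2 * f" using sf[OF BV] by (simp add: s_def f_def)
    have cc: "c \<ge> 1" using c1 by (simp add: c_def)
    have ft: "f \<le> n * real \<Theta>"
    proof -
      have "card B \<le> \<Theta>" using B by auto
      then have "card (Nbs B) \<le> n * \<Theta>" using order.trans[OF cardNB[OF BV] mult_le_mono2] by blast
      then have "real (card (Nbs B)) \<le> real (n * \<Theta>)" by (simp only: of_nat_le_iff)
      then show ?thesis by (simp add: f_def)
    qed
    have "2 * (real n - \<psi>) * s \<le> (s + f) * (n - q)"
      unfolding s_def f_def
    proof (rule mostly_covered_iso[OF BV \<psi>(2)])
      have "s + f \<le> 3 * (n * real \<Theta>)" using s2f ft by simp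
      then show "real (card (mostly_covered \<psi> B)) + real (card (Nbs B)) \<le> 2 powr (n - q)" using \<Theta> by (simp add: s_def f_def)
      show "card (Nbs B) > 0" using fpos by (simp add: f_def)
    qed
    then have "s * (n + q - 2 * \<psi>) \<le> f * (n - q)" by (simp add: algebra_simps)
    moreover have "s * (n + 3 / 4 * q) \<le> s * (n + q - 2 * \<psi>)" using \<psi>q s0 by (intro mult_left_mono) auto
    ultimately have s1: "s * (n + 3 / 4 * q) \<le> f * (n - q)" by linarith
    have s3: "s * (n + q / 4) \<le> f * (n - q)"
    proof -
      have "s * (n + q / 4) \<le> s * (n + 3 / 4 * q)" using q s0 by (intro mult_left_mono) auto
      then show ?thesis using s1 by linarith
    qed
    have "(real \<psi> + 3) * s \<le> (q / 4) * s" using \<psi>q q s0 by (intro mult_right_mono) auto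
    then have "real n * s + (real \<psi> + 3) * s \<le> s * (n + q / 4)" by (simp add: algebra_simps)
    moreover have "n * (s + (real \<psi> + 3) * s / n) = real n * s + (real \<psi> + 3) * s" using n by (simp add: distrib_left)
    ultimately have "n * (s + (real \<psi> + 3) * s / n) \<le> s * (n + q / 4)" by simp
    also have "\<dots> \<le> f * (n - q)" by (rule s3)
    also have "\<dots> = n * (f * (1 - q / n))" using n by (simp add: field_simps)
    finally have sE: "s + (real \<psi> + 3) * s / n \<le> f * (1 - q / n)" using n by simp
    have cq: "c * q \<le> 16 * f"
    proof -
      have "q / 16 * (c - 1) \<le> \<psi> * (c - 1)" using \<psi>q cc by (intro mult_right_mono) auto
      then have "n + q / 16 * (c - 1) \<le> f" using f1 by linarith
      moreover have "q / 16 * (c - 1) = c * q / 16 - q / 16" by (simp add: field_simps)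
      ultimately show ?thesis using q n by linarith
    qed
    have lg: "log 2 n \<ge> 0" using n by simp
    have "(c * (1 + 12 * log 2 n)) * (q * (2 * n)) = (c * q) * (2 * n * (1 + 12 * log 2 n))" by (simp add: algebra_simps)
    also have "\<dots> \<le> (16 * f) * (2 * n * (1 + 12 * log 2 n))" using cq lg by (intro mult_right_mono) auto
    also have "\<dots> = f * (32 * n * (1 + 12 * log 2 n))" by (simp add: algebra_simps)
    also have "\<dots> \<le> f * q\<^sup>2" using q2 fpos by (intro mult_left_mono) auto
    finally have "(c * (1 + 12 * log 2 n)) \<le> f * q\<^sup>2 / (q * (2 * n))"
      using q n by (simp add: pos_le_divide_eq)
    also have "\<dots> = f * q / (2 * n)" using q by (simp add: power2_eq_square)
    finally have cl: "c * (1 + 12 * log 2 n) \<le> f * q / (2 * n)" .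
    \<comment> \<open>The other half of the saving. It is this large because
      \<open>card (Nbs B)\<close> is at least \<open>n ^ 3 / 2\<close>, and it outweighs the crude
      factor \<open>2 ^ n * 2 ^ n\<close> for all containers.\<close>
    have "f * q / (2 * n) \<ge> real n ^ 2"
    proof -
      have "real n ^ 3 / 2 * 24 \<le> f * q" using f3 q fpos by (intro mult_mono) auto
      moreover have "real n ^ 3 / 2 * 24 = 12 * (real n ^ 3)" "real n ^ 2 * (2 * n) = 2 * (real n ^ 3)"
        by (simp_all add: power2_eq_square power3_eq_cube)
      moreover have "real n ^ 3 \<ge> 0" by simp
      ultimately have "real n ^ 2 * (2 * n) \<le> f * q" by linarith
      then show ?thesis using n by (simp add: pos_le_divide_eq)
    qed
    then have main: "c - f + f * (1 - q / n) + 12 * c * log 2 n \<le> - (real n ^ 2)"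
      using cl by (simp add: algebra_simps)
    then have "?E B \<le> - (real n ^ 2) - 12 * c * log 2 n"
      using sE by (simp add: c_def[symmetric] s_def[symmetric] f_def[symmetric])
    then have "2 powr ?E B \<le> 2 powr (- (real n ^ 2) - 12 * c * log 2 n)" by (intro powr_mono) auto
    also have "\<dots> = 2 powr (- (real n ^ 2)) / 2 powr (12 * c * log 2 n)" by (simp add: powr_diff)
    also have "2 powr (12 * c * log 2 n) = (2 powr log 2 n) powr (12 * c)" by (simp add: powr_powr mult_ac)
    also have "\<dots> = n ^ (12 * card B)"
    proof -
      have "real n powr (12 * c) = real n powr real (12 * card B)" by (simp add: c_def)
      also have "\<dots> = real n ^ (12 * card B)" using n by (subst powr_realpow) auto
      finally show ?thesis using n by simp
    qed
    finally show "2 powr ?E B \<le> 2 powr (- (real n ^ 2)) * (1 / real n ^ (12 * card B))" by simp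
  qed
  also have "\<dots> = 2 powr (- (real n ^ 2)) * (\<Sum>B\<in>?B. 1 / real n ^ (12 * card B))"
    by (simp add: sum_distrib_left)
  also have "\<dots> \<le> 2 powr (- (real n ^ 2)) * (real (2 ^ n) * 2 ^ n)"
  proof (rule mult_left_mono)
    have "(\<Sum>B\<in>?B. 1 / real n ^ (12 * card B)) \<le>
      (\<Sum>B | B \<subseteq> V \<and> B \<noteq> {} \<and> connected_by R6 B \<and> card B \<le> 2 ^ n. 1 / real n ^ (12 * card B))"
    proof (rule sum_mono2)
      show "finite {B. B \<subseteq> V \<and> B \<noteq> {} \<and> connected_by R6 B \<and> card B \<le> 2 ^ n}"
        using finV by (auto intro: finite_subset[of _ "Pow V"])
      show "?B \<subseteq> {B. B \<subseteq> V \<and> B \<noteq> {} \<and> connected_by R6 B \<and> card B \<le> 2 ^ n}"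
        using card_mono[OF finV] cardV order.trans by blast
    qed auto
    also have "\<dots> \<le> real (2 ^ n) * 2 ^ n" using n by (intro sum_connected_by_le) auto
    finally show "(\<Sum>B\<in>?B. 1 / real n ^ (12 * card B)) \<le> real (2 ^ n) * 2 ^ n" .
  qed auto
  also have "\<dots> = 2 powr (2 * real n - (real n ^ 2))"
  proof -
    have "real (2 ^ n) * 2 ^ n = 2 powr (real n + real n)" unfolding powr_add by (simp add: powr_realpow)
    then have "2 powr (- (real n ^ 2)) * (real (2 ^ n) * 2 ^ n) = 2 powr (- (real n ^ 2) + (real n + real n))"
      by (simp only: powr_add)
    then show ?thesis by (simp add: algebra_simps)
  qed
  also have "\<dots> \<le> 2 powr 0"
    using n by (intro powr_mono) (auto simp: power2_eq_square intro!: mult_right_mono)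
  finally show ?thesis by simp
qed

lemma sparse_sum_le:
  fixes q :: real
  assumes n: "n \<ge> 60"
    and n2: "3 + 36 * log 2 n + 4 * log 2 (3 * real n ^ 4) \<le> real n / 10"
    and n3: "real n ^ 4 * 2 ^ n \<le> 2 powr (6 / 5 * n)"
    and q: "24 \<le> q" "q \<le> n / 2" and q2: "32 * n * (1 + 12 * log 2 n) \<le> q\<^sup>2"
    and \<Theta>: "3 * n * real \<Theta> \<le> 2 powr (n - q)"
  shows "(\<Sum>A | A \<subseteq> V \<and> card A \<le> \<Theta>. polymer_weight k A) \<le> exp 10"
proof -
  have "(\<Sum>A | A \<subseteq> V \<and> card A \<le> \<Theta>. polymer_weight k A) \<le>
    exp (\<Sum>C | C \<subseteq> V \<and> C \<noteq> {} \<and> connected_by R2 C \<and> card C \<le> \<Theta>. polymer_weight k C)"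
    using polymer_weight_mult polymer_weight_nonneg polymer_weight_empty R2_sym by (intro polymer_sum_le finV) auto
  also have "(\<Sum>C | C \<subseteq> V \<and> C \<noteq> {} \<and> connected_by R2 C \<and> card C \<le> \<Theta>. polymer_weight k C) \<le>
    (\<Sum>C | C \<subseteq> V \<and> C \<noteq> {} \<and> connected_by R2 C \<and> card (Nbs C) \<le> n ^ 4. polymer_weight k C) +
    (\<Sum>C | C \<subseteq> V \<and> C \<noteq> {} \<and> connected_by R2 C \<and> (card C \<le> \<Theta> \<and> card (Nbs C) > n ^ 4). polymer_weight k C)"
    using finV polymer_weight_nonneg
    by (subst sum.union_disjoint[symmetric])
      (auto intro!: sum_mono2 intro: finite_subset[of _ "Pow V"])
  also have "\<dots> \<le> 9 + 1" using small_polymers large_polymers assms by (intro add_mono) auto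
  finally show ?thesis by simp
qed

end

section \<open>Colourings of the cube\<close>

definition parity_class :: "'a set \<Rightarrow> bool \<Rightarrow> 'a set set" where
  "parity_class N p = {x. x \<subseteq> N \<and> even (card x) = p}"

definition cube_nbs :: "'a set \<Rightarrow> 'a set \<Rightarrow> 'a set set" where
  "cube_nbs N x = (\<lambda>i. flip i x) ` N"

definition colourings :: "'a set \<Rightarrow> ('a set \<Rightarrow> 3) set" where
  "colourings N = {c \<in> PiE (Pow N) (\<lambda>_. UNIV). \<forall>x\<in>Pow N. \<forall>i\<in>N. c (flip i x) \<noteq> c x}"

lemma finite_colourings: "finite N \<Longrightarrow> finite (colourings N)"
  unfolding colourings_def by (rule finite_subset[OF _ finite_PiE[of "Pow N" "\<lambda>_. UNIV"]]) auto

lemma parity_class_Un: "parity_class N p \<union> parity_class N (\<not> p) = Pow N" "parity_class N p \<inter> parity_class N (\<not> p) = {}"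
  by (auto simp: parity_class_def)

lemma finite_parity_class: "finite N \<Longrightarrow> finite (parity_class N p)"
  by (rule finite_subset[of _ "Pow N"]) (auto simp: parity_class_def)

lemma flip_parity_class:
  assumes "finite N" "i \<in> N"
  shows "flip i x \<in> parity_class N p \<longleftrightarrow> x \<in> parity_class N (\<not> p)"
  using assms even_card_flip[of x i] finite_subset[of x N] finite_subset[of "flip i x" N]
  by (auto simp: parity_class_def)

lemma card_parity_class:
  assumes "finite N" "N \<noteq> {}"
  shows "card (parity_class N p) = 2 ^ (card N - 1)"
proof -
  obtain i where i: "i \<in> N" using assms by blast
  have "parity_class N (\<not> p) = flip i ` parity_class N p"
  proof (rule set_eqI)
    fix x
    show "x \<in> parity_class N (\<not> p) \<longleftrightarrow> x \<in> flip i ` parity_class N p"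
      using flip_parity_class[OF assms(1) i, of x p] flip_parity_class[OF assms(1) i, of _ "\<not> p"]
      by (auto simp: image_iff) (metis flip_flip)
  qed
  then have "card (parity_class N (\<not> p)) = card (parity_class N p)" by (simp add: card_image inj_on_def)
  moreover have "card (parity_class N p) + card (parity_class N (\<not> p)) = 2 ^ card N"
  proof -
    have "card (parity_class N p \<union> parity_class N (\<not> p)) = card (parity_class N p) + card (parity_class N (\<not> p))"
      using assms(1) by (intro card_Un_disjoint finite_parity_class parity_class_Un(2))
    then show ?thesis using assms(1) by (simp add: parity_class_Un(1) card_Pow)
  qed
  moreover have "2 ^ card N = 2 * (2::nat) ^ (card N - 1)"
    using assms by (cases "card N") auto
  ultimately show ?thesis by linarith
qed

lemma mem_flip: "a \<in> flip i x \<longleftrightarrow> (a \<in> x) \<noteq> (a = i)"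
  by (auto simp: flip_def)

lemma card_cube_nbs: "card (cube_nbs N x) = card N"
  unfolding cube_nbs_def by (rule card_image) (simp add: inj_on_def)

lemma cube_nbs_sym: "x \<in> cube_nbs N y \<longleftrightarrow> y \<in> cube_nbs N x"
  unfolding cube_nbs_def by (metis (no_types, lifting) flip_flip imageE imageI)

lemma cube_nbs_parity_class: "finite N \<Longrightarrow> x \<in> parity_class N p \<Longrightarrow> cube_nbs N x \<subseteq> parity_class N (\<not> p)"
  using flip_parity_class[of N _ x "\<not> p"] by (auto simp: cube_nbs_def)

text \<open>\<open>flip i v = flip j w\<close> means that \<open>v\<close> and \<open>w\<close>
  differ exactly in \<open>i\<close> and \<open>j\<close>, so a common neighbour arises from
  \<open>v\<close> by one of these two flips.\<close>

lemma card_cube_nbs_Int_le: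
  assumes "v \<noteq> w"
  shows "card (cube_nbs N v \<inter> cube_nbs N w) \<le> 2"
proof (cases "cube_nbs N v \<inter> cube_nbs N w = {}")
  case False
  then obtain i j where ij: "flip i v = flip j w" by (auto simp: cube_nbs_def)
  have "cube_nbs N v \<inter> cube_nbs N w \<subseteq> {flip i v, flip j v}"
  proof
    fix z assume "z \<in> cube_nbs N v \<inter> cube_nbs N w"
    then obtain a b where z: "z = flip a v" "z = flip b w" by (auto simp: cube_nbs_def)
    have "a = i \<or> a = j"
    proof (rule ccontr)
      assume n: "\<not> (a = i \<or> a = j)"
      have e: "a \<in> flip i v \<longleftrightarrow> a \<in> flip j w" using ij by simp
      have "a \<in> flip a v \<longleftrightarrow> a \<in> flip b w" using z by simp
      then have "a = b" using e n by (auto simp: mem_flip)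
      then show False using z assms by simp
    qed
    then show "z \<in> {flip i v, flip j v}" using z by auto
  qed
  then have "card (cube_nbs N v \<inter> cube_nbs N w) \<le> card {flip i v, flip j v}" by (intro card_mono) auto
  also have "\<dots> \<le> 2" by (simp add: card_insert_if)
  finally show ?thesis .
qed simp

lemma bip_graph_cube:
  assumes N: "finite N" "N \<noteq> {}"
  shows "bip_graph (parity_class N p) (parity_class N (\<not> p)) (cube_nbs N) (card N)"
proof
  show "card N > 0" using N by (simp add: card_gt_0_iff)
  show "cube_nbs N u \<subseteq> parity_class N p" if "u \<in> parity_class N (\<not> p)" for u using cube_nbs_parity_class[OF N(1) that] by simp
  show "cube_nbs N v \<subseteq> parity_class N (\<not> p)" if "v \<in> parity_class N p" for v using cube_nbs_parity_class[OF N(1) that] .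
  show "u \<in> cube_nbs N v \<longleftrightarrow> v \<in> cube_nbs N u" for u v by (rule cube_nbs_sym)
qed (use N parity_class_Un(2) in \<open>simp_all add: finite_parity_class card_cube_nbs\<close>)

text \<open>Vertices of equal parity are never adjacent, so the edges inside
  \<open>S \<union> F\<close> are the edges between \<open>S\<close> and \<open>F\<close>, and
  \<open>edge_isoperimetry\<close> for the union is the required bound.\<close>

lemma iso_graph_cube:
  assumes N: "finite N" "N \<noteq> {}"
  shows "iso_graph (parity_class N p) (parity_class N (\<not> p)) (cube_nbs N) (card N)"
proof -
  interpret bip_graph "parity_class N p" "parity_class N (\<not> p)" "cube_nbs N" "card N" by (rule bip_graph_cube[OF N])
  show ?thesis
  proof
    show "card (cube_nbs N v \<inter> cube_nbs N w) \<le> 2" if "v \<noteq> w" for v w using that by (rule card_cube_nbs_Int_le)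
    have "card (parity_class N p) \<le> card (Pow N)" using N by (intro card_mono) (auto simp: parity_class_def)
    then show "card (parity_class N p) \<le> 2 ^ card N" using N by (simp add: card_Pow)
  next
    fix S F assume S: "S \<subseteq> parity_class N p" and F: "F \<subseteq> parity_class N (\<not> p)"
    have fin: "finite S" "finite F" using S F finite_parity_class[OF N(1)] finite_subset by blast+
    have SF: "S \<inter> F = {}" using S F parity_class_Un(2)[of N p] by blast
    have c: "real (card S) + card F = card (S \<union> F)" using fin SF by (simp add: card_Un_disjoint)
    have fS: "flip i x \<notin> S" if "x \<in> S" "i \<in> N" for i x
      using that S flip_parity_class[OF N(1) that(2), of x p] parity_class_Un(2)[of N p] by blast
    have fF: "flip i x \<notin> F" if "x \<in> F" "i \<in> N" for i x
      using that F flip_parity_class[OF N(1) that(2), of x "\<not> p"] parity_class_Un(2)[of N p] by auto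
    have cnt: "card {i\<in>N. flip i x \<in> X} = card (cube_nbs N x \<inter> X)" for x X
    proof -
      have "cube_nbs N x \<inter> X = (\<lambda>i. flip i x) ` {i\<in>N. flip i x \<in> X}" by (auto simp: cube_nbs_def)
      then show ?thesis by (simp add: card_image inj_on_def)
    qed
    have "(\<Sum>i\<in>N. card {x\<in>S \<union> F. flip i x \<in> S \<union> F}) = (\<Sum>i\<in>N. \<Sum>x\<in>S \<union> F. if flip i x \<in> S \<union> F then 1 else 0)"
      using fin by (intro sum.cong refl) (simp add: sum.If_cases Int_def)
    also have "\<dots> = (\<Sum>x\<in>S \<union> F. card {i\<in>N. flip i x \<in> S \<union> F})"
      using N by (subst sum.swap) (intro sum.cong refl, simp add: sum.If_cases Int_def)
    also have "\<dots> = (\<Sum>x\<in>S. card {i\<in>N. flip i x \<in> S \<union> F}) + (\<Sum>x\<in>F. card {i\<in>N. flip i x \<in> S \<union> F})"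
      using fin SF by (rule sum.union_disjoint)
    also have "(\<Sum>x\<in>S. card {i\<in>N. flip i x \<in> S \<union> F}) = (\<Sum>x\<in>S. card (cube_nbs N x \<inter> F))"
      unfolding cnt[symmetric] using fS by (intro sum.cong refl arg_cong[of _ _ card]) auto
    also have "(\<Sum>x\<in>F. card {i\<in>N. flip i x \<in> S \<union> F}) = (\<Sum>x\<in>F. card (cube_nbs N x \<inter> S))"
      unfolding cnt[symmetric] using fF by (intro sum.cong refl arg_cong[of _ _ card]) auto
    also have "\<dots> = (\<Sum>x\<in>S. card (cube_nbs N x \<inter> F))" using sum_deg[OF S F] by simp
    finally have f: "(\<Sum>i\<in>N. card {x\<in>S \<union> F. flip i x \<in> S \<union> F})
      = (\<Sum>v\<in>S. card (cube_nbs N v \<inter> F)) + (\<Sum>v\<in>S. card (cube_nbs N v \<inter> F))" .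
    have e: "2 * real (\<Sum>v\<in>S. card (cube_nbs N v \<inter> F)) = (\<Sum>i\<in>N. real (card {x\<in>S \<union> F. flip i x \<in> S \<union> F}))"
      unfolding of_nat_sum[symmetric] f by simp
    show "2 * real (\<Sum>v\<in>S. card (cube_nbs N v \<inter> F)) \<le> (real (card S) + real (card F)) * log 2 (real (card S) + real (card F))"
    proof (cases "S \<union> F = {}")
      case False
      have "S \<union> F \<subseteq> Pow N" using S F by (auto simp: parity_class_def)
      from edge_isoperimetry[OF N(1) this False] show ?thesis unfolding e c by simp
    qed auto
  qed
qed

lemma (in bip_graph) sum_sparse_eq:
  "(\<Sum>A | A \<subseteq> V \<and> card A \<le> \<Theta>. \<Sum>a\<in>PiE A (\<lambda>_. - {k}). \<Prod>u\<in>U. real (card (- ext k A a ` nb u)))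
    = 2 ^ card U * (\<Sum>A | A \<subseteq> V \<and> card A \<le> \<Theta>. polymer_weight k A)"
proof -
  have "(\<Prod>u\<in>U. real (card (- ext k A a ` nb u))) = 2 ^ card U * (\<Prod>u\<in>U. half_choices k A a u)" for A a
    unfolding half_choices_def prod_dividef by simp
  then show ?thesis unfolding polymer_weight_def by (simp add: sum_distrib_left)
qed

text \<open>A colouring is encoded by its deviation set, the colours on that set and the colours of
  the free class. The free vertices choose independently among the colours absent from their
  neighbourhoods, which yields \<open>2 ^ card U\<close> times a polymer sum.\<close>

lemma sparse_colourings_le:
  fixes N :: "'a set" and q :: real
  assumes N: "finite N" and n: "card N = n" "n \<ge> 60"
    and n2: "3 + 36 * log 2 n + 4 * log 2 (3 * real n ^ 4) \<le> real n / 10"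
    and n3: "real n ^ 4 * 2 ^ n \<le> 2 powr (6 / 5 * n)"
    and q: "24 \<le> q" "q \<le> n / 2" and q2: "32 * n * (1 + 12 * log 2 n) \<le> q\<^sup>2"
    and \<Theta>: "3 * n * real \<Theta> \<le> 2 powr (n - q)"
  shows "real (card {c\<in>colourings N. card {x\<in>parity_class N p. c x \<noteq> k} \<le> \<Theta>}) \<le> exp 10 * 2 ^ (2 ^ (n - 1))"
proof -
  have ne: "N \<noteq> {}" using n by auto
  interpret iso_graph "parity_class N p" "parity_class N (\<not> p)" "cube_nbs N" "card N" by (rule iso_graph_cube[OF N ne])
  let ?V = "parity_class N p" and ?U = "parity_class N (\<not> p)"
  let ?T = "SIGMA A:{A. A \<subseteq> ?V \<and> card A \<le> \<Theta>}. SIGMA a:PiE A (\<lambda>_. - {k}). PiE ?U (\<lambda>u. - ext k A a ` cube_nbs N u)"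
  let ?C = "{c\<in>colourings N. card {x\<in>?V. c x \<noteq> k} \<le> \<Theta>}"
  let ?D = "\<lambda>c. {x\<in>?V. c x \<noteq> (k::3)}"
  have finT1: "finite {A. A \<subseteq> ?V \<and> card A \<le> \<Theta>}" using finV by (auto intro: finite_subset[of _ "Pow ?V"])
  have finA: "finite (PiE A (\<lambda>_. - {k}))" if "A \<subseteq> ?V" for A
    using finite_subset[OF that finV] by (intro finite_PiE) auto
  have finU': "finite (PiE ?U (\<lambda>u. - ext k A a ` cube_nbs N u))" for A a
    using finU by (intro finite_PiE) auto
  have "card ?C \<le> card ?T"
  proof (rule card_inj_on_le[where f = "\<lambda>c. (?D c, restrict c (?D c), restrict c ?U)"])
    show "finite ?T" using finT1 finA finU' by (intro finite_SigmaI) auto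
    show "inj_on (\<lambda>c. (?D c, restrict c (?D c), restrict c ?U)) ?C"
    proof (rule inj_onI)
      fix c c' assume c: "c \<in> ?C" and c': "c' \<in> ?C"
        and e: "(?D c, restrict c (?D c), restrict c ?U) = (?D c', restrict c' (?D c'), restrict c' ?U)"
      have "c x = c' x" if x: "x \<in> Pow N" for x
      proof (cases "x \<in> ?U")
        case True
        have "restrict c ?U = restrict c' ?U" using e by simp
        then have "restrict c ?U x = restrict c' ?U x" by (rule fun_cong)
        then show ?thesis using True by simp
      next
        case False
        then have xV: "x \<in> ?V" using x parity_class_Un(1)[of N p] by blast
        have D: "?D c = ?D c'" "restrict c (?D c) = restrict c' (?D c')" using e by auto
        show ?thesis
        proof (cases "x \<in> ?D c")
          case True
          then have "x \<in> ?D c'" using D(1) by simp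
          then have "restrict c (?D c) x = c x" "restrict c' (?D c') x = c' x" using True by auto
          then show ?thesis using D(2) by simp
        next
          case False
          then have "x \<notin> ?D c'" using D(1) by simp
          then show ?thesis using False xV by auto
        qed
      qed
      then show "c = c'" using c c' by (intro PiE_ext[of c "Pow N" "\<lambda>_. UNIV"]) (auto simp: colourings_def)
    qed
    show "(\<lambda>c. (?D c, restrict c (?D c), restrict c ?U)) ` ?C \<subseteq> ?T"
    proof
      fix y assume "y \<in> (\<lambda>c. (?D c, restrict c (?D c), restrict c ?U)) ` ?C"
      then obtain c where c: "c \<in> colourings N" "card (?D c) \<le> \<Theta>" and y: "y = (?D c, restrict c (?D c), restrict c ?U)" by auto
      have "c u \<notin> ext k (?D c) (restrict c (?D c)) ` cube_nbs N u" if u: "u \<in> ?U" for u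
      proof
        assume "c u \<in> ext k (?D c) (restrict c (?D c)) ` cube_nbs N u"
        then obtain v where v: "v \<in> cube_nbs N u" "c u = ext k (?D c) (restrict c (?D c)) v" by auto
        have "v \<in> ?V" using v u nbU by blast
        then have "ext k (?D c) (restrict c (?D c)) v = c v" by (auto simp: ext_def)
        moreover obtain i where i: "i \<in> N" "v = flip i u" using v by (auto simp: cube_nbs_def)
        moreover have "c (flip i u) \<noteq> c u" using c(1) i(1) u by (simp add: colourings_def parity_class_def)
        ultimately show False using v(2) by simp
      qed
      then show "y \<in> ?T" using c y by auto
    qed
  qed
  then have "real (card ?C) \<le> real (card ?T)" by simp
  also have "real (card ?T) = (\<Sum>A | A \<subseteq> ?V \<and> card A \<le> \<Theta>. \<Sum>a\<in>PiE A (\<lambda>_. - {k}). \<Prod>u\<in>?U. real (card (- ext k A a ` cube_nbs N u)))"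
  proof -
    have "card (SIGMA a:PiE A (\<lambda>_. - {k}). PiE ?U (\<lambda>u. - ext k A a ` cube_nbs N u))
      = (\<Sum>a\<in>PiE A (\<lambda>_. - {k}). \<Prod>u\<in>?U. card (- ext k A a ` cube_nbs N u))" if "A \<subseteq> ?V" for A
      using finA[OF that] finU' finU by (simp add: card_SigmaI card_PiE)
    moreover have "finite (SIGMA a:PiE A (\<lambda>_. - {k}). PiE ?U (\<lambda>u. - ext k A a ` cube_nbs N u))" if "A \<subseteq> ?V" for A
      using finA[OF that] finU' by (intro finite_SigmaI) auto
    ultimately show ?thesis using finT1 by (simp add: card_SigmaI)
  qed
  also have "\<dots> = 2 ^ card ?U * (\<Sum>A | A \<subseteq> ?V \<and> card A \<le> \<Theta>. polymer_weight k A)" by (rule sum_sparse_eq)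
  also have "\<dots> \<le> 2 ^ card ?U * exp 10"
    using assms by (intro mult_left_mono sparse_sum_le[of q]) auto
  also have "card ?U = 2 ^ (n - 1)" using card_parity_class[OF N ne] n by simp
  finally show ?thesis by (simp add: mult.commute)
qed

section \<open>Phases of slices\<close>

lemma sum_PiE_prod:
  fixes h :: "'v \<Rightarrow> 'b \<Rightarrow> real"
  assumes "finite V"
  shows "(\<Sum>c\<in>PiE V L. \<Prod>v\<in>V. h v (c v)) = (\<Prod>v\<in>V. \<Sum>a\<in>L v. h v a)"
  using assms
proof (induction V rule: finite_induct)
  case (insert v V)
  have "(\<Sum>c\<in>PiE (insert v V) L. \<Prod>u\<in>insert v V. h u (c u))
    = (\<Sum>c\<in>PiE V L. \<Sum>a\<in>L v. \<Prod>u\<in>insert v V. h u ((c(v := a)) u))"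
    using insert.hyps by (intro sum_PiE_insert)
  also have "\<dots> = (\<Sum>c\<in>PiE V L. \<Sum>a\<in>L v. h v a * (\<Prod>u\<in>V. h u (c u)))"
  proof (intro sum.cong refl)
    fix c a
    have "(\<Prod>u\<in>V. h u ((c(v := a)) u)) = (\<Prod>u\<in>V. h u (c u))"
      using insert.hyps by (intro prod.cong) auto
    then show "(\<Prod>u\<in>insert v V. h u ((c(v := a)) u)) = h v a * (\<Prod>u\<in>V. h u (c u))"
      using insert.hyps by simp
  qed
  also have "\<dots> = (\<Sum>a\<in>L v. h v a) * (\<Sum>c\<in>PiE V L. \<Prod>u\<in>V. h u (c u))"
    by (simp add: sum_product sum.swap[of _ "PiE V L"])
  finally show ?case using insert by simp
qed simp

text \<open>Weight each disagreement by 1 / 32; a vertex then contributes \<open>1 + 2 / 32\<close>.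
  The base 17 / 16 is near enough to 1 that, for small \<open>r\<close>, such patterns are
  exponentially rarer than the colourings of a phase.\<close>

lemma card_near_le:
  fixes \<tau> :: "'v \<Rightarrow> 3"
  assumes X: "finite X"
  shows "real (card {\<sigma>\<in>PiE X (\<lambda>_. UNIV). card {x\<in>X. \<sigma> x \<noteq> \<tau> x} \<le> r}) \<le> 32 ^ r * (17 / 16) ^ card X"
proof -
  let ?P = "PiE X (\<lambda>_. UNIV :: 3 set)" and ?F = "\<lambda>\<sigma>. {x\<in>X. \<sigma> x \<noteq> \<tau> x}"
  have finP: "finite ?P" using X by (intro finite_PiE) auto
  have "real (card {\<sigma>\<in>?P. card (?F \<sigma>) \<le> r}) * (1 / 32) ^ r = (\<Sum>\<sigma>\<in>{\<sigma>\<in>?P. card (?F \<sigma>) \<le> r}. (1 / 32) ^ r)" by simp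
  also have "\<dots> \<le> (\<Sum>\<sigma>\<in>{\<sigma>\<in>?P. card (?F \<sigma>) \<le> r}. (1 / 32) ^ card (?F \<sigma>))"
    by (intro sum_mono power_decreasing) auto
  also have "\<dots> \<le> (\<Sum>\<sigma>\<in>?P. (1 / 32) ^ card (?F \<sigma>))" using finP by (intro sum_mono2) auto
  also have "\<dots> = (\<Sum>\<sigma>\<in>?P. \<Prod>x\<in>X. if \<sigma> x \<noteq> \<tau> x then 1 / 32 else 1)"
    using X by (simp add: prod.If_cases Int_def)
  also have "\<dots> = (\<Prod>x\<in>X. \<Sum>a\<in>UNIV. if a \<noteq> \<tau> x then 1 / 32 else 1)" by (rule sum_PiE_prod[OF X])
  also have "\<dots> = (\<Prod>x\<in>X. 17 / 16)"
  proof (intro prod.cong refl)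
    fix x
    have "- {a. a \<noteq> \<tau> x} = {\<tau> x}" "{a. a \<noteq> \<tau> x} = - {\<tau> x}" by auto
    then show "(\<Sum>a\<in>UNIV. if a \<noteq> \<tau> x then 1 / 32 else 1) = (17 / 16 :: real)"
      by (simp add: sum.If_cases card_Compl3)
  qed
  finally show ?thesis by (simp add: power_divide divide_le_eq mult.commute)
qed

text \<open>In the phase \<open>(p, a)\<close> the vertices of parity \<open>p\<close> have colour \<open>a\<close> and the others avoid it.\<close>

definition phase_list :: "bool \<times> 3 \<Rightarrow> 'a set \<Rightarrow> 3 set" where
  "phase_list P x = (if even (card x) = fst P then {snd P} else - {snd P})"

text \<open>A nonempty proper set of colours is a singleton or the complement of one, and the parity
  of \<open>x\<close> decides which class the phase fixes. This is why every star with a possible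
  centre acquires a phase at every point of \<open>M\<close>.\<close>

lemma ex_phase_list:
  assumes "S \<noteq> {}" "S \<noteq> UNIV"
  shows "\<exists>P. phase_list P x = S"
proof -
  have "card S \<noteq> 0" using assms finite_subset[of S UNIV] by auto
  moreover have "card S \<noteq> 3" using assms card_subset_eq[of UNIV S] by auto
  moreover have "card S \<le> 3" using card_mono[of UNIV S] by simp
  ultimately have "card S = 1 \<or> card S = 2" by linarith
  then have "card S = 1 \<or> card (- S) = 1" by (auto simp: card_Compl3)
  then consider "card S = 1" | "card (- S) = 1" by blast
  then show ?thesis
  proof cases
    case 1
    then obtain a where "S = {a}" by (auto simp: card_1_singleton_iff)
    then have "phase_list (even (card x), a) x = S" by (simp add: phase_list_def)
    then show ?thesis ..
  next
    case 2
    then obtain a where "- S = {a}" by (auto simp: card_1_singleton_iff)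
    then have "S = - {a}" by blast
    then have "phase_list (odd (card x), a) x = S" by (simp add: phase_list_def)
    then show ?thesis ..
  qed
qed

definition proper_pairs :: "3 set \<Rightarrow> 3 set \<Rightarrow> (3 \<times> 3) set" where
  "proper_pairs A B = {(a, b). a \<in> A \<and> b \<in> B \<and> a \<noteq> b}"

lemma finite_proper_pairs [simp]: "finite (proper_pairs A B)"
  by (rule finite_subset[OF subset_UNIV]) simp

lemma card_proper_pairs: "card (proper_pairs A B) = card A * card B - card (A \<inter> B)"
proof -
  have "proper_pairs A B = A \<times> B - (\<lambda>a. (a, a)) ` (A \<inter> B)" by (auto simp: proper_pairs_def)
  moreover have "card ((\<lambda>a. (a, a)) ` (A \<inter> B)) = card (A \<inter> B)" by (simp add: card_image inj_on_def)
  moreover have "(\<lambda>a. (a, a)) ` (A \<inter> B) \<subseteq> A \<times> B" by auto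
  ultimately show ?thesis by (simp add: card_Diff_subset card_cartesian_product)
qed

text \<open>For equal phases both factors are 2. For different phases the best case is that of two
  singleton lists with distinct colours and their complements, \<open>1 * 3\<close>. The ratio 3 / 4
  on every edge where the label changes is the source of all gains against nonconstant
  labels.\<close>

lemma card_proper_pairs_phase_list:
  assumes "even (card y) \<longleftrightarrow> odd (card x)"
  shows "card (proper_pairs (phase_list P x) (phase_list Q y)) * card (proper_pairs (- phase_list P x) (- phase_list Q y)) \<le> (if P = Q then 4 else 3)"
proof -
  obtain p a q b where PQ: "P = (p, a)" "Q = (q, b)" by (metis surj_pair)
  have 1: "card ({a} \<inter> {b}) = (if a = b then 1 else 0)" by auto
  have 2: "card (- {a} \<inter> - {b}) = (if a = b then 2 else 1)"
  proof -
    have "- {a} \<inter> - {b} = - {a, b}" by auto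
    then show ?thesis by (simp add: card_Compl3)
  qed
  have 3: "card ({a} \<inter> - {b}) = (if a = b then 0 else 1)" "card (- {a} \<inter> {b}) = (if a = b then 0 else 1)" by auto
  show ?thesis
    using assms unfolding PQ phase_list_def card_proper_pairs
    by (cases "even (card x)"; cases p; cases q) (simp_all add: 1 2 3 card_Compl3 double_complement)
qed

text \<open>\<open>\<pi>\<close> is a label, which assigns a phase to each vertex of
  \<open>M\<close>. Around a star with this label the outer slices belong to \<open>in_lists\<close>
  and the central slice to \<open>off_lists\<close>.\<close>

definition in_lists :: "'a set \<Rightarrow> ('a set \<Rightarrow> bool \<times> 3) \<Rightarrow> ('a set \<Rightarrow> 3) set" where
  "in_lists M \<pi> = {\<sigma>\<in>colourings M. \<forall>x\<in>Pow M. \<sigma> x \<in> phase_list (\<pi> x) x}"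

definition off_lists :: "'a set \<Rightarrow> ('a set \<Rightarrow> bool \<times> 3) \<Rightarrow> ('a set \<Rightarrow> 3) set" where
  "off_lists M \<pi> = {\<sigma>\<in>colourings M. \<forall>x\<in>Pow M. \<sigma> x \<notin> phase_list (\<pi> x) x}"

definition cut :: "'a set \<Rightarrow> ('a set \<Rightarrow> 'b) \<Rightarrow> 'a \<Rightarrow> nat" where
  "cut M \<pi> i = card {x. x \<subseteq> M \<and> i \<notin> x \<and> \<pi> x \<noteq> \<pi> (flip i x)}"

text \<open>The edges in direction \<open>i\<close> are a perfect matching of the cube. Keeping only
  their constraints makes the count a product over the matching.\<close>

lemma card_list_colourings_le:
  assumes M: "finite M" "i \<in> M"
  shows "card {\<sigma>\<in>colourings M. \<forall>x\<in>Pow M. \<sigma> x \<in> A x} \<le> (\<Prod>x\<in>Pow (M - {i}). card (proper_pairs (A x) (A (flip i x))))"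
proof -
  let ?C = "{\<sigma>\<in>colourings M. \<forall>x\<in>Pow M. \<sigma> x \<in> A x}"
  let ?P = "PiE (Pow (M - {i})) (\<lambda>x. proper_pairs (A x) (A (flip i x)))"
  let ?f = "\<lambda>\<sigma>. \<lambda>x\<in>Pow (M - {i}). (\<sigma> x, \<sigma> (flip i x))"
  have "card ?C \<le> card ?P"
  proof (rule card_inj_on_le)
    show "finite ?P" using M by (intro finite_PiE) auto
    show "?f ` ?C \<subseteq> ?P"
    proof (intro image_subsetI)
      fix \<sigma> assume s: "\<sigma> \<in> ?C"
      have "(\<sigma> x, \<sigma> (flip i x)) \<in> proper_pairs (A x) (A (flip i x))" if x: "x \<in> Pow (M - {i})" for x
      proof -
        have "x \<in> Pow M" "flip i x \<in> Pow M" using x M(2) by auto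
        moreover have "\<sigma> (flip i x) \<noteq> \<sigma> x" using s x M(2) by (auto simp: colourings_def)
        ultimately show ?thesis using s by (auto simp: proper_pairs_def)
      qed
      then show "?f \<sigma> \<in> ?P" by simp
    qed
    show "inj_on ?f ?C"
    proof (rule inj_onI)
      fix \<sigma> \<tau> assume s: "\<sigma> \<in> ?C" and t: "\<tau> \<in> ?C" and e: "?f \<sigma> = ?f \<tau>"
      have e': "\<sigma> x = \<tau> x \<and> \<sigma> (flip i x) = \<tau> (flip i x)" if "x \<in> Pow (M - {i})" for x
        using fun_cong[OF e, of x] that by simp
      have "\<sigma> x = \<tau> x" if "x \<in> Pow M" for x
      proof (cases "i \<in> x")
        case True
        then have "flip i x \<in> Pow (M - {i})" using that by (auto simp: flip_def)
        from e'[OF this] show ?thesis by simp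
      next
        case False
        then show ?thesis using e'[of x] that by auto
      qed
      then show "\<sigma> = \<tau>" using s t by (intro PiE_ext[of \<sigma> "Pow M" "\<lambda>_. UNIV"]) (auto simp: colourings_def)
    qed
  qed
  also have "card ?P = (\<Prod>x\<in>Pow (M - {i}). card (proper_pairs (A x) (A (flip i x))))"
    using M by (simp add: card_PiE)
  finally show ?thesis .
qed

text \<open>Each of the \<open>2 ^ (card M - 1)\<close> matching edges contributes at most 4, and at
  most 3 where the label changes. The leading factor is the value for a constant label.\<close>

lemma card_in_lists_off_lists_le:
  assumes M: "finite M" "i \<in> M"
  shows "real (card (in_lists M \<pi>) * card (off_lists M \<pi>)) \<le> 2 ^ (2 ^ card M) * (3 / 4) ^ cut M \<pi> i"
proof -
  let ?X = "Pow (M - {i})"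
  have finX: "finite ?X" using M by simp
  let ?D = "{x\<in>?X. \<pi> x \<noteq> \<pi> (flip i x)}"
  have parity_class: "even (card (flip i x)) \<longleftrightarrow> odd (card x)" if "x \<in> ?X" for x
    using that M(1) finite_subset by (intro even_card_flip) auto
  have "card (in_lists M \<pi>) * card (off_lists M \<pi>) \<le>
    (\<Prod>x\<in>?X. card (proper_pairs (phase_list (\<pi> x) x) (phase_list (\<pi> (flip i x)) (flip i x)))) *
    (\<Prod>x\<in>?X. card (proper_pairs (- phase_list (\<pi> x) x) (- phase_list (\<pi> (flip i x)) (flip i x))))"
    using card_list_colourings_le[OF M, of "\<lambda>x. phase_list (\<pi> x) x"]
      card_list_colourings_le[OF M, of "\<lambda>x. - phase_list (\<pi> x) x"]
    unfolding in_lists_def off_lists_def by (intro mult_mono) auto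
  also have "\<dots> = (\<Prod>x\<in>?X. card (proper_pairs (phase_list (\<pi> x) x) (phase_list (\<pi> (flip i x)) (flip i x))) *
      card (proper_pairs (- phase_list (\<pi> x) x) (- phase_list (\<pi> (flip i x)) (flip i x))))" by (simp add: prod.distrib)
  also have "\<dots> \<le> (\<Prod>x\<in>?X. if \<pi> x = \<pi> (flip i x) then 4 else 3)"
    by (intro prod_mono conjI card_proper_pairs_phase_list parity_class) auto
  finally have "real (card (in_lists M \<pi>) * card (off_lists M \<pi>)) \<le> real (\<Prod>x\<in>?X. if \<pi> x = \<pi> (flip i x) then 4 else 3)"
    by (simp only: of_nat_le_iff)
  also have "\<dots> = (\<Prod>x\<in>?X. 4 * (if \<pi> x \<noteq> \<pi> (flip i x) then 3 / 4 else 1))"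
    unfolding of_nat_prod by (intro prod.cong) auto
  also have "\<dots> = 4 ^ card ?X * (3 / 4) ^ card ?D"
    using finX by (simp add: prod.distrib prod.If_cases Int_def)
  also have "card ?D = cut M \<pi> i" unfolding cut_def by (intro arg_cong[of _ _ card]) auto
  also have "(4::real) ^ card ?X = 2 ^ (2 ^ card M)"
  proof -
    have "card ?X = 2 ^ (card M - 1)" using M by (simp add: card_Pow)
    moreover have "card M = Suc (card M - 1)" using M by (metis card_Suc_Diff1 card_Diff_singleton diff_Suc_1)
    then have "(2::nat) ^ card M = 2 * 2 ^ (card M - 1)" by (metis power_Suc)
    moreover have "(4::real) ^ k = 2 ^ (2 * k)" for k by (simp add: power_mult)
    ultimately show ?thesis by simp
  qed
  finally show ?thesis .
qed

lemma card_in_lists_le: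
  assumes M: "finite M"
  shows "card (in_lists M \<pi>) \<le> (\<Prod>x\<in>Pow M. card (phase_list (\<pi> x) x))"
    and "card (off_lists M \<pi>) \<le> (\<Prod>x\<in>Pow M. card (- phase_list (\<pi> x) x))"
proof -
  have "in_lists M \<pi> \<subseteq> PiE (Pow M) (\<lambda>x. phase_list (\<pi> x) x)" by (auto simp: in_lists_def colourings_def PiE_iff extensional_def)
  then have "card (in_lists M \<pi>) \<le> card (PiE (Pow M) (\<lambda>x. phase_list (\<pi> x) x))"
    using M by (intro card_mono finite_PiE) auto
  then show "card (in_lists M \<pi>) \<le> (\<Prod>x\<in>Pow M. card (phase_list (\<pi> x) x))" using M by (simp add: card_PiE)
  have "off_lists M \<pi> \<subseteq> PiE (Pow M) (\<lambda>x. - phase_list (\<pi> x) x)" by (auto simp: off_lists_def colourings_def PiE_iff extensional_def)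
  then have "card (off_lists M \<pi>) \<le> card (PiE (Pow M) (\<lambda>x. - phase_list (\<pi> x) x))"
    using M by (intro card_mono finite_PiE) auto
  then show "card (off_lists M \<pi>) \<le> (\<Prod>x\<in>Pow M. card (- phase_list (\<pi> x) x))" using M by (simp add: card_PiE)
qed

text \<open>No label occurs both in \<open>R\<close> and outside it, so every edge leaving
  \<open>R\<close> changes the label, and \<open>card_sub_cube_le\<close> provides many such
  edges.\<close>

lemma sum_cut_ge:
  assumes M: "finite M" and R: "R \<subseteq> Pow M" "real (card R) \<le> 2 ^ card M / 2"
    and sep: "\<And>x y. x \<in> R \<Longrightarrow> y \<subseteq> M \<Longrightarrow> y \<notin> R \<Longrightarrow> \<pi> x \<noteq> \<pi> y"
  shows "real (card R) \<le> (\<Sum>i\<in>M. real (cut M \<pi> i))"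
proof -
  have "real (card R) \<le> (\<Sum>i\<in>M. real (card {x\<in>R. flip i x \<notin> R}))"
    using R by (intro card_sub_cube_le M)
  also have "\<dots> \<le> (\<Sum>i\<in>M. real (cut M \<pi> i))"
  proof (intro sum_mono of_nat_mono)
    fix i assume i: "i \<in> M"
    let ?A = "{x\<in>R. flip i x \<notin> R}" and ?B = "{x. x \<subseteq> M \<and> i \<notin> x \<and> \<pi> x \<noteq> \<pi> (flip i x)}"
    have "card ?A \<le> card ?B"
    proof (rule card_inj_on_le[where f = "\<lambda>x. x - {i}"])
      show "inj_on (\<lambda>x. x - {i}) ?A"
      proof (rule inj_onI)
        fix x y assume x: "x \<in> ?A" and y: "y \<in> ?A" and e: "x - {i} = y - {i}"
        then have "x = y \<or> y = flip i x" by (auto simp: flip_def)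
        then show "x = y" using x y by auto
      qed
      show "(\<lambda>x. x - {i}) ` ?A \<subseteq> ?B"
      proof (intro image_subsetI)
        fix x assume x: "x \<in> ?A"
        then have xM: "x \<subseteq> M" "flip i x \<subseteq> M" using R i by auto
        have "\<pi> x \<noteq> \<pi> (flip i x)" using sep[of x "flip i x"] x xM by auto
        moreover have "x - {i} = x \<and> flip i (x - {i}) = flip i x \<or> x - {i} = flip i x \<and> flip i (x - {i}) = x"
          by (auto simp: flip_def)
        ultimately show "x - {i} \<in> ?B" using xM by auto
      qed
      show "finite ?B" using M by (auto intro: finite_subset[of _ "Pow M"])
    qed
    then show "card ?A \<le> cut M \<pi> i" by (simp add: cut_def)
  qed
  finally show ?thesis .
qed

text \<open>If one label covers more than half of \<open>M\<close>, its complement is small and has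
  more than \<open>r\<close> points. Otherwise every class is at most half, so each has a boundary
  at least as large as itself; these boundaries count each label-changing edge twice, whence the
  bound \<open>2 ^ card M / 2\<close>. Averaging over the directions gives \<open>i\<close>.\<close>

lemma ex_big_cut:
  fixes \<pi> :: "'a set \<Rightarrow> 'b::finite"
  assumes M: "finite M" "M \<noteq> {}" and r: "real r + 1 \<le> 2 ^ card M / 2"
    and no: "\<And>P. card {x\<in>Pow M. \<pi> x \<noteq> P} > r"
  shows "\<exists>i\<in>M. real r + 1 \<le> card M * real (cut M \<pi> i)"
proof -
  let ?C = "\<lambda>P. {x\<in>Pow M. \<pi> x = P}"
  have fin: "finite (?C P)" for P using M by auto
  have "real r + 1 \<le> (\<Sum>i\<in>M. real (cut M \<pi> i))"
  proof (cases "\<exists>P. real (card (?C P)) > 2 ^ card M / 2")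
    case True
    then obtain P where P: "real (card (?C P)) > 2 ^ card M / 2" by blast
    let ?R = "{x\<in>Pow M. \<pi> x \<noteq> P}"
    have "card (Pow M) = card (?C P \<union> ?R)" by (rule arg_cong[of _ _ card]) auto
    also have "\<dots> = card (?C P) + card ?R" using M by (intro card_Un_disjoint) auto
    finally have "real (card (?C P)) + card ?R = 2 ^ card M" using M by (simp add: card_Pow flip: of_nat_add)
    then have "real (card ?R) \<le> (\<Sum>i\<in>M. real (cut M \<pi> i))"
      using P by (intro sum_cut_ge M) auto
    moreover have "real (card ?R) \<ge> real r + 1" using no[of P] by linarith
    ultimately show ?thesis by linarith
  next
    case False
    have c: "real (card (?C P)) \<le> (\<Sum>i\<in>M. real (card {x\<in>?C P. flip i x \<notin> ?C P}))" for P
      using False by (intro card_sub_cube_le M) (auto simp: not_less)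
    have U: "Pow M = (\<Union>P\<in>UNIV. ?C P)" by auto
    have "card (Pow M) = (\<Sum>P\<in>UNIV. card (?C P))"
      by (subst U, rule card_UN_disjoint) (use fin in auto)
    then have "2 ^ card M = (\<Sum>P\<in>UNIV. real (card (?C P)))" using M by (simp add: card_Pow flip: of_nat_sum)
    also have "\<dots> \<le> (\<Sum>P\<in>UNIV. \<Sum>i\<in>M. real (card {x\<in>?C P. flip i x \<notin> ?C P}))" by (intro sum_mono c)
    also have "\<dots> = (\<Sum>i\<in>M. \<Sum>P\<in>UNIV. real (card {x\<in>?C P. flip i x \<notin> ?C P}))" by (rule sum.swap)
    also have "\<dots> \<le> (\<Sum>i\<in>M. 2 * real (cut M \<pi> i))"
    proof (rule sum_mono)
      fix i assume i: "i \<in> M"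
      let ?E = "{x\<in>Pow M. \<pi> x \<noteq> \<pi> (flip i x)}" and ?B = "{x. x \<subseteq> M \<and> i \<notin> x \<and> \<pi> x \<noteq> \<pi> (flip i x)}"
      have "(\<Sum>P\<in>UNIV. card {x\<in>?C P. flip i x \<notin> ?C P}) = card (\<Union>P\<in>UNIV. {x\<in>?C P. flip i x \<notin> ?C P})"
        using M by (intro card_UN_disjoint[symmetric]) auto
      also have "\<dots> \<le> card (?B \<union> flip i ` ?B)"
      proof (rule card_mono)
        show "finite (?B \<union> flip i ` ?B)" using M by (auto intro: finite_subset[of _ "Pow M"])
        show "(\<Union>P\<in>UNIV. {x\<in>?C P. flip i x \<notin> ?C P}) \<subseteq> ?B \<union> flip i ` ?B"
        proof
          fix x assume "x \<in> (\<Union>P\<in>UNIV. {x\<in>?C P. flip i x \<notin> ?C P})"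
          then have x: "x \<subseteq> M" "\<pi> x \<noteq> \<pi> (flip i x)" using i by auto
          show "x \<in> ?B \<union> flip i ` ?B"
          proof (cases "i \<in> x")
            case True
            then have "flip i x \<in> ?B" using x i by (auto simp: mem_flip)
            then have "flip i (flip i x) \<in> flip i ` ?B" by blast
            then show ?thesis by simp
          next
            case False
            then show ?thesis using x by auto
          qed
        qed
      qed
      also have "\<dots> \<le> card ?B + card (flip i ` ?B)" by (rule card_Un_le)
      also have "card (flip i ` ?B) = card ?B" by (simp add: card_image inj_on_def)
      finally have "(\<Sum>P\<in>UNIV. card {x\<in>?C P. flip i x \<notin> ?C P}) \<le> 2 * cut M \<pi> i" by (simp add: cut_def)
      then have "real (\<Sum>P\<in>UNIV. card {x\<in>?C P. flip i x \<notin> ?C P}) \<le> real (2 * cut M \<pi> i)" by (simp only: of_nat_le_iff)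
      then show "(\<Sum>P\<in>UNIV. real (card {x\<in>?C P. flip i x \<notin> ?C P})) \<le> 2 * real (cut M \<pi> i)" by simp
    qed
    also have "\<dots> = 2 * (\<Sum>i\<in>M. real (cut M \<pi> i))" by (simp add: sum_distrib_left)
    finally show ?thesis using r by simp
  qed
  moreover have "(\<Sum>i\<in>M. real (cut M \<pi> i)) \<le> (\<Sum>i\<in>M. Max ((\<lambda>i. real (cut M \<pi> i)) ` M))"
    using M by (intro sum_mono Max_ge) auto
  moreover have "Max ((\<lambda>i. real (cut M \<pi> i)) ` M) \<in> (\<lambda>i. real (cut M \<pi> i)) ` M"
    using M by (intro Max_in) auto
  then obtain i where "i \<in> M" "Max ((\<lambda>i. real (cut M \<pi> i)) ` M) = real (cut M \<pi> i)" by (rule imageE) auto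
  ultimately show ?thesis by (intro bexI[of _ i]) auto
qed

text \<open>Determined by \<open>ex_phase_list\<close> unless all three colours occur at
  \<open>x\<close>; then it is an arbitrary phase, but a star with such a point has no compatible
  centre and counts nothing.\<close>

definition phase_label :: "('a set \<Rightarrow> 3) set \<Rightarrow> 'a set \<Rightarrow> bool \<times> 3" where
  "phase_label Y x = (SOME P. phase_list P x = (\<lambda>\<sigma>. \<sigma> x) ` Y)"

section \<open>The cube as a cube of slices, and Finner's inequality over its stars\<close>

locale sliced_cube =
  fixes D M :: "'a set"
  assumes finD: "finite D" and finM: "finite M" and DM: "D \<inter> M = {}"
    and D_ne: "D \<noteq> {}" and M_ne: "M \<noteq> {}"
begin

sublocale bip_graph "parity_class D True" "parity_class D False" "cube_nbs D" "card D"
  using bip_graph_cube[OF finD D_ne, of True] by simp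

abbreviation "Ve \<equiv> parity_class D True"
abbreviation "Vo \<equiv> parity_class D False"

definition slice :: "('a set \<Rightarrow> 3) \<Rightarrow> 'a set \<Rightarrow> 'a set \<Rightarrow> 3" where
  "slice c w = (\<lambda>x\<in>Pow M. c (w \<union> x))"

definition slices :: "('a set \<Rightarrow> 3) \<Rightarrow> 'a set \<Rightarrow> 'a set \<Rightarrow> 3" where
  "slices c = (\<lambda>v\<in>Ve. slice c v)"

definition compatible :: "('a set \<Rightarrow> 'a set \<Rightarrow> 3) \<Rightarrow> 'a set \<Rightarrow> ('a set \<Rightarrow> 3) set" where
  "compatible f w = {\<tau>\<in>colourings M. \<forall>x\<in>Pow M. \<forall>v\<in>cube_nbs D w. \<tau> x \<noteq> f v x}"

definition star_label :: "('a set \<Rightarrow> 'a set \<Rightarrow> 3) \<Rightarrow> 'a set \<Rightarrow> 'a set \<Rightarrow> bool \<times> 3" where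
  "star_label f w = (\<lambda>x\<in>Pow M. phase_label (f ` cube_nbs D w) x)"

lemma flip_Un_M: "i \<in> M \<Longrightarrow> v \<subseteq> D \<Longrightarrow> flip i (v \<union> x) = v \<union> flip i x"
  using DM by (auto simp: flip_def)

lemma flip_Un_D: "i \<in> D \<Longrightarrow> x \<subseteq> M \<Longrightarrow> flip i (v \<union> x) = flip i v \<union> x"
  using DM by (auto simp: flip_def)

lemma slice_colourings:
  assumes c: "c \<in> colourings (D \<union> M)" and v: "v \<subseteq> D"
  shows "slice c v \<in> colourings M"
  unfolding colourings_def
proof (intro CollectI conjI ballI)
  show "slice c v \<in> PiE (Pow M) (\<lambda>_. UNIV)" by (simp add: slice_def)
  fix x i assume x: "x \<in> Pow M" and i: "i \<in> M"
  have "c (flip i (v \<union> x)) \<noteq> c (v \<union> x)" using c v x i by (auto simp: colourings_def)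
  then show "slice c v (flip i x) \<noteq> slice c v x" using x i v by (simp add: slice_def flip_Un_M)
qed

lemma slice_adj:
  assumes c: "c \<in> colourings (D \<union> M)" and w: "w \<subseteq> D" and v: "v \<in> cube_nbs D w" and x: "x \<in> Pow M"
  shows "slice c w x \<noteq> slice c v x"
proof -
  obtain i where i: "i \<in> D" "v = flip i w" using v by (auto simp: cube_nbs_def)
  have "c (flip i (w \<union> x)) \<noteq> c (w \<union> x)" using c w x i by (auto simp: colourings_def)
  then show ?thesis using x i by (simp add: slice_def flip_Un_D)
qed

lemma slices_PiE: "c \<in> colourings (D \<union> M) \<Longrightarrow> slices c \<in> PiE Ve (\<lambda>_. colourings M)"
  using slice_colourings by (auto simp: slices_def parity_class_def)

lemma slice_compatible:
  assumes c: "c \<in> colourings (D \<union> M)" and w: "w \<in> Vo"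
  shows "slice c w \<in> compatible (slices c) w"
proof -
  have wD: "w \<subseteq> D" using w by (auto simp: parity_class_def)
  have "slices c v = slice c v" if "v \<in> cube_nbs D w" for v
    using that nbU[OF w] by (auto simp: slices_def)
  then show ?thesis
    using slice_colourings[OF c wD] slice_adj[OF c wD] by (auto simp: compatible_def)
qed

lemma phase_list_phase_label:
  assumes w: "w \<in> Vo" and B: "compatible f w \<noteq> {}" and x: "x \<in> Pow M"
  shows "phase_list (star_label f w x) x = (\<lambda>v. f v x) ` cube_nbs D w"
proof -
  let ?S = "(\<lambda>\<sigma>. \<sigma> x) ` (f ` cube_nbs D w)"
  have "?S \<noteq> {}" using nb_ne w by auto
  moreover have "?S \<noteq> UNIV"
  proof -
    obtain \<tau> where "\<tau> \<in> compatible f w" using B by blast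
    then have "\<tau> x \<notin> ?S" using x by (auto simp: compatible_def)
    then show ?thesis by blast
  qed
  ultimately have "\<exists>P. phase_list P x = ?S" by (rule ex_phase_list)
  then have "phase_list (phase_label (f ` cube_nbs D w) x) x = ?S" unfolding phase_label_def by (rule someI_ex)
  then show ?thesis using x by (simp add: star_label_def image_image)
qed

lemma star_label_in_lists:
  assumes w: "w \<in> Vo" and B: "compatible f w \<noteq> {}" and v: "v \<in> cube_nbs D w" and f: "f v \<in> colourings M"
  shows "f v \<in> in_lists M (star_label f w)"
  using phase_list_phase_label[OF w B] v f by (auto simp: in_lists_def)

text \<open>The outer slices show every colour in the list at \<open>x\<close>, so the centre avoids
  the whole list. Together with \<open>star_label_in_lists\<close> this separates the star, for a
  given label, into independent choices of the centre and of each outer slice.\<close>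

lemma compatible_off_lists:
  assumes w: "w \<in> Vo"
  shows "compatible f w \<subseteq> off_lists M (star_label f w)"
proof
  fix \<tau> assume t: "\<tau> \<in> compatible f w"
  then have B: "compatible f w \<noteq> {}" by blast
  show "\<tau> \<in> off_lists M (star_label f w)"
    using phase_list_phase_label[OF w B] t by (auto simp: off_lists_def compatible_def)
qed

text \<open>\<open>\<rho>\<close> rewards or penalises a star according to its label.
  \<open>\<theta>\<close> is paid for each pair of a star and a marked slice in it, hence
  \<open>card D\<close> times for every marked slice.\<close>

definition star_weight :: "(('a set \<Rightarrow> 3) \<Rightarrow> bool) \<Rightarrow> (('a set \<Rightarrow> bool \<times> 3) \<Rightarrow> real) \<Rightarrow> real \<Rightarrow> ('a set \<Rightarrow> 'a set \<Rightarrow> 3) \<Rightarrow> real" where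
  "star_weight fl \<rho> \<theta> f = (\<Prod>w\<in>Vo. \<theta> ^ card {v\<in>cube_nbs D w. fl (f v)} * \<rho> (star_label f w))"

lemma compatible_cong: "(\<forall>v\<in>cube_nbs D w. f v = f' v) \<Longrightarrow> compatible f w = compatible f' w"
  by (auto simp: compatible_def)

lemma star_label_cong: "(\<forall>v\<in>cube_nbs D w. f v = f' v) \<Longrightarrow> star_label f w = star_label f' w"
  unfolding star_label_def by (metis (no_types, lifting) image_cong)

text \<open>The weight sees the even slices only. Given these, the odd slices are not adjacent to
  each other and are bounded independently by \<open>compatible\<close>.\<close>

lemma sum_star_weight_le:
  assumes \<rho>: "\<And>\<pi>. \<rho> \<pi> \<ge> 0" and \<theta>: "\<theta> \<ge> 0"
  shows "(\<Sum>c\<in>colourings (D \<union> M). star_weight fl \<rho> \<theta> (slices c)) \<le>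
    (\<Sum>f\<in>PiE Ve (\<lambda>_. colourings M). \<Prod>w\<in>Vo. \<theta> ^ card {v\<in>cube_nbs D w. fl (f v)} * \<rho> (star_label f w) * real (card (compatible f w)))"
proof -
  let ?F = "PiE Ve (\<lambda>_. colourings M)"
  have finC: "finite (colourings M)" using finM by (rule finite_colourings)
  have finB: "finite (compatible f w)" for f w using finC by (auto simp: compatible_def)
  have WT0: "star_weight fl \<rho> \<theta> f \<ge> 0" for f unfolding star_weight_def using \<rho> \<theta> by (intro prod_nonneg) auto
  let ?i = "\<lambda>(f, g). \<lambda>x\<in>Pow (D \<union> M). if even (card (x \<inter> D)) then f (x \<inter> D) (x \<inter> M) else g (x \<inter> D) (x \<inter> M)"
  have "(\<Sum>c\<in>colourings (D \<union> M). star_weight fl \<rho> \<theta> (slices c)) \<le> (\<Sum>(f, g)\<in>(SIGMA f:?F. PiE Vo (compatible f)). star_weight fl \<rho> \<theta> f)"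
  proof (rule sum_le_included[where i = ?i])
    show "finite (colourings (D \<union> M))" using finD finM by (intro finite_colourings) auto
    show "finite (SIGMA f:?F. PiE Vo (compatible f))"
      using finC finB finU finV by (intro finite_SigmaI finite_PiE) auto
    show "\<forall>y\<in>SIGMA f:?F. PiE Vo (compatible f). 0 \<le> (case y of (f, g) \<Rightarrow> star_weight fl \<rho> \<theta> f)" using WT0 by auto
    show "\<forall>c\<in>colourings (D \<union> M). \<exists>y\<in>SIGMA f:?F. PiE Vo (compatible f). ?i y = c \<and>
      star_weight fl \<rho> \<theta> (slices c) \<le> (case y of (f, g) \<Rightarrow> star_weight fl \<rho> \<theta> f)"
    proof
      fix c assume c: "c \<in> colourings (D \<union> M)"
      let ?g = "\<lambda>w\<in>Vo. slice c w"
      have "?i (slices c, ?g) x = c x" for x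
      proof (cases "x \<in> Pow (D \<union> M)")
        case True
        then have "x \<inter> D \<union> x \<inter> M = x" by auto
        then have "slice c (x \<inter> D) (x \<inter> M) = c x" by (simp add: slice_def)
        then show ?thesis using True by (auto simp: slices_def parity_class_def)
      next
        case False
        then show ?thesis using c by (auto simp: colourings_def PiE_iff extensional_def)
      qed
      then have "?i (slices c, ?g) = c" by (rule ext)
      moreover have "?g \<in> PiE Vo (compatible (slices c))" using slice_compatible[OF c] by auto
      ultimately show "\<exists>y\<in>SIGMA f:?F. PiE Vo (compatible f). ?i y = c \<and>
        star_weight fl \<rho> \<theta> (slices c) \<le> (case y of (f, g) \<Rightarrow> star_weight fl \<rho> \<theta> f)"
        using slices_PiE[OF c] by (intro bexI[of _ "(slices c, ?g)"]) auto
    qed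
  qed
  also have "\<dots> = (\<Sum>f\<in>?F. \<Sum>g\<in>PiE Vo (compatible f). star_weight fl \<rho> \<theta> f)"
    using finC finB finU finV by (subst sum.Sigma) (auto intro!: finite_PiE)
  also have "\<dots> = (\<Sum>f\<in>?F. \<Prod>w\<in>Vo. \<theta> ^ card {v\<in>cube_nbs D w. fl (f v)} * \<rho> (star_label f w) * real (card (compatible f w)))"
    using finU by (simp add: card_PiE star_weight_def prod.distrib mult.commute)
  finally show ?thesis .
qed

text \<open>The contribution of one star after Finner's inequality has raised it to the power
  \<open>card D\<close>: a sum over labels, with the \<open>card D\<close> outer slices chosen
  independently.\<close>

definition star_total :: "(('a set \<Rightarrow> 3) \<Rightarrow> bool) \<Rightarrow> (('a set \<Rightarrow> bool \<times> 3) \<Rightarrow> real) \<Rightarrow> real \<Rightarrow> real" where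
  "star_total fl \<rho> \<omega> = (\<Sum>\<pi>\<in>PiE (Pow M) (\<lambda>_. UNIV).
     (\<rho> \<pi> * card (off_lists M \<pi>)) ^ card D * (\<Sum>\<sigma>\<in>in_lists M \<pi>. if fl \<sigma> then \<omega> else 1) ^ card D)"

lemma star_sum_le:
  assumes \<rho>: "\<And>\<pi>. \<rho> \<pi> \<ge> 0" and \<theta>: "\<theta> \<ge> 0" and w: "w \<in> Vo"
  shows "(\<Sum>y\<in>PiE (cube_nbs D w) (\<lambda>_. colourings M).
    (\<theta> ^ card {v\<in>cube_nbs D w. fl (y v)} * \<rho> (star_label y w) * real (card (compatible y w))) ^ card D) \<le> star_total fl \<rho> (\<theta> ^ card D)"
proof -
  let ?d = "card D" and ?n = "cube_nbs D w"
  let ?Y = "PiE ?n (\<lambda>_. colourings M)"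
  let ?g = "\<lambda>y. (\<theta> ^ card {v\<in>?n. fl (y v)} * \<rho> (star_label y w) * real (card (compatible y w))) ^ ?d"
  let ?h = "\<lambda>\<sigma>. if fl \<sigma> then \<theta> ^ ?d else 1"
  have finC: "finite (colourings M)" using finM by (rule finite_colourings)
  have finn: "finite ?n" using fin_nb w by auto
  have cn: "card ?n = ?d" by (rule card_cube_nbs)
  have finHp: "finite (in_lists M \<pi>)" "finite (off_lists M \<pi>)" for \<pi> using finC by (auto simp: in_lists_def off_lists_def)
  have finY: "finite ?Y" using finC finn by (intro finite_PiE) auto
  have finP: "finite (PiE (Pow M) (\<lambda>_. UNIV :: (bool \<times> 3) set))" using finM by (intro finite_PiE) auto
  have d0: "?d > 0" using npos .
  have "(\<Sum>y\<in>?Y. ?g y) = (\<Sum>y\<in>{y\<in>?Y. compatible y w \<noteq> {}}. ?g y)"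
    using finY d0 by (intro sum.mono_neutral_right) (auto simp: zero_power)
  also have "\<dots> \<le> (\<Sum>(\<pi>, y)\<in>(SIGMA \<pi>:PiE (Pow M) (\<lambda>_. UNIV). PiE ?n (\<lambda>_. in_lists M \<pi>)).
      (\<rho> \<pi> * card (off_lists M \<pi>)) ^ ?d * (\<Prod>v\<in>?n. ?h (y v)))"
  proof (rule sum_le_included[where i = snd])
    show "finite {y\<in>?Y. compatible y w \<noteq> {}}" using finY by (rule finite_subset[rotated]) auto
    show "finite (SIGMA \<pi>:PiE (Pow M) (\<lambda>_. UNIV :: (bool \<times> 3) set). PiE ?n (\<lambda>_. in_lists M \<pi>))"
      using finP finn finHp finM by (intro finite_SigmaI finite_PiE) auto
    show "\<forall>y\<in>SIGMA \<pi>:PiE (Pow M) (\<lambda>_. UNIV). PiE ?n (\<lambda>_. in_lists M \<pi>). 0 \<le>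
      (case y of (\<pi>, y) \<Rightarrow> (\<rho> \<pi> * card (off_lists M \<pi>)) ^ ?d * (\<Prod>v\<in>?n. ?h (y v)))"
      using \<rho> \<theta> by (auto intro!: mult_nonneg_nonneg prod_nonneg)
    show "\<forall>y\<in>{y\<in>?Y. compatible y w \<noteq> {}}. \<exists>z\<in>SIGMA \<pi>:PiE (Pow M) (\<lambda>_. UNIV). PiE ?n (\<lambda>_. in_lists M \<pi>). snd z = y \<and>
      ?g y \<le> (case z of (\<pi>, y) \<Rightarrow> (\<rho> \<pi> * card (off_lists M \<pi>)) ^ ?d * (\<Prod>v\<in>?n. ?h (y v)))"
    proof
      fix y assume "y \<in> {y\<in>?Y. compatible y w \<noteq> {}}"
      then have y: "y \<in> ?Y" and B: "compatible y w \<noteq> {}" by auto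
      have "y v \<in> in_lists M (star_label y w)" if "v \<in> ?n" for v
        using star_label_in_lists[OF w B that] y that by auto
      then have "y \<in> PiE ?n (\<lambda>_. in_lists M (star_label y w))" using y by (auto simp: PiE_iff)
      moreover have "star_label y w \<in> PiE (Pow M) (\<lambda>_. UNIV)" by (simp add: star_label_def)
      moreover have "?g y \<le> (\<rho> (star_label y w) * card (off_lists M (star_label y w))) ^ ?d * (\<Prod>v\<in>?n. ?h (y v))"
      proof -
        have e: "(\<Prod>v\<in>?n. ?h (y v)) = (\<theta> ^ card {v\<in>?n. fl (y v)}) ^ ?d"
          using finn by (simp add: prod.If_cases Int_def power_mult[symmetric] mult.commute)
        have "real (card (compatible y w)) \<le> real (card (off_lists M (star_label y w)))"
          using compatible_off_lists[OF w] finHp by (intro of_nat_mono card_mono) auto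
        then have "\<theta> ^ card {v\<in>?n. fl (y v)} * \<rho> (star_label y w) * real (card (compatible y w)) \<le>
          \<rho> (star_label y w) * real (card (off_lists M (star_label y w))) * \<theta> ^ card {v\<in>?n. fl (y v)}"
          using \<rho>[of "star_label y w"] \<theta>
          by (simp only: mult_ac) (intro mult_left_mono mult_right_mono zero_le_power; simp)
        then show ?thesis unfolding e power_mult_distrib[symmetric]
          using \<rho>[of "star_label y w"] \<theta> by (intro power_mono) auto
      qed
      ultimately show "\<exists>z\<in>SIGMA \<pi>:PiE (Pow M) (\<lambda>_. UNIV). PiE ?n (\<lambda>_. in_lists M \<pi>). snd z = y \<and>
        ?g y \<le> (case z of (\<pi>, y) \<Rightarrow> (\<rho> \<pi> * card (off_lists M \<pi>)) ^ ?d * (\<Prod>v\<in>?n. ?h (y v)))"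
        by (intro bexI[of _ "(star_label y w, y)"]) auto
    qed
  qed
  also have "\<dots> = (\<Sum>\<pi>\<in>PiE (Pow M) (\<lambda>_. UNIV). (\<rho> \<pi> * card (off_lists M \<pi>)) ^ ?d * (\<Sum>y\<in>PiE ?n (\<lambda>_. in_lists M \<pi>). \<Prod>v\<in>?n. ?h (y v)))"
    using finP finn finHp finM by (subst sum.Sigma[symmetric]) (auto simp: sum_distrib_left intro!: finite_PiE)
  also have "\<dots> = star_total fl \<rho> (\<theta> ^ ?d)"
    unfolding star_total_def using finn by (simp add: sum_PiE_prod[where h = "\<lambda>_. ?h"] cn)
  finally show ?thesis .
qed

text \<open>Every even vertex lies in exactly \<open>card D\<close> stars, so Finner's inequality
  with exponent \<open>card D\<close> has only trivial padding factors and leaves one factor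
  \<open>star_total\<close> for each of the \<open>2 ^ (card D - 1)\<close> odd vertices.\<close>

lemma sum_star_weight_power_le:
  assumes \<rho>: "\<And>\<pi>. \<rho> \<pi> \<ge> 0" and \<theta>: "\<theta> \<ge> 0"
  shows "(\<Sum>c\<in>colourings (D \<union> M). star_weight fl \<rho> \<theta> (slices c)) ^ card D \<le> star_total fl \<rho> (\<theta> ^ card D) ^ (2 ^ (card D - 1))"
proof -
  let ?d = "card D"
  define \<phi> where "\<phi> w f = \<theta> ^ card {v\<in>cube_nbs D w. fl (f v)} * \<rho> (star_label f w) * real (card (compatible f w))" for w f
  have \<phi>0: "\<phi> w f \<ge> 0" for w f using \<rho> \<theta> by (simp add: \<phi>_def)
  have finC: "finite (colourings M)" using finM by (rule finite_colourings)
  have degeq: "card {w\<in>Vo. v \<in> cube_nbs D w} = ?d" if v: "v \<in> Ve" for v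
  proof -
    have "{w\<in>Vo. v \<in> cube_nbs D w} = cube_nbs D v" using nbV[OF v] nb_sym[OF v] by auto
    then show ?thesis by (simp add: card_cube_nbs)
  qed
  have WT0: "star_weight fl \<rho> \<theta> f \<ge> 0" for f unfolding star_weight_def using \<rho> \<theta> by (intro prod_nonneg) auto
  have "(\<Sum>c\<in>colourings (D \<union> M). star_weight fl \<rho> \<theta> (slices c)) ^ ?d \<le> (\<Sum>f\<in>PiE Ve (\<lambda>_. colourings M). \<Prod>w\<in>Vo. \<phi> w f) ^ ?d"
    using sum_star_weight_le[OF \<rho> \<theta>] WT0 unfolding \<phi>_def by (intro power_mono sum_nonneg) auto
  also have "\<dots> \<le> (\<Prod>w\<in>Vo. \<Sum>y\<in>PiE (cube_nbs D w) (\<lambda>_. colourings M). \<phi> w y ^ ?d) *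
    (\<Prod>v\<in>Ve. real (card (colourings M)) ^ (?d - card {w\<in>Vo. v \<in> cube_nbs D w}))"
  proof (rule Finner[OF finV finU npos])
    show "\<phi> w f = \<phi> w f'" if "w \<in> Vo" "\<forall>v\<in>cube_nbs D w. f v = f' v" for w f f'
    proof -
      have "{v\<in>cube_nbs D w. fl (f v)} = {v\<in>cube_nbs D w. fl (f' v)}" using that(2) by auto
      then show ?thesis using star_label_cong[OF that(2)] compatible_cong[OF that(2)] by (simp add: \<phi>_def)
    qed
  qed (use finC nbU \<phi>0 degeq in auto)
  also have "\<dots> = (\<Prod>w\<in>Vo. \<Sum>y\<in>PiE (cube_nbs D w) (\<lambda>_. colourings M). \<phi> w y ^ ?d)"
    using degeq by simp
  also have "\<dots> \<le> (\<Prod>w\<in>Vo. star_total fl \<rho> (\<theta> ^ ?d))"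
    using star_sum_le[OF \<rho> \<theta>, of _ fl] \<phi>0 unfolding \<phi>_def
    by (intro prod_mono conjI sum_nonneg) auto
  also have "\<dots> = star_total fl \<rho> (\<theta> ^ ?d) ^ (2 ^ (?d - 1))"
    using card_parity_class[OF finD D_ne, of False] by simp
  finally show ?thesis .
qed

end

section \<open>Dominant phases and the defects along their boundaries\<close>

definition phased :: "'a set \<Rightarrow> nat \<Rightarrow> ('a set \<Rightarrow> bool \<times> 3) \<Rightarrow> bool \<times> 3 \<Rightarrow> bool" where
  "phased M r \<pi> P \<longleftrightarrow> card {x\<in>Pow M. \<pi> x \<noteq> P} \<le> r"

text \<open>Only through a flat slice can two neighbouring stars have different dominant phases.\<close>

definition flat :: "'a set \<Rightarrow> nat \<Rightarrow> ('a set \<Rightarrow> 3) \<Rightarrow> bool" where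
  "flat M r \<sigma> \<longleftrightarrow> (\<exists>a b. card {x\<in>Pow M. \<sigma> x \<noteq> (if even (card x) then a else b)} \<le> 2 * r)"

lemma card_flat_le:
  assumes M: "finite M"
  shows "real (card {\<sigma>\<in>colourings M. flat M r \<sigma>}) \<le> 9 * (32 ^ (2 * r) * (17 / 16) ^ (2 ^ card M))"
proof -
  let ?N = "\<lambda>(a :: 3, b). {\<sigma>\<in>PiE (Pow M) (\<lambda>_. UNIV). card {x\<in>Pow M. \<sigma> x \<noteq> (if even (card x) then a else b)} \<le> 2 * r}"
  have fin: "finite (?N ab)" for ab
    using M by (cases ab) (auto intro!: finite_subset[OF _ finite_PiE[of "Pow M" "\<lambda>_. UNIV"]])
  have "{\<sigma>\<in>colourings M. flat M r \<sigma>} \<subseteq> (\<Union>ab\<in>UNIV. ?N ab)"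
    unfolding flat_def colourings_def by auto
  then have "card {\<sigma>\<in>colourings M. flat M r \<sigma>} \<le> card (\<Union>ab\<in>UNIV. ?N ab)" using fin by (intro card_mono) auto
  also have "\<dots> \<le> (\<Sum>ab\<in>UNIV. card (?N ab))" by (intro card_UN_le) auto
  finally have "real (card {\<sigma>\<in>colourings M. flat M r \<sigma>}) \<le> real (\<Sum>ab\<in>UNIV. card (?N ab))"
    by (simp only: of_nat_le_iff)
  also have "\<dots> = (\<Sum>ab\<in>UNIV. real (card (?N ab)))" by (rule of_nat_sum)
  also have "\<dots> \<le> (\<Sum>ab\<in>(UNIV :: (3 \<times> 3) set). 32 ^ (2 * r) * (17 / 16) ^ card (Pow M))"
  proof (rule sum_mono)
    fix ab :: "3 \<times> 3"
    obtain a b where ab: "ab = (a, b)" by (metis surj_pair)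
    show "real (card (?N ab)) \<le> 32 ^ (2 * r) * (17 / 16) ^ card (Pow M)"
      unfolding ab prod.case using M by (intro card_near_le) simp
  qed
  also have "\<dots> = 9 * (32 ^ (2 * r) * (17 / 16) ^ (2 ^ card M))"
    using M by (simp add: card_Pow)
  finally show ?thesis .
qed

context sliced_cube begin

lemma phased_unique:
  assumes r: "4 * r < 2 ^ card M" and "phased M r \<pi> P" "phased M r \<pi> Q"
  shows "P = Q"
proof (rule ccontr)
  assume "P \<noteq> Q"
  then have "Pow M = {x\<in>Pow M. \<pi> x \<noteq> P} \<union> {x\<in>Pow M. \<pi> x \<noteq> Q}" by auto
  then have "card (Pow M) \<le> card {x\<in>Pow M. \<pi> x \<noteq> P} + card {x\<in>Pow M. \<pi> x \<noteq> Q}"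
    by (metis (no_types, lifting) card_Un_le)
  then show False using assms finM unfolding phased_def by (simp add: card_Pow)
qed

text \<open>If both phases fix the same parity class, their singleton lists are disjoint there and
  the whole class would be exceptional. Otherwise one list is a singleton on the even and the other
  on the odd vertices, which determines the common slice outside at most \<open>2 * r\<close>
  points.\<close>

lemma phased_flat:
  assumes r: "4 * r < 2 ^ card M" and w: "w \<in> Vo" "w' \<in> Vo" and v: "v \<in> cube_nbs D w" "v \<in> cube_nbs D w'"
    and B: "compatible f w \<noteq> {}" "compatible f w' \<noteq> {}"
    and t: "phased M r (star_label f w) P" "phased M r (star_label f w') P'" "P \<noteq> P'"
  shows "flat M r (f v)"
proof -
  let ?E = "{x\<in>Pow M. star_label f w x \<noteq> P} \<union> {x\<in>Pow M. star_label f w' x \<noteq> P'}"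
  have finE: "finite ?E" using finM by auto
  have cE: "card ?E \<le> 2 * r"
    using card_Un_le[of "{x\<in>Pow M. star_label f w x \<noteq> P}" "{x\<in>Pow M. star_label f w' x \<noteq> P'}"] t unfolding phased_def by linarith
  have good: "f v x \<in> phase_list P x" "f v x \<in> phase_list P' x" if "x \<in> Pow M" "x \<notin> ?E" for x
    using phase_list_phase_label[OF w(1) B(1) that(1)] phase_list_phase_label[OF w(2) B(2) that(1)] that v by auto
  obtain p a p' a' where P: "P = (p, a)" "P' = (p', a')" by (metis surj_pair)
  show ?thesis
  proof (cases "p = p'")
    case True
    then have aa: "a \<noteq> a'" using P t(3) by auto
    have "parity_class M p \<subseteq> ?E"
    proof
      fix x assume x: "x \<in> parity_class M p"
      then have "even (card x) = p" "x \<in> Pow M" by (auto simp: parity_class_def)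
      show "x \<in> ?E"
      proof (rule ccontr)
        assume "x \<notin> ?E"
        then have "f v x \<in> phase_list P x" "f v x \<in> phase_list P' x" using good \<open>x \<in> Pow M\<close> by blast+
        then show False using aa True P \<open>even (card x) = p\<close> by (simp add: phase_list_def)
      qed
    qed
    then have "card (parity_class M p) \<le> card ?E" by (rule card_mono[OF finE])
    then have "card (parity_class M p) \<le> 2 * r" using cE by linarith
    then have "2 * 2 ^ (card M - 1) \<le> 4 * r" using card_parity_class[OF finM M_ne, of p] by simp
    moreover have "(2::nat) * 2 ^ (card M - 1) = 2 ^ card M" using finM M_ne by (cases "card M") auto
    ultimately show ?thesis using r by linarith
  next
    case False
    let ?e = "if p then a else a'" and ?o = "if p then a' else a"
    have "{x\<in>Pow M. f v x \<noteq> (if even (card x) then ?e else ?o)} \<subseteq> ?E"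
    proof
      fix x assume x: "x \<in> {x\<in>Pow M. f v x \<noteq> (if even (card x) then ?e else ?o)}"
      show "x \<in> ?E"
      proof (rule ccontr)
        assume "x \<notin> ?E"
        then have "f v x \<in> phase_list P x" "f v x \<in> phase_list P' x" using good x by auto
        then show False using x False P by (cases p; cases p'; cases "even (card x)") (auto simp: phase_list_def)
      qed
    qed
    then have "card {x\<in>Pow M. f v x \<noteq> (if even (card x) then ?e else ?o)} \<le> card ?E"
      by (rule card_mono[OF finE])
    then have "card {x\<in>Pow M. f v x \<noteq> (if even (card x) then ?e else ?o)} \<le> 2 * r"
      using cE by linarith
    then show ?thesis unfolding flat_def by blast
  qed
qed

definition bad_stars where "bad_stars r f = {w\<in>Vo. \<forall>P. \<not> phased M r (star_label f w) P}"
definition flat_slices where "flat_slices r f = {v\<in>Ve. flat M r (f v)}"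
text \<open>Odd vertices are assigned by the dominant phase of their star. A non-flat even vertex
  takes the phase of an adjacent star, and by \<open>phased_flat\<close> no two adjacent stars can
  disagree about it.\<close>

definition phase_region where "phase_region r f P = {w\<in>Vo. phased M r (star_label f w) P} \<union>
  {v\<in>Ve. \<not> flat M r (f v) \<and> (\<exists>w\<in>cube_nbs D v. phased M r (star_label f w) P)}"

lemma fin_bad: "finite (bad_stars r f)" "finite (flat_slices r f)"
  using finV finU by (auto simp: bad_stars_def flat_slices_def)

text \<open>From a star, the region is left only towards a flat slice. From a non-flat slice, it is
  left only towards a star without dominant phase, since a different dominant phase would make the
  slice flat.\<close>

lemma phase_region_edge:
  assumes r: "4 * r < 2 ^ card M" and B: "\<And>w. w \<in> Vo \<Longrightarrow> compatible f w \<noteq> {}"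
    and x: "x \<in> phase_region r f P" and i: "i \<in> D" and y: "flip i x \<notin> phase_region r f P"
  shows "x \<in> bad_stars r f \<union> flat_slices r f \<or> flip i x \<in> bad_stars r f \<union> flat_slices r f"
proof (cases "x \<in> Vo")
  case True
  then have y': "flip i x \<in> Ve" using flip_parity_class[OF finD i, of x True] by simp
  have "x \<in> cube_nbs D (flip i x)" using imageI[OF i, of "\<lambda>j. flip j (flip i x)"] by (simp add: cube_nbs_def)
  moreover have "phased M r (star_label f x) P" using x True disj by (auto simp: phase_region_def)
  ultimately have "flat M r (f (flip i x))" using y y' by (auto simp: phase_region_def)
  then show ?thesis using y' by (auto simp: flat_slices_def)
next
  case False
  then obtain w where w: "x \<in> Ve" "\<not> flat M r (f x)" "w \<in> cube_nbs D x" "phased M r (star_label f w) P"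
    using x by (auto simp: phase_region_def)
  have wV: "w \<in> Vo" using w nbV by blast
  have y': "flip i x \<in> Vo" using flip_parity_class[OF finD i, of x False] w by simp
  have nt: "\<not> phased M r (star_label f (flip i x)) P" using y y' by (auto simp: phase_region_def)
  have "flip i x \<in> bad_stars r f"
  proof (rule ccontr)
    assume "flip i x \<notin> bad_stars r f"
    then obtain Q where Q: "phased M r (star_label f (flip i x)) Q" using y' by (auto simp: bad_stars_def)
    have "x \<in> cube_nbs D w" using w cube_nbs_sym by blast
    moreover have "x \<in> cube_nbs D (flip i x)" using imageI[OF i, of "\<lambda>j. flip j (flip i x)"] by (simp add: cube_nbs_def)
    ultimately have "flat M r (f x)"
      using phased_flat[OF r wV y' _ _ B[OF wV] B[OF y'] w(4) Q] nt Q by blast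
    then show False using w by simp
  qed
  then show ?thesis by simp
qed

text \<open>Edges of one direction are pairwise disjoint, so each boundary edge can be charged to an
  endpoint in \<open>Y\<close> injectively, separately for each direction.\<close>

lemma boundary_le:
  assumes X: "finite Y"
    and e: "\<And>x i. x \<in> X \<Longrightarrow> i \<in> D \<Longrightarrow> flip i x \<notin> X \<Longrightarrow> x \<in> Y \<or> flip i x \<in> Y"
  shows "(\<Sum>i\<in>D. real (card {x\<in>X. flip i x \<notin> X})) \<le> card D * real (card Y)"
proof -
  have "(\<Sum>i\<in>D. real (card {x\<in>X. flip i x \<notin> X})) \<le> (\<Sum>i\<in>D. real (card Y))"
  proof (intro sum_mono of_nat_mono)
    fix i assume i: "i \<in> D"
    show "card {x\<in>X. flip i x \<notin> X} \<le> card Y"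
    proof (rule card_inj_on_le[where f = "\<lambda>x. if x \<in> Y then x else flip i x"])
      show "inj_on (\<lambda>x. if x \<in> Y then x else flip i x) {x\<in>X. flip i x \<notin> X}"
      proof (rule inj_onI)
        fix x y assume x: "x \<in> {x\<in>X. flip i x \<notin> X}" and y: "y \<in> {x\<in>X. flip i x \<notin> X}"
          and eq: "(if x \<in> Y then x else flip i x) = (if y \<in> Y then y else flip i y)"
        have "x = y \<or> x = flip i y \<or> flip i x = y" using eq by (auto split: if_splits)
        then show "x = y" using x y by auto
      qed
    qed (use e i X in auto)
  qed
  then show ?thesis by simp
qed

lemma phase_region_or_compl_le:
  assumes r: "4 * r < 2 ^ card M" and B: "\<And>w. w \<in> Vo \<Longrightarrow> compatible f w \<noteq> {}"
    and X: "X = phase_region r f P \<or> X = Pow D - phase_region r f P" and h: "real (card X) \<le> 2 ^ card D / 2"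
  shows "real (card X) \<le> card D * (real (card (bad_stars r f)) + card (flat_slices r f))"
proof -
  let ?Y = "bad_stars r f \<union> flat_slices r f"
  have XD: "X \<subseteq> Pow D" using X by (auto simp: phase_region_def parity_class_def)
  have "real (card X) \<le> (\<Sum>i\<in>D. real (card {x\<in>X. flip i x \<notin> X}))"
    using h XD by (intro card_sub_cube_le finD)
  also have "\<dots> \<le> card D * real (card ?Y)"
  proof (rule boundary_le)
    fix x i assume x: "x \<in> X" and i: "i \<in> D" and y: "flip i x \<notin> X"
    from X show "x \<in> ?Y \<or> flip i x \<in> ?Y"
    proof
      assume "X = phase_region r f P"
      then show ?thesis using phase_region_edge[OF r B _ i] x y by blast
    next
      assume X: "X = Pow D - phase_region r f P"
      then have "flip i x \<in> phase_region r f P" "flip i (flip i x) \<notin> phase_region r f P" using x y i by auto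
      from phase_region_edge[OF r B this(1) i this(2)] show ?thesis by auto
    qed
  qed (use fin_bad in auto)
  also have "\<dots> \<le> card D * (real (card (bad_stars r f)) + card (flat_slices r f))"
    using card_Un_le[of "bad_stars r f" "flat_slices r f"] by (intro mult_left_mono) linarith+
  finally show ?thesis .
qed

lemma card_cube_nbs_inside_le:
  assumes X: "X \<subseteq> Vo"
  shows "card {v\<in>Ve. cube_nbs D v \<subseteq> X} \<le> card X"
proof -
  let ?S = "{v\<in>Ve. cube_nbs D v \<subseteq> X}"
  have "card D * card ?S = (\<Sum>v\<in>?S. card (cube_nbs D v \<inter> X))"
  proof -
    have "card (cube_nbs D v \<inter> X) = card D" if "v \<in> ?S" for v
      using that card_cube_nbs[of D v] by (simp add: Int_absorb2)
    then show ?thesis by simp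
  qed
  also have "\<dots> = (\<Sum>w\<in>X. card (cube_nbs D w \<inter> ?S))" using X by (intro sum_deg) auto
  also have "\<dots> \<le> (\<Sum>w\<in>X. card D)"
  proof (rule sum_mono)
    fix w assume "w \<in> X"
    then have "finite (cube_nbs D w)" using X fin_nb by auto
    then show "card (cube_nbs D w \<inter> ?S) \<le> card D" using card_mono[of "cube_nbs D w" "cube_nbs D w \<inter> ?S"] card_cube_nbs[of D w] by auto
  qed
  finally show ?thesis using npos by (simp add: mult.commute)
qed

text \<open>With \<open>t\<close> the number of defects, the cube is covered by six regions of at
  most \<open>card D * t\<close> vertices, by the defects, and by the even vertices surrounded by
  bad stars. The last two together have at most \<open>2 * t\<close> vertices, so the factor is 6 +
  2.\<close>

lemma no_majority:
  assumes r: "4 * r < 2 ^ card M" and B: "\<And>w. w \<in> Vo \<Longrightarrow> compatible f w \<noteq> {}"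
    and h: "\<And>P. real (card (phase_region r f P)) \<le> 2 ^ card D / 2"
  shows "2 ^ card D \<le> 8 * card D * (real (card (bad_stars r f)) + card (flat_slices r f))"
proof -
  let ?b = "bad_stars r f" and ?v = "flat_slices r f"
  let ?S = "{v\<in>Ve. cube_nbs D v \<subseteq> ?b}"
  let ?t = "real (card ?b) + card ?v"
  have finK: "finite (phase_region r f P)" for P using finV finU by (auto simp: phase_region_def)
  have finS: "finite ?S" using finV by auto
  have cover: "Pow D \<subseteq> (\<Union>P\<in>UNIV. phase_region r f P) \<union> (?b \<union> ?v \<union> ?S)"
  proof
    fix x assume "x \<in> Pow D"
    then have "x \<in> Ve \<or> x \<in> Vo" by (auto simp: parity_class_def)
    then show "x \<in> (\<Union>P\<in>UNIV. phase_region r f P) \<union> (?b \<union> ?v \<union> ?S)"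
    proof
      assume x: "x \<in> Vo"
      then show ?thesis by (auto simp: phase_region_def bad_stars_def)
    next
      assume x: "x \<in> Ve"
      show ?thesis
      proof (cases "x \<in> ?v \<or> x \<in> ?S")
        case False
        then obtain w where w: "w \<in> cube_nbs D x" "w \<notin> ?b" and nf: "\<not> flat M r (f x)" using x by (auto simp: flat_slices_def)
        then obtain P where "phased M r (star_label f w) P" using nbV[OF x] by (auto simp: bad_stars_def)
        then have "x \<in> phase_region r f P" using x w nf by (auto simp: phase_region_def)
        then show ?thesis by blast
      qed auto
    qed
  qed
  have "real (2 ^ card D) = real (card (Pow D))" using finD by (simp add: card_Pow)
  also have "\<dots> \<le> real (card ((\<Union>P\<in>UNIV. phase_region r f P) \<union> (?b \<union> ?v \<union> ?S)))"
    using cover finK fin_bad finS by (intro of_nat_mono card_mono) auto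
  also have "\<dots> \<le> real (card (\<Union>P\<in>UNIV. phase_region r f P)) + (card ?b + card ?v + card ?S)"
    using card_Un_le[of "\<Union>P\<in>UNIV. phase_region r f P" "?b \<union> ?v \<union> ?S"] card_Un_le[of "?b \<union> ?v" ?S] card_Un_le[of ?b ?v]
    by linarith
  also have "real (card (\<Union>P\<in>UNIV. phase_region r f P)) \<le> real (\<Sum>P\<in>UNIV. card (phase_region r f P))"
    by (intro of_nat_mono card_UN_le) auto
  also have "\<dots> = (\<Sum>P\<in>UNIV. real (card (phase_region r f P)))" by simp
  also have "\<dots> \<le> (\<Sum>P\<in>(UNIV :: (bool \<times> 3) set). card D * ?t)"
    using phase_region_or_compl_le[OF r B _ h] by (intro sum_mono) auto
  also have "\<dots> = 6 * (card D * ?t)" by simp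
  also have "real (card ?b + card ?v + card ?S) \<le> 2 * (card D * ?t)"
  proof -
    have "card ?S \<le> card ?b" by (rule card_cube_nbs_inside_le) (auto simp: bad_stars_def)
    then have "real (card ?b + card ?v + card ?S) \<le> 2 * (1 * ?t)" by simp
    also have "\<dots> \<le> 2 * (card D * ?t)" using npos by (intro mult_left_mono mult_right_mono) auto
    finally show ?thesis .
  qed
  finally show ?thesis by simp
qed

text \<open>The complement of a majority region has at most half of the cube, so the defects bound
  it, and it contains every star without dominant phase \<open>P\<close>.\<close>

lemma majority:
  assumes r: "4 * r < 2 ^ card M" and B: "\<And>w. w \<in> Vo \<Longrightarrow> compatible f w \<noteq> {}"
    and h: "real (card (phase_region r f P)) > 2 ^ card D / 2"
  shows "real (card {w\<in>Vo. \<not> phased M r (star_label f w) P}) \<le> card D * (real (card (bad_stars r f)) + card (flat_slices r f))"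
proof -
  let ?X = "Pow D - phase_region r f P"
  have KD: "phase_region r f P \<subseteq> Pow D" by (auto simp: phase_region_def parity_class_def)
  have "card (phase_region r f P) \<le> card (Pow D)" using finD KD by (intro card_mono) auto
  moreover have "card ?X = card (Pow D) - card (phase_region r f P)"
    using KD finD by (intro card_Diff_subset) (auto intro: finite_subset)
  ultimately have c: "real (card ?X) = 2 ^ card D - real (card (phase_region r f P))" using finD by (simp add: card_Pow of_nat_diff)
  have "{w\<in>Vo. \<not> phased M r (star_label f w) P} \<subseteq> ?X" using disj by (auto simp: phase_region_def parity_class_def)
  then have "real (card {w\<in>Vo. \<not> phased M r (star_label f w) P}) \<le> real (card ?X)" using finD by (intro of_nat_mono card_mono) auto
  also have "\<dots> \<le> card D * (real (card (bad_stars r f)) + card (flat_slices r f))"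
  proof (rule phase_region_or_compl_le[OF r B])
    show "real (card ?X) \<le> 2 ^ card D / 2" using c h by linarith
  qed auto
  finally show ?thesis .
qed

definition nonexact where "nonexact f P = {w\<in>Vo. \<exists>x\<in>Pow M. star_label f w x \<noteq> P}"

text \<open>A star whose label is constantly \<open>(p, a)\<close> forces colour \<open>a\<close> at
  parity \<open>p\<close> in its centre and in all its outer slices. So a deviating vertex lies over
  a nonexact odd vertex or over an even vertex with only nonexact neighbours; the latter are no more
  numerous than the former, hence the factor 2.\<close>

lemma deviations_le:
  assumes c: "c \<in> colourings (D \<union> M)"
  shows "card {x\<in>parity_class (D \<union> M) p. c x \<noteq> a} \<le> 2 * card (nonexact (slices c) (p, a)) * 2 ^ card M"
proof -
  let ?f = "slices c" and ?X = "nonexact (slices c) (p, a)"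
  let ?S = "{v\<in>Ve. cube_nbs D v \<subseteq> ?X}"
  have XV: "?X \<subseteq> Vo" by (auto simp: nonexact_def)
  have finX: "finite ?X" "finite ?S" using finU finV by (auto simp: nonexact_def)
  have "{x\<in>parity_class (D \<union> M) p. c x \<noteq> a} \<subseteq> (\<lambda>(v, y). v \<union> y) ` ((?X \<union> ?S) \<times> Pow M)"
  proof
    fix x assume "x \<in> {x\<in>parity_class (D \<union> M) p. c x \<noteq> a}"
    then have x: "x \<subseteq> D \<union> M" "even (card x) = p" "c x \<noteq> a" by (auto simp: parity_class_def)
    define v where "v = x \<inter> D"
    define y where "y = x \<inter> M"
    have vy: "v \<subseteq> D" "y \<subseteq> M" "x = v \<union> y" using x by (auto simp: v_def y_def)
    have "card x = card v + card y"
      using vy finD finM DM finite_subset by (metis card_Un_disjoint Int_mono subset_empty)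
    then have ev: "even (card v + card y) = p" using x by simp
    have sl: "slice c v y = c x" using vy by (simp add: slice_def)
    have "v \<in> ?X \<union> ?S"
    proof (cases "v \<in> Vo")
      case True
      have "v \<in> ?X"
      proof (rule ccontr)
        assume "v \<notin> ?X"
        then have e: "star_label ?f v y = (p, a)" using True vy by (auto simp: nonexact_def)
        have "slice c v \<in> off_lists M (star_label ?f v)" using slice_compatible[OF c True] compatible_off_lists[OF True] by blast
        then have "slice c v y \<notin> phase_list (star_label ?f v y) y" using vy by (auto simp: off_lists_def)
        moreover have "odd (card v)" using True by (auto simp: parity_class_def)
        ultimately show False using x sl ev e by (auto simp: phase_list_def)
      qed
      then show ?thesis by simp
    next
      case False
      then have vV: "v \<in> Ve" using vy by (auto simp: parity_class_def)
      have "w \<in> ?X" if w: "w \<in> cube_nbs D v" for w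
      proof (rule ccontr)
        assume "w \<notin> ?X"
        have wV: "w \<in> Vo" using w nbV vV by blast
        have e: "star_label ?f w y = (p, a)" using \<open>w \<notin> ?X\<close> wV vy by (auto simp: nonexact_def)
        have Bn: "compatible ?f w \<noteq> {}" using slice_compatible[OF c wV] by blast
        have vw: "v \<in> cube_nbs D w" using w cube_nbs_sym by blast
        have "?f v = slice c v" using vV by (simp add: slices_def)
        then have "slice c v \<in> in_lists M (star_label ?f w)" using star_label_in_lists[OF wV Bn vw] slice_colourings[OF c vy(1)] by simp
        then have "slice c v y \<in> phase_list (star_label ?f w y) y" using vy by (auto simp: in_lists_def)
        moreover have "even (card v)" using vV by (auto simp: parity_class_def)
        ultimately show False using x sl ev e by (auto simp: phase_list_def)
      qed
      then show ?thesis using vV by auto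
    qed
    then show "x \<in> (\<lambda>(v, y). v \<union> y) ` ((?X \<union> ?S) \<times> Pow M)" using vy by auto
  qed
  then have "card {x\<in>parity_class (D \<union> M) p. c x \<noteq> a} \<le> card ((\<lambda>(v, y). v \<union> y) ` ((?X \<union> ?S) \<times> Pow M))"
    using finX finM by (intro card_mono) auto
  also have "\<dots> \<le> card ((?X \<union> ?S) \<times> Pow M)" using finX finM by (intro card_image_le) auto
  also have "\<dots> = card (?X \<union> ?S) * 2 ^ card M" using finM by (simp add: card_cartesian_product card_Pow)
  also have "\<dots> \<le> (2 * card ?X) * 2 ^ card M"
    using card_Un_le[of ?X ?S] card_cube_nbs_inside_le[OF XV] by (intro mult_right_mono) auto
  finally show ?thesis .
qed

end

text \<open>\<open>\<beta>\<close> marks defects. \<open>z\<close> suppresses the five other phases,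
  whose constant labels would otherwise multiply the bound for each star by 6. \<open>e\<close>
  makes it visible when many stars of the phase \<open>P0\<close> are imperfect.\<close>

definition star_reward :: "'a set \<Rightarrow> nat \<Rightarrow> bool \<times> 3 \<Rightarrow> real \<Rightarrow> real \<Rightarrow> real \<Rightarrow> ('a set \<Rightarrow> bool \<times> 3) \<Rightarrow> real" where
  "star_reward M r P0 z e \<beta> \<pi> =
    (if \<forall>P. \<not> phased M r \<pi> P then \<beta>
     else if \<not> phased M r \<pi> P0 then z
     else if \<forall>x\<in>Pow M. \<pi> x = P0 then 1 else e)"

section \<open>Upper bound for the contribution of one star\<close>

context sliced_cube begin

lemma phased_const: "(\<forall>x\<in>Pow M. \<pi> x = P) \<Longrightarrow> phased M r \<pi> P"
proof -
  assume "\<forall>x\<in>Pow M. \<pi> x = P"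
  then have "{x\<in>Pow M. \<pi> x \<noteq> P} = {}" by auto
  then show ?thesis unfolding phased_def by (metis card.empty le0)
qed

lemma card_off_lists_phased_le:
  assumes t: "phased M r \<pi> P"
  shows "real (card (off_lists M \<pi>)) \<le> 2 ^ (2 ^ (card M - 1) + r)"
proof -
  obtain p a where P: "P = (p, a)" by (metis surj_pair)
  have finP: "finite (Pow M)" using finM by simp
  let ?X = "{x\<in>Pow M. card (- phase_list (\<pi> x) x) = 2}"
  have c12: "card (- phase_list (\<pi> x) x) = 1 \<or> card (- phase_list (\<pi> x) x) = 2" for x
    by (auto simp: phase_list_def card_Compl3)
  have "card (off_lists M \<pi>) \<le> (\<Prod>x\<in>Pow M. card (- phase_list (\<pi> x) x))" by (rule card_in_lists_le(2)[OF finM])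
  also have "\<dots> = (\<Prod>x\<in>Pow M. if x \<in> ?X then 2 else 1)"
    using c12 by (intro prod.cong refl) auto
  also have "\<dots> = 2 ^ card ?X" using finP by (simp add: prod.If_cases Int_def)
  also have "\<dots> \<le> 2 ^ (2 ^ (card M - 1) + r)"
  proof (rule power_increasing)
    have "?X \<subseteq> parity_class M p \<union> {x\<in>Pow M. \<pi> x \<noteq> P}"
      by (auto simp: parity_class_def P phase_list_def card_Compl3 split: if_splits)
    then have "card ?X \<le> card (parity_class M p \<union> {x\<in>Pow M. \<pi> x \<noteq> P})"
      using finP finite_parity_class[OF finM] by (intro card_mono) auto
    also have "\<dots> \<le> card (parity_class M p) + card {x\<in>Pow M. \<pi> x \<noteq> P}" by (rule card_Un_le)
    finally show "card ?X \<le> 2 ^ (card M - 1) + r" using t card_parity_class[OF finM M_ne] by (simp add: phased_def)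
  qed simp
  finally have "real (card (off_lists M \<pi>)) \<le> real (2 ^ (2 ^ (card M - 1) + r))" by (simp only: of_nat_le_iff)
  then show ?thesis by simp
qed

lemma card_in_lists_const_le:
  assumes t: "\<forall>x\<in>Pow M. \<pi> x = P"
  shows "real (card (in_lists M \<pi>)) \<le> 2 ^ (2 ^ (card M - 1))"
proof -
  obtain p a where P: "P = (p, a)" by (metis surj_pair)
  have finP: "finite (Pow M)" using finM by simp
  have "card (in_lists M \<pi>) \<le> (\<Prod>x\<in>Pow M. card (phase_list (\<pi> x) x))" by (rule card_in_lists_le(1)[OF finM])
  also have "\<dots> = (\<Prod>x\<in>Pow M. if x \<in> parity_class M (\<not> p) then 2 else 1)"
    using t by (intro prod.cong refl) (auto simp: P phase_list_def parity_class_def card_Compl3)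
  also have "\<dots> = 2 ^ card (parity_class M (\<not> p))"
  proof -
    have "Pow M \<inter> {x. x \<in> parity_class M (\<not> p)} = parity_class M (\<not> p)" by (auto simp: parity_class_def)
    then show ?thesis using finP by (simp add: prod.If_cases)
  qed
  finally have "real (card (in_lists M \<pi>)) \<le> real (2 ^ card (parity_class M (\<not> p)))" by (simp only: of_nat_le_iff)
  then show ?thesis using card_parity_class[OF finM M_ne, of "\<not> p"] by simp
qed

text \<open>The additive bound serves labels with a dominant phase, where flat slices are
  negligible. The multiplicative one serves the other labels, whose loss is large enough to absorb a
  factor \<open>\<omega>\<close> for all slices.\<close>

lemma flat_sum_le:
  fixes F \<omega> :: real
  assumes F: "real (card {\<sigma>\<in>colourings M. flat M r \<sigma>}) \<le> F" and \<omega>: "\<omega> \<ge> 1"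
  shows "(\<Sum>\<sigma>\<in>in_lists M \<pi>. if flat M r \<sigma> then \<omega> else 1) \<le> card (in_lists M \<pi>) + \<omega> * F"
    and "(\<Sum>\<sigma>\<in>in_lists M \<pi>. if flat M r \<sigma> then \<omega> else 1) \<le> \<omega> * card (in_lists M \<pi>)"
proof -
  have finC: "finite (colourings M)" using finM by (rule finite_colourings)
  have finHp: "finite (in_lists M \<pi>)" using finC by (auto simp: in_lists_def)
  have "(\<Sum>\<sigma>\<in>in_lists M \<pi>. if flat M r \<sigma> then \<omega> else 1) \<le> (\<Sum>\<sigma>\<in>in_lists M \<pi>. 1 + (if flat M r \<sigma> then \<omega> else 0))"
    using \<omega> by (intro sum_mono) auto
  also have "\<dots> = card (in_lists M \<pi>) + \<omega> * card {\<sigma>\<in>in_lists M \<pi>. flat M r \<sigma>}"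
    using finHp by (simp add: sum.distrib sum.If_cases Int_def)
  also have "\<dots> \<le> card (in_lists M \<pi>) + \<omega> * F"
  proof -
    have "card {\<sigma>\<in>in_lists M \<pi>. flat M r \<sigma>} \<le> card {\<sigma>\<in>colourings M. flat M r \<sigma>}"
      using finC by (intro card_mono) (auto simp: in_lists_def)
    then have "real (card {\<sigma>\<in>in_lists M \<pi>. flat M r \<sigma>}) \<le> F" using F by linarith
    then show ?thesis using \<omega> by (intro add_left_mono mult_left_mono) auto
  qed
  finally show "(\<Sum>\<sigma>\<in>in_lists M \<pi>. if flat M r \<sigma> then \<omega> else 1) \<le> card (in_lists M \<pi>) + \<omega> * F" .
  have "(\<Sum>\<sigma>\<in>in_lists M \<pi>. if flat M r \<sigma> then \<omega> else 1) \<le> (\<Sum>\<sigma>\<in>in_lists M \<pi>. \<omega>)"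
    using \<omega> by (intro sum_mono) auto
  then show "(\<Sum>\<sigma>\<in>in_lists M \<pi>. if flat M r \<sigma> then \<omega> else 1) \<le> \<omega> * card (in_lists M \<pi>)" by (simp add: mult.commute)
qed

text \<open>Three kinds of labels. The six constant ones give the main term, with
  \<open>\<delta>\<close> for flat slices. A nonconstant label with a dominant phase loses a
  constant factor, and one without loses \<open>\<gamma>\<close>; both losses occur to the power
  \<open>card D\<close>, against at most \<open>6 ^ (2 ^ card M)\<close> labels.\<close>

lemma star_total_le:
  fixes F \<omega> z e \<beta> \<gamma> \<delta> :: real
  assumes r: "real r + 1 \<le> 2 ^ card M / 2" "4 * r < 2 ^ card M"
    and F: "real (card {\<sigma>\<in>colourings M. flat M r \<sigma>}) \<le> F" and \<omega>: "\<omega> \<ge> 1"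
    and z: "0 \<le> z" "z \<le> 1" and e: "1 \<le> e" and \<beta>: "0 \<le> \<beta>"
    and h1: "\<omega> * F \<le> \<delta> * 2 ^ (2 ^ (card M - 1))"
    and h2: "\<omega> * F * 2 ^ (2 ^ (card M - 1) + r) \<le> 2 ^ (2 ^ card M) / 20"
    and h3: "\<beta> * \<omega> * (3 / 4) powr ((real r + 1) / card M) \<le> \<gamma>"
  shows "star_total (flat M r) (star_reward M r P0 z e \<beta>) \<omega> \<le>
    (2 ^ (2 ^ card M)) ^ card D * ((1 + 5 * z ^ card D) * (1 + \<delta>) ^ card D
      + 6 ^ (2 ^ card M) * ((4 / 5 * e) ^ card D + \<gamma> ^ card D))"
proof -
  let ?d = "card D" and ?K = "2 ^ card M :: nat"
  define X where "X = (2::real) ^ (2 ^ card M)"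
  define Y where "Y = (2::real) ^ (2 ^ (card M - 1))"
  have XY: "X = Y * Y"
  proof -
    have "(2::nat) ^ card M = 2 ^ (card M - 1) + 2 ^ (card M - 1)"
      using finM M_ne by (cases "card M") auto
    then show ?thesis unfolding X_def Y_def by (simp add: power_add)
  qed
  have Y1: "Y > 0" and X0: "X > 0" by (simp_all add: X_def Y_def)
  have F0: "F \<ge> 0" using F by linarith
  have \<delta>0: "\<delta> \<ge> 0"
  proof -
    have "0 \<le> \<delta> * Y" using h1 F0 \<omega> by (smt (verit) Y_def mult_nonneg_nonneg)
    then show ?thesis using Y1 by (simp add: zero_le_mult_iff)
  qed
  have \<gamma>0: "\<gamma> \<ge> 0" using h3 \<beta> \<omega> by (smt (verit) mult_nonneg_nonneg powr_ge_zero)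
  let ?\<rho> = "star_reward M r P0 z e \<beta>"
  let ?S = "\<lambda>\<pi>. \<Sum>\<sigma>\<in>in_lists M \<pi>. if flat M r \<sigma> then \<omega> else 1"
  let ?T = "\<lambda>\<pi>. (?\<rho> \<pi> * card (off_lists M \<pi>)) ^ ?d * ?S \<pi> ^ ?d"
  let ?P = "PiE (Pow M) (\<lambda>_. UNIV :: (bool \<times> 3) set)"
  let ?cp = "\<lambda>P. \<lambda>x\<in>Pow M. (P :: bool \<times> 3)"
  have finP: "finite ?P" using finM by (intro finite_PiE) auto
  have S0: "?S \<pi> \<ge> 0" for \<pi> using \<omega> by (intro sum_nonneg) auto
  have \<rho>0: "?\<rho> \<pi> \<ge> 0" for \<pi> using z e \<beta> by (simp add: star_reward_def)
  have Tpow: "?T \<pi> = (?\<rho> \<pi> * (card (off_lists M \<pi>) * ?S \<pi>)) ^ ?d" for \<pi> by (simp add: power_mult_distrib)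
  have const: "?T (?cp P) \<le> (if P = P0 then 1 else z ^ ?d) * (X ^ ?d * (1 + \<delta>) ^ ?d)" for P
  proof -
    have cc: "\<forall>x\<in>Pow M. ?cp P x = P" by simp
    have ph: "phased M r (?cp P) P" by (rule phased_const[OF cc])
    have ph0: "phased M 0 (?cp P) P" by (rule phased_const[OF cc])
    have \<rho>: "?\<rho> (?cp P) = (if P = P0 then 1 else z)"
    proof -
      have ex: "\<not> (\<forall>P'. \<not> phased M r (?cp P) P')" using ph by blast
      have R: "?\<rho> (?cp P) = (if \<not> phased M r (?cp P) P0 then z else if \<forall>x\<in>Pow M. ?cp P x = P0 then 1 else e)"
        unfolding star_reward_def by (rule if_not_P[OF ex])
      show ?thesis
      proof (cases "P = P0")
        case True
        then show ?thesis using ph unfolding R by simp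
      next
        case False
        then have "\<not> phased M r (?cp P) P0" using phased_unique[OF r(2) ph] by blast
        then show ?thesis using False unfolding R by simp
      qed
    qed
    have "card (off_lists M (?cp P)) * ?S (?cp P) \<le> Y * (Y * (1 + \<delta>))"
    proof (rule mult_mono)
      show "real (card (off_lists M (?cp P))) \<le> Y" using card_off_lists_phased_le[OF ph0] by (simp add: Y_def)
      have "?S (?cp P) \<le> card (in_lists M (?cp P)) + \<omega> * F" by (rule flat_sum_le(1)[OF F \<omega>])
      also have "\<dots> \<le> Y + \<delta> * Y" unfolding Y_def by (rule add_mono[OF card_in_lists_const_le[OF cc] h1])
      finally show "?S (?cp P) \<le> Y * (1 + \<delta>)" by (simp add: algebra_simps)
    qed (use S0 Y1 in auto)
    then have "?\<rho> (?cp P) * (card (off_lists M (?cp P)) * ?S (?cp P)) \<le> (if P = P0 then 1 else z) * (X * (1 + \<delta>))"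
      unfolding \<rho> XY using z by (intro mult_left_mono) (auto simp: mult_ac)
    then have "?T (?cp P) \<le> ((if P = P0 then 1 else z) * (X * (1 + \<delta>))) ^ ?d"
      unfolding Tpow using \<rho>0 S0 by (intro power_mono) auto
    also have "\<dots> = (if P = P0 then 1 else z ^ ?d) * (X ^ ?d * (1 + \<delta>) ^ ?d)"
      by (auto simp: power_mult_distrib)
    finally show ?thesis .
  qed
  have nonconst: "?T \<pi> \<le> X ^ ?d * ((4 / 5 * e) ^ ?d + \<gamma> ^ ?d)" if nc: "\<not> (\<exists>P. \<forall>x\<in>Pow M. \<pi> x = P)" for \<pi>
  proof (cases "\<exists>P. phased M r \<pi> P")
    case True
    then obtain P where P: "phased M r \<pi> P" by blast
    have "2 \<le> (2::real) ^ card M" using finM M_ne self_le_power[of "2::real" "card M"] by (simp add: card_gt_0_iff)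
    moreover have "card {x\<in>Pow M. \<pi> x \<noteq> Q} > 0" for Q
    proof -
      have "{x\<in>Pow M. \<pi> x \<noteq> Q} \<noteq> {}" using nc by blast
      moreover have "finite {x\<in>Pow M. \<pi> x \<noteq> Q}" using finM by simp
      ultimately show ?thesis by (meson card_gt_0_iff)
    qed
    \<comment> \<open>Threshold 0: a nonconstant label changes along at least one edge and so loses
      a factor 3 / 4. Flat slices return at most 1 / 20, which makes 4 / 5.\<close>
    ultimately obtain i where i: "i \<in> M" "real 0 + 1 \<le> card M * real (cut M \<pi> i)"
      using ex_big_cut[OF finM M_ne, of 0 \<pi>] by auto
    then have "cut M \<pi> i \<noteq> 0" by (cases "cut M \<pi> i") auto
    then have cut: "(3 / 4 :: real) ^ cut M \<pi> i \<le> 3 / 4" using power_decreasing[of 1 "cut M \<pi> i" "3/4 :: real"] by simp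
    have "real (card (off_lists M \<pi>)) * card (in_lists M \<pi>) \<le> X * (3 / 4) ^ cut M \<pi> i"
      using card_in_lists_off_lists_le[OF finM i(1), of \<pi>] by (simp add: X_def mult.commute)
    also have "\<dots> \<le> X * (3 / 4)" using cut X0 by (intro mult_left_mono) auto
    finally have 1: "real (card (off_lists M \<pi>)) * card (in_lists M \<pi>) \<le> X * (3 / 4)" .
    have "real (card (off_lists M \<pi>)) * (\<omega> * F) \<le> 2 ^ (2 ^ (card M - 1) + r) * (\<omega> * F)"
      using card_off_lists_phased_le[OF P] F0 \<omega> by (intro mult_right_mono) auto
    also have "\<dots> \<le> X / 20" using h2 by (simp add: X_def mult_ac)
    finally have 2: "real (card (off_lists M \<pi>)) * (\<omega> * F) \<le> X / 20" .
    have "card (off_lists M \<pi>) * ?S \<pi> \<le> card (off_lists M \<pi>) * (card (in_lists M \<pi>) + \<omega> * F)"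
      by (intro mult_left_mono flat_sum_le(1)[OF F \<omega>]) auto
    also have "\<dots> \<le> X * (4 / 5)" using 1 2 by (simp add: algebra_simps)
    finally have 3: "card (off_lists M \<pi>) * ?S \<pi> \<le> X * (4 / 5)" .
    have 4: "?\<rho> \<pi> \<le> e" using z e True by (auto simp: star_reward_def)
    have "?\<rho> \<pi> * (card (off_lists M \<pi>) * ?S \<pi>) \<le> e * (X * (4 / 5))"
      by (rule mult_mono[OF 4 3]) (use e S0 in auto)
    then have "?T \<pi> \<le> (e * (X * (4 / 5))) ^ ?d" unfolding Tpow using \<rho>0 S0 by (intro power_mono) auto
    also have "e * (X * (4 / 5)) = X * (4 / 5 * e)" by simp
    also have "(X * (4 / 5 * e)) ^ ?d = X ^ ?d * (4 / 5 * e) ^ ?d" by (rule power_mult_distrib)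
    also have "\<dots> \<le> X ^ ?d * ((4 / 5 * e) ^ ?d + \<gamma> ^ ?d)" using X0 \<gamma>0 by (intro mult_left_mono) auto
    finally show ?thesis .
  next
    case False
    then have "card {x\<in>Pow M. \<pi> x \<noteq> Q} > r" for Q unfolding phased_def by (meson not_le)
    then obtain i where i: "i \<in> M" "real r + 1 \<le> card M * real (cut M \<pi> i)"
      using ex_big_cut[OF finM M_ne r(1), of \<pi>] by auto
    have m0: "real (card M) > 0" using finM M_ne by (simp add: card_gt_0_iff)
    have "(3 / 4 :: real) ^ cut M \<pi> i = (3 / 4) powr real (cut M \<pi> i)" by (simp add: powr_realpow)
    also have "\<dots> \<le> (3 / 4) powr ((real r + 1) / card M)"
      using i m0 by (intro powr_mono') (auto simp: divide_le_eq mult.commute)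
    finally have cut: "(3 / 4 :: real) ^ cut M \<pi> i \<le> (3 / 4) powr ((real r + 1) / card M)" .
    have "card (off_lists M \<pi>) * ?S \<pi> \<le> card (off_lists M \<pi>) * (\<omega> * card (in_lists M \<pi>))"
      by (intro mult_left_mono flat_sum_le(2)[OF F \<omega>]) auto
    also have "\<dots> = \<omega> * real (card (in_lists M \<pi>) * card (off_lists M \<pi>))" by simp
    also have "\<dots> \<le> \<omega> * (X * (3 / 4) ^ cut M \<pi> i)"
      unfolding X_def using \<omega> by (intro mult_left_mono card_in_lists_off_lists_le[OF finM i(1)]) auto
    also have "\<dots> \<le> \<omega> * (X * (3 / 4) powr ((real r + 1) / card M))"
      using \<omega> X0 cut by (intro mult_left_mono) auto
    finally have 3: "card (off_lists M \<pi>) * ?S \<pi> \<le> \<omega> * (X * (3 / 4) powr ((real r + 1) / card M))" .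
    have "?\<rho> \<pi> = \<beta>" using False by (auto simp: star_reward_def)
    then have "?\<rho> \<pi> * (card (off_lists M \<pi>) * ?S \<pi>) \<le> \<beta> * (\<omega> * (X * (3 / 4) powr ((real r + 1) / card M)))"
      using 3 \<beta> by (simp only: mult_left_mono)
    also have "\<dots> = (\<beta> * \<omega> * (3 / 4) powr ((real r + 1) / card M)) * X" by (simp add: mult_ac)
    also have "\<dots> \<le> \<gamma> * X" using h3 X0 by (intro mult_right_mono) auto
    finally have "?T \<pi> \<le> (\<gamma> * X) ^ ?d" unfolding Tpow using \<rho>0 S0 by (intro power_mono) auto
    also have "\<dots> = X ^ ?d * \<gamma> ^ ?d" by (simp add: power_mult_distrib)
    also have "\<dots> \<le> X ^ ?d * ((4 / 5 * e) ^ ?d + \<gamma> ^ ?d)" using X0 e by (intro mult_left_mono) auto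
    finally show ?thesis .
  qed
  let ?Q = "\<lambda>\<pi>. \<exists>P. \<forall>x\<in>Pow M. \<pi> x = P"
  have "star_total (flat M r) ?\<rho> \<omega> = (\<Sum>\<pi>\<in>?P. ?T \<pi>)" by (simp add: star_total_def)
  also have "\<dots> = (\<Sum>\<pi>\<in>{\<pi>\<in>?P. ?Q \<pi>}. ?T \<pi>) + (\<Sum>\<pi>\<in>{\<pi>\<in>?P. \<not> ?Q \<pi>}. ?T \<pi>)"
    by (rule sum_split_pred[OF finP])
  also have "(\<Sum>\<pi>\<in>{\<pi>\<in>?P. ?Q \<pi>}. ?T \<pi>) \<le> (\<Sum>P\<in>UNIV. (if P = P0 then 1 else z ^ ?d) * (X ^ ?d * (1 + \<delta>) ^ ?d))"
  proof (rule sum_le_included[where i = ?cp])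
    show "finite {\<pi>\<in>?P. ?Q \<pi>}" using finP by (rule finite_subset[rotated]) auto
    show "\<forall>P\<in>UNIV. 0 \<le> (if P = P0 then 1 else z ^ ?d) * (X ^ ?d * (1 + \<delta>) ^ ?d)"
      using z X0 \<delta>0 by auto
    show "\<forall>\<pi>\<in>{\<pi>\<in>?P. ?Q \<pi>}. \<exists>P\<in>UNIV. ?cp P = \<pi> \<and> ?T \<pi> \<le> (if P = P0 then 1 else z ^ ?d) * (X ^ ?d * (1 + \<delta>) ^ ?d)"
    proof
      fix \<pi> assume "\<pi> \<in> {\<pi>\<in>?P. ?Q \<pi>}"
      then obtain P where P: "\<pi> \<in> ?P" "\<forall>x\<in>Pow M. \<pi> x = P" by auto
      then have e: "?cp P = \<pi>" by (auto simp: fun_eq_iff PiE_iff extensional_def)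
      show "\<exists>P\<in>UNIV. ?cp P = \<pi> \<and> ?T \<pi> \<le> (if P = P0 then 1 else z ^ ?d) * (X ^ ?d * (1 + \<delta>) ^ ?d)"
        using const[of P] e by blast
    qed
  qed simp
  also have "(\<Sum>P\<in>UNIV. (if P = P0 then 1 else z ^ ?d) * (X ^ ?d * (1 + \<delta>) ^ ?d))
    = (1 + 5 * z ^ ?d) * (X ^ ?d * (1 + \<delta>) ^ ?d)"
  proof -
    have "- {P. P = P0} = - {P0}" by auto
    moreover have "card (- {P0}) = 5" by (simp add: Compl_eq_Diff_UNIV card_Diff_subset)
    ultimately have "(\<Sum>P\<in>UNIV. if P = P0 then 1 else z ^ ?d) = 1 + 5 * z ^ ?d"
      by (simp add: sum.If_cases)
    then show ?thesis by (simp add: sum_distrib_right[symmetric])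
  qed
  also have "(\<Sum>\<pi>\<in>{\<pi>\<in>?P. \<not> ?Q \<pi>}. ?T \<pi>) \<le> (\<Sum>\<pi>\<in>{\<pi>\<in>?P. \<not> ?Q \<pi>}. X ^ ?d * ((4 / 5 * e) ^ ?d + \<gamma> ^ ?d))"
    by (intro sum_mono nonconst) auto
  also have "\<dots> \<le> 6 ^ ?K * (X ^ ?d * ((4 / 5 * e) ^ ?d + \<gamma> ^ ?d))"
  proof -
    have "card {\<pi>\<in>?P. \<not> ?Q \<pi>} \<le> card ?P" using finP by (intro card_mono) auto
    also have "\<dots> = 6 ^ ?K" using finM by (simp add: card_PiE card_Pow)
    finally have "real (card {\<pi>\<in>?P. \<not> ?Q \<pi>}) \<le> real (6 ^ ?K)" by (simp only: of_nat_le_iff)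
    then show ?thesis using X0 e \<gamma>0 by (simp add: mult_right_mono)
  qed
  finally show ?thesis by (simp add: X_def algebra_simps)
qed

end

section \<open>Rarity of colourings far from every phase\<close>

context sliced_cube begin

text \<open>A flat slice collects \<open>root (card D) \<omega>\<close> from each of its
  \<open>card D\<close> stars. A star without any dominant phase is counted here with
  \<open>\<omega> * z\<close> although its reward is \<open>\<omega>\<close>, which is harmless as
  \<open>z \<le> 1\<close>.\<close>

lemma star_weight_ge:
  fixes \<omega> z e :: real
  assumes \<omega>: "\<omega> \<ge> 1" and z: "0 < z" "z \<le> 1" and e: "1 \<le> e"
  shows "star_weight (flat M r) (star_reward M r P0 z e \<omega>) (root (card D) \<omega>) f
    \<ge> \<omega> ^ (card (bad_stars r f) + card (flat_slices r f)) * z ^ card {w\<in>Vo. \<not> phased M r (star_label f w) P0}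
      * e ^ (card (nonexact f P0) - card {w\<in>Vo. \<not> phased M r (star_label f w) P0})"
proof -
  let ?N = "{w\<in>Vo. \<not> phased M r (star_label f w) P0}"
  let ?E = "{w\<in>Vo. phased M r (star_label f w) P0 \<and> \<not> (\<forall>x\<in>Pow M. star_label f w x = P0)}"
  let ?\<theta> = "root (card D) \<omega>"
  have \<theta>: "?\<theta> ^ card D = \<omega>" "?\<theta> \<ge> 0" using \<omega> npos by (auto simp: real_root_ge_zero)
  have "(\<Sum>w\<in>Vo. card {v\<in>cube_nbs D w. flat M r (f v)}) = card D * card (flat_slices r f)"
  proof -
    have "(\<Sum>w\<in>Vo. card {v\<in>cube_nbs D w. flat M r (f v)}) = (\<Sum>w\<in>Vo. card (cube_nbs D w \<inter> flat_slices r f))"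
      using nbU by (intro sum.cong refl arg_cong[of _ _ card]) (auto simp: flat_slices_def)
    also have "\<dots> = (\<Sum>v\<in>flat_slices r f. card (cube_nbs D v \<inter> Vo))"
      by (rule sum_deg[symmetric]) (auto simp: flat_slices_def)
    also have "\<dots> = (\<Sum>v\<in>flat_slices r f. card D)"
    proof (intro sum.cong refl)
      fix v assume "v \<in> flat_slices r f"
      then have "cube_nbs D v \<inter> Vo = cube_nbs D v" using nbV by (auto simp: flat_slices_def)
      then show "card (cube_nbs D v \<inter> Vo) = card D" by (simp add: card_cube_nbs)
    qed
    finally show ?thesis by simp
  qed
  then have 1: "(\<Prod>w\<in>Vo. ?\<theta> ^ card {v\<in>cube_nbs D w. flat M r (f v)}) = \<omega> ^ card (flat_slices r f)"
    by (simp add: power_sum[symmetric] power_mult \<theta>)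
  have pc: "(\<Prod>w\<in>Vo. if Q w then a else 1) = a ^ card {w\<in>Vo. Q w}" for Q and a :: real
    using finU by (simp add: prod.If_cases Int_def)
  have "(\<Prod>w\<in>Vo. (if \<forall>P. \<not> phased M r (star_label f w) P then \<omega> else 1) * (if \<not> phased M r (star_label f w) P0 then z else 1)
      * (if phased M r (star_label f w) P0 \<and> \<not> (\<forall>x\<in>Pow M. star_label f w x = P0) then e else 1)) \<le> (\<Prod>w\<in>Vo. star_reward M r P0 z e \<omega> (star_label f w))"
  proof (intro prod_mono conjI)
    fix w assume "w \<in> Vo"
    show "(if \<forall>P. \<not> phased M r (star_label f w) P then \<omega> else 1) * (if \<not> phased M r (star_label f w) P0 then z else 1)
      * (if phased M r (star_label f w) P0 \<and> \<not> (\<forall>x\<in>Pow M. star_label f w x = P0) then e else 1) \<le> star_reward M r P0 z e \<omega> (star_label f w)"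
    proof (cases "\<forall>P. \<not> phased M r (star_label f w) P")
      case True
      then have n: "(\<forall>P. \<not> phased M r (star_label f w) P) = True" "phased M r (star_label f w) P0 = False" by blast+
      show ?thesis unfolding star_reward_def n using \<omega> z by (simp add: mult_left_le)
    next
      case False
      then have n: "(\<forall>P. \<not> phased M r (star_label f w) P) = False" by blast
      show ?thesis unfolding star_reward_def n using z e by auto
    qed
  qed (use \<omega> z e in auto)
  then have 2: "\<omega> ^ card (bad_stars r f) * z ^ card ?N * e ^ card ?E \<le> (\<Prod>w\<in>Vo. star_reward M r P0 z e \<omega> (star_label f w))"
    by (simp only: prod.distrib pc bad_stars_def)
  have "nonexact f P0 \<subseteq> ?E \<union> ?N" by (auto simp: nonexact_def)
  then have "card (nonexact f P0) \<le> card (?E \<union> ?N)" using finU by (intro card_mono) auto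
  also have "\<dots> \<le> card ?E + card ?N" by (rule card_Un_le)
  finally have "e ^ (card (nonexact f P0) - card ?N) \<le> e ^ card ?E" using e by (intro power_increasing) auto
  then have "\<omega> ^ card (bad_stars r f) * z ^ card ?N * e ^ (card (nonexact f P0) - card ?N) \<le> \<omega> ^ card (bad_stars r f) * z ^ card ?N * e ^ card ?E"
    using \<omega> z by (intro mult_left_mono) auto
  with 2 have "\<omega> ^ card (bad_stars r f) * z ^ card ?N * e ^ (card (nonexact f P0) - card ?N) \<le> (\<Prod>w\<in>Vo. star_reward M r P0 z e \<omega> (star_label f w))"
    by linarith
  then have "\<omega> ^ card (flat_slices r f) * (\<omega> ^ card (bad_stars r f) * z ^ card ?N * e ^ (card (nonexact f P0) - card ?N))
    \<le> \<omega> ^ card (flat_slices r f) * (\<Prod>w\<in>Vo. star_reward M r P0 z e \<omega> (star_label f w))"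
    using \<omega> by (intro mult_left_mono) auto
  then show ?thesis unfolding star_weight_def prod.distrib 1 by (simp add: power_add mult_ac)
qed

lemma sum_star_weight_le_powr:
  fixes \<omega> z e R :: real
  assumes \<omega>: "\<omega> \<ge> 1" and z: "0 < z" "z \<le> 1" and e: "1 \<le> e"
    and R: "star_total (flat M r) (star_reward M r P0 z e \<omega>) \<omega> \<le> (2 ^ (2 ^ card M)) ^ card D * R" "R > 0"
  shows "(\<Sum>c\<in>colourings (D \<union> M). star_weight (flat M r) (star_reward M r P0 z e \<omega>) (root (card D) \<omega>) (slices c))
    \<le> 2 ^ (2 ^ (card D + card M - 1)) * R powr (2 ^ (card D - 1) / card D)"
proof -
  let ?d = "card D" and ?s = "\<Sum>c\<in>colourings (D \<union> M). star_weight (flat M r) (star_reward M r P0 z e \<omega>) (root (card D) \<omega>) (slices c)"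
  have \<theta>: "root ?d \<omega> ^ ?d = \<omega>" "root ?d \<omega> \<ge> 0" using \<omega> npos by (auto simp: real_root_ge_zero)
  have \<rho>0: "star_reward M r P0 z e \<omega> \<pi> \<ge> 0" for \<pi> using z e \<omega> by (simp add: star_reward_def)
  have T0: "star_total (flat M r) (star_reward M r P0 z e \<omega>) \<omega> \<ge> 0"
    unfolding star_total_def using \<rho>0 \<omega> by (intro sum_nonneg mult_nonneg_nonneg zero_le_power) auto
  have s0: "?s \<ge> 0" unfolding star_weight_def using \<rho>0 \<theta> by (intro sum_nonneg prod_nonneg) auto
  have "?s ^ ?d \<le> star_total (flat M r) (star_reward M r P0 z e \<omega>) \<omega> ^ (2 ^ (?d - 1))"
    using sum_star_weight_power_le[of "star_reward M r P0 z e \<omega>" "root ?d \<omega>" "flat M r"] \<rho>0 \<theta> by simp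
  also have "\<dots> \<le> ((2 ^ (2 ^ card M)) ^ ?d * R) ^ (2 ^ (?d - 1))"
    using R T0 by (intro power_mono) auto
  also have "\<dots> = (2 ^ (2 ^ (?d + card M - 1)) * R powr (2 ^ (?d - 1) / ?d)) ^ ?d"
  proof -
    have "(2 ^ (2 ^ card M)) ^ (2 ^ (?d - 1)) = (2::real) ^ (2 ^ (?d + card M - 1))"
    proof -
      have "(2::nat) ^ card M * 2 ^ (?d - 1) = 2 ^ (?d + card M - 1)"
        using npos by (simp add: power_add[symmetric] add.commute)
      then show ?thesis by (simp add: power_mult[symmetric])
    qed
    moreover have "(R powr (2 ^ (?d - 1) / ?d)) ^ ?d = R ^ (2 ^ (?d - 1))"
    proof -
      have "(R powr (2 ^ (?d - 1) / ?d)) ^ ?d = R powr (2 ^ (?d - 1) / ?d * ?d)"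
        using R(2) by (simp add: powr_powr flip: powr_realpow)
      also have "\<dots> = R powr real (2 ^ (?d - 1))" using npos by simp
      also have "\<dots> = R ^ (2 ^ (?d - 1))" using R(2) by (rule powr_realpow)
      finally show ?thesis .
    qed
    moreover have "((2 ^ (2 ^ card M)) ^ ?d) ^ (2 ^ (?d - 1)) = (((2::real) ^ (2 ^ card M)) ^ (2 ^ (?d - 1))) ^ ?d"
      by (simp only: power_mult[symmetric] mult_ac)
    ultimately show ?thesis by (simp only: power_mult_distrib)
  qed
  finally show ?thesis using npos s0 by (subst (asm) power_mono_iff) auto
qed

text \<open>Seven weighted counts. Without a majority phase, the defects give each colouring a
  weight that exceeds the loss in Finner's inequality. With majority phase \<open>P\<close> but more
  than \<open>\<Theta>\<close> deviations, the tilt towards \<open>P\<close> reduces the loss to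
  \<open>exp Y\<close>, and each colouring has at least this weight, through its defects or through
  its nonexact stars.\<close>

lemma dense_colourings_le:
  fixes \<omega> u F \<delta> \<gamma> :: real
  assumes r: "real r + 1 \<le> 2 ^ card M / 2" "4 * r < 2 ^ card M"
    and F: "real (card {\<sigma>\<in>colourings M. flat M r \<sigma>}) \<le> F" and \<omega>: "\<omega> \<ge> 38416"
    and h1: "\<omega> * F \<le> \<delta> * 2 ^ (2 ^ (card M - 1))"
    and h2: "\<omega> * F * 2 ^ (2 ^ (card M - 1) + r) \<le> 2 ^ (2 ^ card M) / 20"
    and h3: "\<omega> * \<omega> * (3 / 4) powr ((real r + 1) / card M) \<le> \<gamma>"
    and u: "u = \<omega> powr (- (1 / 2))" and \<delta>: "\<delta> \<ge> 0" "2 * card D * \<delta> \<le> u"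
    and k1: "6 ^ (2 ^ card M) * (9 / 10) ^ card D \<le> u" and k2: "6 ^ (2 ^ card M) * \<gamma> ^ card D \<le> u"
    and \<Theta>: "143 * 2 ^ (card D + card M) * u < real \<Theta> + 1"
  shows "real (card {c\<in>colourings (D \<union> M). \<forall>p a. card {x\<in>parity_class (D \<union> M) p. c x \<noteq> a} > \<Theta>})
    \<le> 7 * 2 ^ (2 ^ (card D + card M - 1))"
proof -
  let ?d = "card D" and ?n = "card D + card M"
  let ?X = "(2::real) ^ (2 ^ (?n - 1))"
  have d0: "real ?d > 0" using npos by simp
  have \<omega>1: "\<omega> \<ge> 1" using \<omega> by simp
  have u0: "u > 0" "u \<le> 1"
    using \<omega>1 unfolding u by (auto simp: powr_minus_divide ge_one_powr_ge_zero)
  have \<gamma>0: "\<gamma> \<ge> 0"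
  proof -
    have "0 \<le> \<omega> * \<omega> * (3 / 4) powr ((real r + 1) / card M)" using \<omega>1 by simp
    then show ?thesis using h3 by linarith
  qed
  have \<delta>p: "(1 + \<delta>) ^ ?d \<le> 1 + u"
  proof -
    have "(1 + \<delta>) ^ ?d \<le> exp \<delta> ^ ?d" using \<delta> exp_ge_add_one_self[of \<delta>] by (intro power_mono) auto
    also have "\<dots> = exp (?d * \<delta>)" by (simp add: exp_of_nat_mult)
    also have "\<dots> \<le> 1 + ?d * \<delta> + (?d * \<delta>)\<^sup>2"
      using \<delta> u0 by (intro exp_bound) auto
    also have "\<dots> \<le> 1 + ?d * \<delta> + (?d * \<delta>)"
    proof -
      have "0 \<le> ?d * \<delta>" "?d * \<delta> \<le> 1" using \<delta> u0 by auto
      then have "(?d * \<delta>) * (?d * \<delta>) \<le> ?d * \<delta>" by (intro mult_left_le) auto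
      then show ?thesis by (simp only: power2_eq_square add_left_mono)
    qed
    also have "\<dots> = 1 + 2 * ?d * \<delta>" by simp
    finally show ?thesis using \<delta>(2) by linarith
  qed
  have finC: "finite (colourings (D \<union> M))" using finD finM by (intro finite_colourings) auto
  have Bne: "compatible (slices c) w \<noteq> {}" if "c \<in> colourings (D \<union> M)" "w \<in> Vo" for c w
    using slice_compatible[OF that] by blast
  let ?t = "\<lambda>c. real (card (bad_stars r (slices c))) + card (flat_slices r (slices c))"
  let ?C1 = "{c\<in>colourings (D \<union> M). \<forall>P. real (card (phase_region r (slices c) P)) \<le> 2 ^ ?d / 2}"
  let ?C2 = "\<lambda>P. {c\<in>colourings (D \<union> M). real (card (phase_region r (slices c) P)) > 2 ^ ?d / 2 \<and>
    card {x\<in>parity_class (D \<union> M) (fst P). c x \<noteq> snd P} > \<Theta>}"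
  have C1: "real (card ?C1) \<le> ?X"
  proof -
    let ?P = "(True, 0 :: 3)"
    let ?star_weight = "\<lambda>c. star_weight (flat M r) (star_reward M r ?P 1 1 \<omega>) (root ?d \<omega>) (slices c)"
    have "star_total (flat M r) (star_reward M r ?P 1 1 \<omega>) \<omega> \<le> (2 ^ (2 ^ card M)) ^ ?d *
      ((1 + 5 * 1 ^ ?d) * (1 + \<delta>) ^ ?d + 6 ^ (2 ^ card M) * ((4 / 5 * 1) ^ ?d + \<gamma> ^ ?d))"
      by (rule star_total_le[OF r F]) (use \<omega>1 h1 h2 h3 in auto)
    also have "\<dots> \<le> (2 ^ (2 ^ card M)) ^ ?d * 14"
    proof (rule mult_left_mono)
      have "(4 / 5 :: real) ^ ?d \<le> (9 / 10) ^ ?d" by (intro power_mono) auto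
      then have "6 ^ (2 ^ card M) * (4 / 5 :: real) ^ ?d \<le> 6 ^ (2 ^ card M) * (9 / 10) ^ ?d" by simp
      moreover have "(1 + 5 * 1 ^ ?d) * (1 + \<delta>) ^ ?d + 6 ^ (2 ^ card M) * ((4 / 5 * 1) ^ ?d + \<gamma> ^ ?d)
        = 6 * (1 + \<delta>) ^ ?d + (6 ^ (2 ^ card M) * (4 / 5) ^ ?d + 6 ^ (2 ^ card M) * \<gamma> ^ ?d)"
        by (simp add: distrib_left)
      ultimately show "(1 + 5 * 1 ^ ?d) * (1 + \<delta>) ^ ?d + 6 ^ (2 ^ card M) * ((4 / 5 * 1) ^ ?d + \<gamma> ^ ?d) \<le> 14"
        using \<delta>p k1 k2 u0 by linarith
    qed simp
    also have "\<dots> \<le> (2 ^ (2 ^ card M)) ^ ?d * (\<omega> powr (1 / 4))"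
    proof (rule mult_left_mono)
      \<comment> \<open>38416 is \<open>14 ^ 4\<close>, and 14 is 6 * 2 + 2. The exponent 1 / 4 is
        exactly the one that turns the loss into the reward of \<open>2 ^ d / (8 * d)\<close>
        defects for \<open>d = card D\<close>, the number guaranteed by
        \<open>no_majority\<close>.\<close>
      have "(14::real) = (14 powr 4) powr (1 / 4)" by (simp add: powr_powr)
      also have "\<dots> \<le> \<omega> powr (1 / 4)" using \<omega> by (intro powr_mono2) auto
      finally show "(14::real) \<le> \<omega> powr (1 / 4)" .
    qed simp
    finally have T: "star_total (flat M r) (star_reward M r ?P 1 1 \<omega>) \<omega> \<le> (2 ^ (2 ^ card M)) ^ ?d * (\<omega> powr (1 / 4))" .
    have S: "(\<Sum>c\<in>colourings (D \<union> M). ?star_weight c) \<le> ?X * (\<omega> powr (1 / 4)) powr (2 ^ (?d - 1) / ?d)"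
      by (rule sum_star_weight_le_powr[OF _ _ _ _ T]) (use \<omega>1 in auto)
    have W0: "?star_weight c \<ge> 0" for c
      unfolding star_weight_def using \<omega>1 by (intro prod_nonneg) (auto simp: star_reward_def real_root_ge_zero)
    have low: "\<omega> powr (2 ^ ?d / (8 * ?d)) \<le> ?star_weight c" if c: "c \<in> ?C1" for c
    proof -
      have "2 ^ ?d \<le> 8 * ?d * ?t c" using c Bne by (intro no_majority[OF r(2)]) auto
      then have "2 ^ ?d / (8 * ?d) \<le> ?t c" using d0 by (simp add: divide_le_eq mult_ac)
      then have "\<omega> powr (2 ^ ?d / (8 * ?d)) \<le> \<omega> powr (?t c)" using \<omega>1 by (intro powr_mono) auto
      also have "\<dots> = \<omega> ^ (card (bad_stars r (slices c)) + card (flat_slices r (slices c)))"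
        using \<omega>1 by (simp flip: powr_realpow)
      also have "\<dots> \<le> ?star_weight c" using star_weight_ge[where \<omega> = \<omega> and z = 1 and e = 1 and r = r and f = "slices c" and ?P0.0 = ?P] \<omega>1 by simp
      finally show ?thesis .
    qed
    have "real (card ?C1) * \<omega> powr (2 ^ ?d / (8 * ?d)) = (\<Sum>c\<in>?C1. \<omega> powr (2 ^ ?d / (8 * ?d)))" by simp
    also have "\<dots> \<le> (\<Sum>c\<in>?C1. ?star_weight c)" by (intro sum_mono low)
    also have "\<dots> \<le> (\<Sum>c\<in>colourings (D \<union> M). ?star_weight c)" using finC W0 by (intro sum_mono2) auto
    also have "\<dots> \<le> ?X * (\<omega> powr (1 / 4)) powr (2 ^ (?d - 1) / ?d)" by (rule S)
    also have "(\<omega> powr (1 / 4)) powr (2 ^ (?d - 1) / ?d) = \<omega> powr (2 ^ ?d / (8 * ?d))"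
    proof -
      have "(2::real) ^ ?d = 2 * 2 ^ (?d - 1)" using npos by (cases "?d") auto
      then have "1 / 4 * (2 ^ (?d - 1) / ?d) = (2::real) ^ ?d / (8 * ?d)" by simp
      then show ?thesis by (simp only: powr_powr)
    qed
    finally show ?thesis using \<omega>1 by simp
  qed
  have C2: "real (card (?C2 P)) \<le> ?X" for P
  proof -
    \<comment> \<open>Small enough that \<open>4 / 5 * (9 / 8) = 9 / 10\<close> keeps nonconstant
      labels negligible, large enough that its logarithm is at least 1 / 9.\<close>
    let ?e = "9 / 8 :: real"
    \<comment> \<open>A penalty of \<open>\<omega> powr (- 1 / 2)\<close> for every
      \<open>card D\<close> stars. By \<open>majority\<close>, \<open>t\<close> defects permit at
      most \<open>card D * t\<close> stars outside the phase, so at least half of the reward for the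
      defects survives.\<close>
    define z where "z = \<omega> powr (- (1 / (2 * ?d)))"
    have z: "0 < z" "z \<le> 1"
    proof -
      show "0 < z" using \<omega>1 by (simp add: z_def)
      have "z \<le> \<omega> powr 0" unfolding z_def using \<omega>1 d0 by (intro powr_mono) auto
      then show "z \<le> 1" using \<omega>1 by simp
    qed
    have zd: "z ^ ?d = u"
    proof -
      have "z ^ ?d = z powr ?d" using z by (simp add: powr_realpow)
      also have "\<dots> = \<omega> powr (- (1 / (2 * ?d)) * ?d)" by (simp add: z_def powr_powr)
      also have "- (1 / (2 * ?d)) * ?d = - (1 / 2 :: real)" using d0 by simp
      finally show ?thesis by (simp add: u)
    qed
    let ?star_weight = "\<lambda>c. star_weight (flat M r) (star_reward M r P z ?e \<omega>) (root ?d \<omega>) (slices c)"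
    define Y where "Y = 13 * u * (2 ^ (?d - 1) / ?d)"
    have Y0: "Y \<ge> 0" using u0 by (simp add: Y_def)
    have "star_total (flat M r) (star_reward M r P z ?e \<omega>) \<omega> \<le> (2 ^ (2 ^ card M)) ^ ?d *
      ((1 + 5 * z ^ ?d) * (1 + \<delta>) ^ ?d + 6 ^ (2 ^ card M) * ((4 / 5 * ?e) ^ ?d + \<gamma> ^ ?d))"
      by (rule star_total_le[OF r F]) (use \<omega>1 h1 h2 h3 z in auto)
    also have "\<dots> \<le> (2 ^ (2 ^ card M)) ^ ?d * (1 + 13 * u)"
    proof (rule mult_left_mono)
      have "(1 + 5 * z ^ ?d) * (1 + \<delta>) ^ ?d \<le> (1 + 5 * u) * (1 + u)"
        unfolding zd using \<delta>p u0 by (intro mult_left_mono) auto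
      also have "\<dots> = 1 + 6 * u + 5 * (u * u)" by (simp add: algebra_simps)
      also have "\<dots> \<le> 1 + 11 * u" using u0 mult_left_le[of u u] by linarith
      finally have "(1 + 5 * z ^ ?d) * (1 + \<delta>) ^ ?d \<le> 1 + 11 * u" .
      moreover have "6 ^ (2 ^ card M) * ((4 / 5 * ?e) ^ ?d + \<gamma> ^ ?d) \<le> u + u"
        unfolding distrib_left using k1 k2 by (intro add_mono) auto
      ultimately show "(1 + 5 * z ^ ?d) * (1 + \<delta>) ^ ?d + 6 ^ (2 ^ card M) * ((4 / 5 * ?e) ^ ?d + \<gamma> ^ ?d) \<le> 1 + 13 * u"
        by linarith
    qed simp
    finally have T: "star_total (flat M r) (star_reward M r P z ?e \<omega>) \<omega> \<le> (2 ^ (2 ^ card M)) ^ ?d * (1 + 13 * u)" .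
    have S: "(\<Sum>c\<in>colourings (D \<union> M). ?star_weight c) \<le> ?X * (1 + 13 * u) powr (2 ^ (?d - 1) / ?d)"
      by (rule sum_star_weight_le_powr[OF \<omega>1 z _ T]) (use u0 in auto)
    also have "\<dots> \<le> ?X * exp Y"
    proof (rule mult_left_mono)
      have "(1 + 13 * u) powr (2 ^ (?d - 1) / ?d) \<le> exp (13 * u) powr (2 ^ (?d - 1) / ?d)"
        using u0 exp_ge_add_one_self[of "13 * u"] by (intro powr_mono2) auto
      also have "\<dots> = exp Y" by (simp add: Y_def exp_powr_real)
      finally show "(1 + 13 * u) powr (2 ^ (?d - 1) / ?d) \<le> exp Y" .
    qed simp
    finally have S': "(\<Sum>c\<in>colourings (D \<union> M). ?star_weight c) \<le> ?X * exp Y" .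
    have W0: "?star_weight c \<ge> 0" for c
      unfolding star_weight_def using \<omega>1 z by (intro prod_nonneg) (auto simp: star_reward_def real_root_ge_zero)
    have low: "exp Y \<le> ?star_weight c" if c: "c \<in> ?C2 P" for c
    proof -
      let ?f = "slices c"
      let ?s = "card {w\<in>Vo. \<not> phased M r (star_label ?f w) P}" and ?N = "card (nonexact ?f P)"
      have cC: "c \<in> colourings (D \<union> M)" using c by auto
      have st: "real ?s \<le> ?d * ?t c" using c Bne[OF cC] by (intro majority[OF r(2)]) auto
      \<comment> \<open>The 143 in the hypothesis on \<open>\<Theta>\<close> is 11 * 13: 13 from
        \<open>Y\<close>, and 11 from \<open>2 * d + 9 \<le> 11 * d\<close> for
        \<open>d = card D\<close>.\<close>
      have N: "real ?N > (2 * ?d + 9) * Y"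
      proof -
        have "\<Theta> < 2 * ?N * 2 ^ card M" using deviations_le[OF cC, of "fst P" "snd P"] c by simp
        then have "real \<Theta> + 1 \<le> real (2 * ?N * 2 ^ card M)" by linarith
        then have "143 * 2 ^ ?n * u < 2 * real ?N * 2 ^ card M" using \<Theta> by simp
        then have "143 * 2 ^ ?d * u < 2 * real ?N" by (simp add: power_add)
        moreover have "2 * ((2 * ?d + 9) * Y) \<le> 143 * 2 ^ ?d * u"
        proof -
          have "(2::real) ^ ?d = 2 * 2 ^ (?d - 1)" using npos by (cases "?d") auto
          then have Yd: "?d * (2 * Y) = 13 * u * 2 ^ ?d" using d0 by (simp add: Y_def)
          have "1 \<le> real ?d" using npos by linarith
          then have "(2 * ?d + 9) * (2 * Y) \<le> (11 * ?d) * (2 * Y)" using Y0 by (intro mult_right_mono) auto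
          also have "\<dots> = 11 * (13 * u * 2 ^ ?d)" unfolding Yd[symmetric] by simp
          finally show ?thesis by (simp add: mult_ac)
        qed
        ultimately show ?thesis by linarith
      qed
      have "Y \<le> ?t c / 2 * ln \<omega> + real (?N - ?s) * ln ?e"
      proof -
        have w1: "ln \<omega> \<ge> 1"
        proof -
          have "exp 1 \<le> \<omega>" using exp_le \<omega> by linarith
          then show ?thesis using \<omega>1 by (simp add: ln_ge_iff)
        qed
        then have 1: "?t c / 2 * 1 \<le> ?t c / 2 * ln \<omega>" by (intro mult_left_mono) auto
        have e9: "ln ?e \<ge> 1 / 9"
        proof -
          have "ln (8 / 9 :: real) \<le> 8 / 9 - 1" by (intro ln_le_minus_one) auto
          moreover have "ln (8 / 9 :: real) = - ln ?e" by (simp add: ln_div)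
          ultimately show ?thesis by simp
        qed
        then have 2: "real (?N - ?s) * (1 / 9) \<le> real (?N - ?s) * ln ?e" by (intro mult_left_mono) auto
        have 3: "real (?N - ?s) \<ge> real ?N - real ?s" by linarith
        \<comment> \<open>Either there are \<open>2 * Y\<close> defects and the surviving half of
          their reward suffices, or there are so few that at least \<open>9 * Y\<close> nonexact
          stars of the phase remain, each worth a ninth.\<close>
        show ?thesis
        proof (cases "?t c \<ge> 2 * Y")
          case True
          have "Y \<le> ?t c / 2 * 1" using True by simp
          then have "Y \<le> ?t c / 2 * ln \<omega>" using 1 by (rule order.trans)
          moreover have "0 \<le> real (?N - ?s) * ln ?e" using e9 by (intro mult_nonneg_nonneg) auto
          ultimately show ?thesis by (rule add_increasing2[rotated])
        next
          case False
          then have "?d * ?t c \<le> ?d * (2 * Y)" by (intro mult_left_mono) auto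
          then have "real ?N - real ?s \<ge> 9 * Y" using N st by (simp add: algebra_simps)
          then have "Y \<le> real (?N - ?s) * (1 / 9)" using 3 by linarith
          then have "Y \<le> real (?N - ?s) * ln ?e" using 2 by (rule order.trans)
          moreover have "0 \<le> ?t c / 2 * ln \<omega>" using w1 by (intro mult_nonneg_nonneg) auto
          ultimately show ?thesis by (rule add_increasing[rotated])
        qed
      qed
      also have "?t c / 2 * ln \<omega> + real (?N - ?s) * ln ?e
        \<le> ?t c * ln \<omega> + real ?s * ln z + real (?N - ?s) * ln ?e"
      proof -
        have "real ?s * (ln \<omega> / (2 * ?d)) \<le> (?d * ?t c) * (ln \<omega> / (2 * ?d))"
          using st \<omega>1 d0 by (intro mult_right_mono) auto
        also have "\<dots> = ?t c / 2 * ln \<omega>" using d0 by (simp add: field_simps)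
        finally have "real ?s * (ln \<omega> / (2 * ?d)) \<le> ?t c / 2 * ln \<omega>" .
        moreover have "ln z = - (ln \<omega> / (2 * ?d))" using \<omega>1 by (simp add: z_def ln_powr)
        then have "real ?s * ln z = - (real ?s * (ln \<omega> / (2 * ?d)))" by simp
        moreover have "?t c * ln \<omega> = ?t c / 2 * ln \<omega> + ?t c / 2 * ln \<omega>"
          by (simp only: distrib_right[symmetric] field_sum_of_halves)
        ultimately have "?t c / 2 * ln \<omega> \<le> ?t c * ln \<omega> + real ?s * ln z" by linarith
        then show ?thesis by (rule add_right_mono)
      qed
      finally have "exp Y \<le> exp (?t c * ln \<omega> + real ?s * ln z + real (?N - ?s) * ln ?e)" by simp
      also have "\<dots> = \<omega> ^ (card (bad_stars r ?f) + card (flat_slices r ?f)) * z ^ ?s * ?e ^ (?N - ?s)"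
      proof -
        have "?t c = real (card (bad_stars r ?f) + card (flat_slices r ?f))" by simp
        moreover have "exp (real k * ln x) = x ^ k" if "x > 0" for k and x :: real
          using that by (simp add: exp_of_nat_mult)
        ultimately show ?thesis using \<omega>1 z by (simp only: exp_add)
      qed
      also have "\<dots> \<le> ?star_weight c" by (rule star_weight_ge) (use \<omega>1 z in auto)
      finally show ?thesis .
    qed
    have "real (card (?C2 P)) * exp Y = (\<Sum>c\<in>?C2 P. exp Y)" by simp
    also have "\<dots> \<le> (\<Sum>c\<in>?C2 P. ?star_weight c)" by (intro sum_mono low)
    also have "\<dots> \<le> (\<Sum>c\<in>colourings (D \<union> M). ?star_weight c)" using finC W0 by (intro sum_mono2) auto
    also have "\<dots> \<le> ?X * exp Y" by (rule S')
    finally show ?thesis by simp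
  qed
  let ?bad = "{c\<in>colourings (D \<union> M). \<forall>p a. card {x\<in>parity_class (D \<union> M) p. c x \<noteq> a} > \<Theta>}"
  have "?bad \<subseteq> ?C1 \<union> (\<Union>P\<in>UNIV. ?C2 P)" by (auto simp: not_le)
  then have "card ?bad \<le> card (?C1 \<union> (\<Union>P\<in>UNIV. ?C2 P))" using finC by (intro card_mono) auto
  also have "\<dots> \<le> card ?C1 + (\<Sum>P\<in>UNIV. card (?C2 P))"
    using card_Un_le[of ?C1 "\<Union>P\<in>UNIV. ?C2 P"] card_UN_le[of UNIV ?C2] by simp
  finally have "real (card ?bad) \<le> real (card ?C1 + (\<Sum>P\<in>UNIV. card (?C2 P)))" by (simp only: of_nat_le_iff)
  also have "\<dots> = real (card ?C1) + (\<Sum>P\<in>UNIV. real (card (?C2 P)))" by simp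
  also have "\<dots> \<le> ?X + (\<Sum>P\<in>(UNIV :: (bool \<times> 3) set). ?X)" by (intro add_mono C1 sum_mono C2)
  finally show ?thesis by simp
qed

end

section \<open>Sign patterns and colourings\<close>

text \<open>With \<open>t K\<close> the sign \<open>s K\<close> twisted by \<open>(-1)\<close> to the power \<open>card K div 2\<close>, admissibility says that
  every square of the cube has a diagonal on which \<open>t\<close> is constant.  Reading \<open>t\<close> as the residue mod 4 of a
  height function that changes by one along every edge, this is exactly closedness of the
  increments; the heights mod 3 form a proper colouring.\<close>

definition twist :: "('a set \<Rightarrow> sign) \<Rightarrow> 'a set \<Rightarrow> bool" where
  "twist s K \<longleftrightarrow> (s K = Plus) = even (card K div 2)"

text \<open>Read a true twist as height 0 on even and 1 on odd levels, a false one as 2 and 3. The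
  change mod 4 from \<open>K\<close> to \<open>insert i K\<close> is then 1 or -1, and this is it,
  taken mod 3.\<close>

definition height_step :: "('a set \<Rightarrow> sign) \<Rightarrow> 'a \<Rightarrow> 'a set \<Rightarrow> 3" where
  "height_step s i K = (if (twist s K = twist s (insert i K)) = even (card K) then 1 else - 1)"

lemma three_neq: "(1 :: 3) \<noteq> - 1" "(0 :: 3) \<noteq> 1" "(0 :: 3) \<noteq> - 1" "(1 :: 3) \<noteq> 0" "(- 1 :: 3) \<noteq> 0" "(- 1 :: 3) \<noteq> 1"
proof -
  have o: "(1 :: 3) \<noteq> 0" "(1 :: 3) \<noteq> - 1" by simp_all
  show "(1 :: 3) \<noteq> - 1" "(1 :: 3) \<noteq> 0" using o by auto
  show "(0 :: 3) \<noteq> 1" "(- 1 :: 3) \<noteq> 1" using o by metis+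
  show "(- 1 :: 3) \<noteq> 0" "(0 :: 3) \<noteq> - 1" using o(1) by (metis neg_equal_0_iff_equal)+
qed

lemma sign_cases: "x = Plus \<or> x = Minus" for x :: sign
  by (cases x) auto

text \<open>The parity of half the cardinality changes from \<open>K\<close> to the top of the
  square and agrees on the two middle sets. So the twist turns the inequality of signs on one
  diagonal into an equality and leaves the other diagonal as it is.\<close>

lemma twist_square:
  assumes adm: "admissible N s" and N: "finite N" and i: "i \<in> N" and j: "j \<in> N" and ij: "i \<noteq> j"
    and K: "K \<subseteq> N - {i, j}"
  shows "twist s (insert i K) = twist s (insert j K) \<or> twist s K = twist s (insert i (insert j K))"
proof -
  have finK: "finite K" using K N finite_subset by blast
  have c: "card (insert i K) = Suc (card K)" "card (insert j K) = Suc (card K)"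
    "card (insert i (insert j K)) = Suc (Suc (card K))"
    using finK K ij by (auto simp: subset_iff card_insert_if)
  have "s (K \<union> {i}) \<noteq> s (K \<union> {j}) \<longrightarrow> s K \<noteq> s (K \<union> {i, j})"
    using adm i j ij K unfolding admissible_def by blast
  then have "s (insert i K) = s (insert j K) \<or> s K \<noteq> s (insert i (insert j K))" by auto
  then show ?thesis
    using sign_cases[of "s K"] sign_cases[of "s (insert i (insert j K))"]
    unfolding twist_def c by auto
qed

lemma height_step_square:
  assumes adm: "admissible N s" and N: "finite N" and i: "i \<in> N" and j: "j \<in> N" and ij: "i \<noteq> j"
    and K: "K \<subseteq> N - {i, j}"
  shows "height_step s i K + height_step s j (insert i K) = height_step s j K + height_step s i (insert j K)"
proof -
  have finK: "finite K" using K N finite_subset by blast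
  have c: "card (insert i K) = Suc (card K)" "card (insert j K) = Suc (card K)"
    using finK K ij by (auto simp: subset_iff card_insert_if)
  have e: "insert j (insert i K) = insert i (insert j K)" by auto
  show ?thesis
    using twist_square[OF assms] unfolding height_step_def c e
    by (cases "twist s K"; cases "twist s (insert i K)"; cases "twist s (insert j K)";
        cases "twist s (insert i (insert j K))"; cases "even (card K)") auto
qed

text \<open>The steps are added up along the path that inserts the elements in increasing order;
  \<open>height_insert\<close> shows that the order does not matter.\<close>

definition height :: "(nat set \<Rightarrow> sign) \<Rightarrow> nat set \<Rightarrow> 3" where
  "height s K = (\<Sum>i\<in>K. height_step s i {j\<in>K. j < i})"

text \<open>An element above all others is the last step of the path. Otherwise the maximum
  \<open>m\<close> is removed, the induction hypothesis inserts \<open>i\<close>, and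
  \<open>height_step_square\<close> exchanges the last two steps.\<close>

lemma height_insert:
  assumes adm: "admissible {..<n} s"
  shows "K \<subseteq> {..<n} \<Longrightarrow> i < n \<Longrightarrow> i \<notin> K \<Longrightarrow> height s (insert i K) = height s K + height_step s i K"
proof (induction "card K" arbitrary: K i rule: less_induct)
  case less
  have finK: "finite K" using less.prems finite_subset by blast
  show ?case
  proof (cases "\<exists>j\<in>K. j > i")
    case False
    then have lt: "j < i" if "j \<in> K" for j using that less.prems by (metis linorder_neqE_nat)
    have "{j\<in>insert i K. j < i} = K" using lt by auto
    moreover have "{j\<in>insert i K. j < l} = {j\<in>K. j < l}" if "l \<in> K" for l using lt[OF that] by auto
    ultimately show ?thesis
      unfolding height_def using finK less.prems by (simp add: add.commute cong: sum.cong)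
  next
    case True
    define m where "m = Max K"
    have mK: "m \<in> K" "i < m" "\<And>j. j \<in> K \<Longrightarrow> j \<le> m"
    proof -
      have ne: "K \<noteq> {}" using True by blast
      then show "m \<in> K" "\<And>j. j \<in> K \<Longrightarrow> j \<le> m" using finK unfolding m_def by auto
      then show "i < m" using True by fastforce
    qed
    define K' where "K' = K - {m}"
    have K': "K = insert m K'" "m \<notin> K'" "i \<notin> K'" "K' \<subseteq> {..<n}" "card K' < card K" "finite K'"
      using mK(1) less.prems finK card_Diff1_less[OF finK mK(1)] unfolding K'_def by auto
    have lt: "j < m" if "j \<in> K'" for j using mK(3)[of j] that K' by (metis insertCI nless_le)
    have top: "height s (insert m A) = height s A + height_step s m A" if "finite A" "\<And>j. j \<in> A \<Longrightarrow> j < m" for A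
    proof -
      have "m \<notin> A" using that by blast
      moreover have "{j\<in>insert m A. j < m} = A" using that by auto
      moreover have "{j\<in>insert m A. j < l} = {j\<in>A. j < l}" if "l \<in> A" for l using \<open>\<And>j. j \<in> A \<Longrightarrow> j < m\<close>[OF that] by auto
      ultimately show ?thesis unfolding height_def using that by (simp add: add.commute cong: sum.cong)
    qed
    have "m < n" using mK(1) less.prems by auto
    have IH: "height s (insert i K') = height s K' + height_step s i K'"
      using less.hyps[OF K'(5,4) less.prems(2) K'(3)] .
    have "height s (insert i K) = height s (insert m (insert i K'))" by (simp add: K'(1) insert_commute)
    also have "\<dots> = height s (insert i K') + height_step s m (insert i K')"
      using K'(6) lt mK(2) by (intro top) auto
    also have "\<dots> = height s K' + (height_step s i K' + height_step s m (insert i K'))" by (simp add: IH add.assoc)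
    also have "height_step s i K' + height_step s m (insert i K') = height_step s m K' + height_step s i (insert m K')"
      using less.prems \<open>m < n\<close> mK(2) K' by (intro height_step_square[OF adm]) auto
    also have "height s K' + (height_step s m K' + height_step s i (insert m K')) = height s (insert m K') + height_step s i K"
      using top[of K'] K' lt by (simp add: add.assoc)
    finally show ?thesis by (simp add: K'(1))
  qed
qed

lemma height_step_eq_1_iff: "height_step s i K = 1 \<longleftrightarrow> (twist s K = twist s (insert i K)) = even (card K)"
  using three_neq by (simp add: height_step_def)

text \<open>Steps are nonzero mod 3, so heights form a proper colouring. Conversely 1 and -1 differ
  mod 3, so the heights determine all steps and with them the twist, starting from the fixed sign at
  the empty set.\<close>

lemma num_admissible_le: "num_admissible n \<le> card (colourings {..<n})"
  unfolding num_admissible_def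
proof (rule card_inj_on_le[where f = "\<lambda>s. restrict (height s) (Pow {..<n})"])
  show "finite (colourings {..<n})" by (rule finite_colourings) simp
  show "(\<lambda>s. restrict (height s) (Pow {..<n})) ` admissible_patterns {..<n} \<subseteq> colourings {..<n}"
  proof (intro image_subsetI)
    fix s assume "s \<in> admissible_patterns {..<n}"
    then have adm: "admissible {..<n} s" by (simp add: admissible_patterns_def)
    have ne: "height s (flip i x) \<noteq> height s x" if x: "x \<subseteq> {..<n}" and i: "i < n" for i x
    proof (cases "i \<in> x")
      case True
      then have "height s (insert i (x - {i})) = height s (x - {i}) + height_step s i (x - {i})"
        using x i by (intro height_insert[OF adm]) auto
      moreover have "insert i (x - {i}) = x" using True by auto
      moreover have "height_step s i (x - {i}) \<noteq> 0" using three_neq by (simp add: height_step_def)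
      ultimately show ?thesis using True by (auto simp: flip_def)
    next
      case False
      then have "height s (insert i x) = height s x + height_step s i x" using x i by (intro height_insert[OF adm]) auto
      moreover have "height_step s i x \<noteq> 0" using three_neq by (simp add: height_step_def)
      ultimately show ?thesis using False by (simp add: flip_def)
    qed
    show "restrict (height s) (Pow {..<n}) \<in> colourings {..<n}"
      using ne by (simp add: colourings_def)
  qed
  show "inj_on (\<lambda>s. restrict (height s) (Pow {..<n})) (admissible_patterns {..<n})"
  proof (rule inj_onI)
    fix s t assume s: "s \<in> admissible_patterns {..<n}" and t: "t \<in> admissible_patterns {..<n}"
      and e: "restrict (height s) (Pow {..<n}) = restrict (height t) (Pow {..<n})"
    have adm: "admissible {..<n} s" "admissible {..<n} t" using s t by (auto simp: admissible_patterns_def)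
    have h: "height s K = height t K" if "K \<subseteq> {..<n}" for K using fun_cong[OF e, of K] that by simp
    have twist: "twist s K = twist t K" if "K \<subseteq> {..<n}" for K
    proof -
      have "finite K" using that finite_subset by blast
      then show ?thesis using that
      proof (induction K rule: finite_induct)
        case empty
        show ?case using adm by (simp add: twist_def admissible_def)
      next
        case (insert i K)
        have "height s (insert i K) = height s K + height_step s i K" "height t (insert i K) = height t K + height_step t i K"
          using insert by (auto intro!: height_insert adm)
        then have "height_step s i K = height_step t i K" using h[of K] h[of "insert i K"] insert.prems by simp
        then show ?case using height_step_eq_1_iff[of s i K] height_step_eq_1_iff[of t i K] insert.IH insert.prems by auto
      qed
    qed
    have "s K = t K" if "K \<subseteq> {..<n}" for K
      using twist[OF that] sign_cases[of "s K"] sign_cases[of "t K"] unfolding twist_def by auto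
    then show "s = t"
      using s t unfolding admissible_patterns_def sign_patterns_def
      by (intro PiE_ext[of s "Pow {..<n}" "\<lambda>_. UNIV"]) auto
  qed
qed

text \<open>On even levels the signs are fixed so that they alternate between consecutive even levels;
  the signs on odd levels are then arbitrary.\<close>

lemma num_admissible_ge:
  assumes n: "n \<ge> 1"
  shows "2 ^ (2 ^ (n - 1)) \<le> num_admissible n"
proof -
  let ?O = "parity_class {..<n} False"
  let ?P = "PiE ?O (\<lambda>_. UNIV :: sign set)"
  let ?f = "\<lambda>g. \<lambda>K\<in>Pow {..<n}. if odd (card K) then g K else if even (card K div 2) then Plus else Minus"
  have finO: "finite ?O" by (rule finite_parity_class) simp
  have U: "(UNIV :: sign set) = {Plus, Minus}" using sign.exhaust by auto
  have "card ?P = card (UNIV :: sign set) ^ card ?O" using finO by (simp add: card_PiE)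
  also have "card ?O = 2 ^ (n - 1)" using n card_parity_class[of "{..<n}" False] by (simp add: lessThan_empty_iff)
  also have "card (UNIV :: sign set) = 2" unfolding U by simp
  finally have "2 ^ (2 ^ (n - 1)) = card ?P" by simp
  also have "\<dots> \<le> num_admissible n"
    unfolding num_admissible_def
  proof (rule card_inj_on_le[where f = ?f])
    show "finite (admissible_patterns {..<n})" by (rule finite_admissible_patterns) simp
    show "inj_on ?f ?P"
    proof (rule inj_onI)
      fix g h assume g: "g \<in> ?P" and h: "h \<in> ?P" and e: "?f g = ?f h"
      have "g K = h K" if "K \<in> ?O" for K
        using fun_cong[OF e, of K] that by (simp add: parity_class_def)
      then show "g = h" using g h by (intro PiE_ext[of g ?O "\<lambda>_. UNIV"]) auto
    qed
    show "?f ` ?P \<subseteq> admissible_patterns {..<n}"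
    proof (intro image_subsetI)
      fix g
      have "admissible {..<n} (?f g)"
        unfolding admissible_def
      proof (intro conjI ballI allI impI)
        show "?f g {} = Plus" by simp
        fix i j K assume i: "i \<in> {..<n}" and j: "j \<in> {..<n}" and ij: "i \<noteq> j" and K: "K \<subseteq> {..<n} - {i, j}"
          and ne: "?f g (K \<union> {i}) \<noteq> ?f g (K \<union> {j})"
        have finK: "finite K" using K finite_subset by blast
        have c: "card (K \<union> {i}) = Suc (card K)" "card (K \<union> {j}) = Suc (card K)"
          "card (K \<union> {i, j}) = Suc (Suc (card K))"
          using finK K ij by (auto simp: subset_iff card_insert_if)
        have sub: "K \<union> {i} \<in> Pow {..<n}" "K \<union> {j} \<in> Pow {..<n}" "K \<union> {i, j} \<in> Pow {..<n}" "K \<in> Pow {..<n}"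
          using i j K by auto
        have "even (card K)"
        proof (rule ccontr)
          assume "odd (card K)"
          then show False using ne unfolding restrict_apply'[OF sub(1)] restrict_apply'[OF sub(2)] c by simp
        qed
        then show "?f g K \<noteq> ?f g (K \<union> {i, j})"
          unfolding restrict_apply'[OF sub(3)] restrict_apply'[OF sub(4)] c by simp
      qed
      then show "?f g \<in> admissible_patterns {..<n}"
        by (simp add: admissible_patterns_def sign_patterns_def)
    qed
  qed
  finally show ?thesis .
qed

section \<open>Asymptotics\<close>

text \<open>\<open>L\<close> is the binary logarithm of the reward for a defect. It must exceed the
  order of the square root of \<open>n log n\<close>, for the polymer sum with
  \<open>q = L / 4\<close>, and stay well below \<open>n / log n\<close>, the loss of a label
  without dominant phase.\<close>

lemma log_bounds_eventually:
  defines "L \<equiv> \<lambda>n::nat. real n / (log 2 n)\<^sup>2"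
  shows "eventually (\<lambda>n. L n \<le> real n / 250 / 16) sequentially"
    and "eventually (\<lambda>n. 2 * real n \<le> 2 powr (9 / 32 * (n / 250))) sequentially"
    and "eventually (\<lambda>n. 2 * L n + 1 \<le> n / 750000 / log 2 n) sequentially"
    and "eventually (\<lambda>n. 38416 \<le> 2 powr L n) sequentially"
    and "eventually (\<lambda>n. 429 * real n \<le> 2 powr (L n / 4)) sequentially"
    and "eventually (\<lambda>n. log 2 n \<le> real n / 10) sequentially"
  unfolding L_def by real_asymp+

lemma sparse_bounds_eventually:
  defines "L \<equiv> \<lambda>n::nat. real n / (log 2 n)\<^sup>2"
  shows "eventually (\<lambda>n::nat. 3 + 36 * log 2 n + 4 * log 2 (3 * real n ^ 4) \<le> real n / 10) sequentially"
    and "eventually (\<lambda>n::nat. real n ^ 4 * 2 ^ n \<le> 2 powr (6 / 5 * n)) sequentially"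
    and "eventually (\<lambda>n. 24 \<le> L n / 4) sequentially"
    and "eventually (\<lambda>n. L n / 4 \<le> n / 2) sequentially"
    and "eventually (\<lambda>n. 32 * n * (1 + 12 * log 2 n) \<le> (L n / 4)\<^sup>2) sequentially"
  unfolding L_def by real_asymp+

lemma half_powr: "(1 / 2 :: real) powr x = 2 powr (- x)"
  by (simp add: powr_minus_divide powr_divide)

lemma card_colourings_le:
  fixes L :: real and n :: nat
  assumes n: "n \<ge> 50000"
    and E1: "L \<le> real n / 250 / 16"
    and E2: "2 * real n \<le> 2 powr (9 / 32 * (n / 250))"
    and E4': "2 * L + 1 \<le> n / 750000 / log 2 n"
    and E5: "38416 \<le> 2 powr L"
    and E6: "429 * real n \<le> 2 powr (L / 4)"
    and E7: "log 2 n \<le> real n / 10"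
    and S1: "3 + 36 * log 2 n + 4 * log 2 (3 * real n ^ 4) \<le> real n / 10"
    and S2: "real n ^ 4 * 2 ^ n \<le> 2 powr (6 / 5 * n)"
    and S3: "24 \<le> L / 4" "L / 4 \<le> n / 2" "32 * n * (1 + 12 * log 2 n) \<le> (L / 4)\<^sup>2"
  shows "real (card (colourings {..<n})) \<le> (7 + 6 * exp 10) * 2 ^ (2 ^ (n - 1))"
proof -
  \<comment> \<open>Slices have between \<open>n / 200\<close> and \<open>n / 100\<close> vertices:
    few enough for the \<open>6 ^ (2 ^ m)\<close> labels to be beaten by
    \<open>(9 / 10) ^ d\<close>, but still linearly many.\<close>
  obtain m where m: "2 ^ m \<le> n div 100" "n div 100 < 2 ^ (m + 1)"
  proof -
    have "1 \<le> n div 100" using div_le_mono[OF n, of 100] by simp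
    from ex_power_ivl1[OF order_refl this] show ?thesis using that by blast
  qed
  define K where "K = real (2 ^ m)"
  have "2 ^ m * 100 \<le> n" using m(1) by linarith
  then have K1: "K \<le> n / 100" unfolding K_def by (simp flip: of_nat_power of_nat_mult)
  have "n < 2 ^ (m + 1) * 100" using m(2) by linarith
  then have "real n < real (2 ^ (m + 1) * 100)" by (simp only: of_nat_less_iff)
  then have K2: "n / 200 \<le> K" unfolding K_def by simp
  have K3: "K \<ge> 250" "n / 250 \<le> K" using K2 n by linarith+
  have m1: "m \<ge> 1" using m n by (cases m) auto
  have mn: "m < n" using \<open>2 ^ m * 100 \<le> n\<close> less_exp[of m] by linarith
  have mlog: "real m \<le> log 2 n"
  proof -
    have "2 ^ m \<le> n" using \<open>2 ^ m * 100 \<le> n\<close> by simp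
    then have "real (2 ^ m) \<le> real n" by (simp only: of_nat_le_iff)
    then have "log 2 (2 ^ m) \<le> log 2 n" using n by (subst log_le_cancel_iff) auto
    then show ?thesis by (simp add: log_nat_power)
  qed
  define d where "d = n - m"
  have d: "d + m = n" "d > 0" "real d \<ge> 9 / 10 * n" using mn mlog E7 unfolding d_def by auto
  interpret sliced_cube "{m..<n}" "{..<m}"
    using mn m1 by unfold_locales (auto simp: lessThan_empty_iff)
  have DM: "{m..<n} \<union> {..<m} = {..<n}" using mn by auto
  have cD: "card {m..<n} = d" "card {..<m} = m" by (auto simp: d_def)
  \<comment> \<open>A thousandth of the slice: \<open>32 ^ (2 * r)\<close> stays below
    \<open>2 powr (K / 100)\<close>, so flat slices are rare, while a label without dominant phase
    changes on at least \<open>(r + 1) / m\<close> edges of some direction, which is of order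
    \<open>n / log n\<close>.\<close>
  define r where "r = 2 ^ m div (1000 :: nat)"
  have r1: "real r \<le> K / 1000" "K / 1000 \<le> real r + 1"
  proof -
    have "r * 1000 \<le> 2 ^ m" "2 ^ m < (r + 1) * 1000"
      unfolding r_def using dividend_less_div_times[of 1000 "2 ^ m"] by simp_all
    then have "real (r * 1000) \<le> K" "K \<le> real ((r + 1) * 1000)" unfolding K_def by (simp_all only: of_nat_le_iff less_imp_le)
    then show "real r \<le> K / 1000" "K / 1000 \<le> real r + 1" by simp_all
  qed
  have r4: "4 * r < 2 ^ m"
  proof -
    have "4 * real r < K" using r1 K3 by linarith
    then have "real (4 * r) < real (2 ^ m)" by (simp add: K_def)
    then show ?thesis by (simp only: of_nat_less_iff)
  qed
  have half: "real (2 ^ (m - 1)) = K / 2" unfolding K_def using m1 by (cases m) auto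
  define F where "F = 9 * (32 ^ (2 * r) * (17 / 16 :: real) ^ (2 ^ m))"
  have FK: "F \<le> 2 powr (K / 8)"
  proof -
    have a: "(9 :: real) \<le> 2 powr 4" by simp
    have b: "(32 :: real) ^ (2 * r) \<le> 2 powr (K / 100)"
    proof -
      have "(32 :: real) ^ (2 * r) = (2 ^ 5) ^ (2 * r)" by simp
      also have "\<dots> = 2 ^ (10 * r)" by (simp only: power_mult[symmetric]) simp
      also have "\<dots> = 2 powr (10 * r)" by (simp flip: powr_realpow)
      also have "\<dots> \<le> 2 powr (K / 100)" using r1 by (intro powr_mono) auto
      finally show ?thesis .
    qed
    have c: "(17 / 16 :: real) ^ (2 ^ m) \<le> 2 powr (K / 11)"
    proof -
      have "(17 / 16 :: real) ^ (2 ^ m) = (17 / 16) powr K" unfolding K_def by (simp flip: powr_realpow)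
      also have "\<dots> = ((17 / 16) powr 11) powr (K / 11)" by (simp only: powr_powr) simp
      also have "(17 / 16 :: real) powr 11 = (17 / 16) ^ 11" by simp
      also have "((17 / 16 :: real) ^ 11) powr (K / 11) \<le> 2 powr (K / 11)"
        using K3 by (intro powr_mono2) (auto simp: power_divide divide_le_eq)
      finally show ?thesis .
    qed
    have "F \<le> 2 powr 4 * (2 powr (K / 100) * 2 powr (K / 11))"
      unfolding F_def by (intro mult_mono a b c) auto
    also have "\<dots> = 2 powr (4 + (K / 100 + K / 11))" by (simp only: powr_add)
    also have "\<dots> \<le> 2 powr (K / 8)" using K3 by (intro powr_mono) auto
    finally show ?thesis .
  qed
  have F0: "F \<ge> 0" unfolding F_def by simp
  define \<omega> where "\<omega> = 2 powr L"
  have LK: "L \<le> K / 16" using E1 K3 by linarith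
  have \<omega>F: "\<omega> * F \<le> 2 powr (3 / 16 * K)"
  proof -
    have "\<omega> * F \<le> 2 powr (K / 16) * 2 powr (K / 8)"
      unfolding \<omega>_def using FK F0 LK by (intro mult_mono powr_mono) auto
    also have "\<dots> = 2 powr (K / 16 + K / 8)" by (simp only: powr_add)
    finally show ?thesis by simp
  qed
  \<comment> \<open>The weight of flat slices, at most \<open>2 powr (3 / 16 * K)\<close>, relative
    to the \<open>2 powr (K / 2)\<close> colourings of a slice in one phase.\<close>
  define \<delta> where "\<delta> = 2 powr (- (5 / 16 * K))"
  define \<gamma> where "\<gamma> = \<omega> * \<omega> * (3 / 4) powr ((real r + 1) / m)"
  define u where "u = \<omega> powr (- (1 / 2))"
  have uL: "u = 2 powr (- (L / 2))" unfolding u_def \<omega>_def by (simp add: powr_powr)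
  have p2h: "(2 :: real) ^ (2 ^ (m - 1)) = 2 powr (K / 2)"
    unfolding half[symmetric] by (rule powr_realpow[symmetric]) simp
  have p2K: "(2 :: real) ^ (2 ^ m) = 2 powr K"
    unfolding K_def by (rule powr_realpow[symmetric]) simp
  have h1: "\<omega> * F \<le> \<delta> * 2 ^ (2 ^ (m - 1))"
    unfolding p2h \<delta>_def powr_add[symmetric] using \<omega>F by simp
  have h2: "\<omega> * F * 2 ^ (2 ^ (m - 1) + r) \<le> 2 ^ (2 ^ m) / 20"
  proof -
    have "\<omega> * F * 2 ^ (2 ^ (m - 1) + r) = \<omega> * F * (2 powr (K / 2) * 2 powr r)"
      unfolding power_add p2h by (simp add: powr_realpow)
    also have "\<dots> \<le> 2 powr (3 / 16 * K) * (2 powr (K / 2) * 2 powr (K / 1000))"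
      using \<omega>F r1 by (intro mult_mono powr_mono) auto
    also have "\<dots> = 2 powr (3 / 16 * K + (K / 2 + K / 1000))" by (simp only: powr_add)
    also have "\<dots> \<le> 2 powr (K - 5)" using K3 by (intro powr_mono) auto
    also have "\<dots> = 2 powr K / 32" by (simp add: powr_diff)
    also have "\<dots> \<le> 2 powr K / 20" by (simp add: field_simps)
    finally show ?thesis unfolding p2K .
  qed
  \<comment> \<open>250000 is 250 * 1000, from \<open>n / 250 \<le> K\<close> and
    \<open>K / 1000 \<le> r + 1\<close>. Three times this appears because \<open>(3 / 4) ^ 3\<close>
    is below 1 / 2.\<close>
  have E4: "2 powr (2 * L) * (3 / 4) powr (n / 250000 / log 2 n) \<le> 1 / 2"
  proof -
    have "(3 / 4 :: real) powr (n / 250000 / log 2 n) = ((3 / 4) powr 3) powr (n / 750000 / log 2 n)"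
      by (simp only: powr_powr) simp
    also have "(3 / 4 :: real) powr 3 = (3 / 4) ^ 3" by simp
    also have "((3 / 4 :: real) ^ 3) powr (n / 750000 / log 2 n) \<le> (1 / 2) powr (n / 750000 / log 2 n)"
      using n by (intro powr_mono2) (auto simp: power_divide divide_le_eq)
    also have "\<dots> = 2 powr (- (n / 750000 / log 2 n))" by (rule half_powr)
    finally have "(3 / 4 :: real) powr (n / 250000 / log 2 n) \<le> 2 powr (- (n / 750000 / log 2 n))" .
    then have "2 powr (2 * L) * (3 / 4) powr (n / 250000 / log 2 n) \<le> 2 powr (2 * L) * 2 powr (- (n / 750000 / log 2 n))"
      by (rule mult_left_mono) (rule powr_ge_zero)
    also have "\<dots> = 2 powr (2 * L + - (n / 750000 / log 2 n))" by (simp only: powr_add)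
    also have "\<dots> \<le> 2 powr (- 1)" using E4' by (intro powr_mono) auto
    finally show ?thesis by (simp add: powr_minus)
  qed
  have \<gamma>: "0 \<le> \<gamma>" "\<gamma> \<le> 1 / 2"
  proof -
    have "\<omega> * \<omega> = 2 powr (2 * L)" unfolding \<omega>_def by (simp flip: powr_add)
    moreover have "(3 / 4 :: real) powr ((real r + 1) / m) \<le> (3 / 4) powr (n / 250000 / log 2 n)"
    proof (intro powr_mono')
      have "n / 250000 / log 2 n \<le> (K / 1000) / log 2 n"
        using K3 n by (intro divide_right_mono) auto
      also have "\<dots> \<le> (K / 1000) / m" using mlog m1 K3 by (intro divide_left_mono) auto
      also have "\<dots> \<le> (real r + 1) / m" using r1 by (intro divide_right_mono) auto
      finally show "n / 250000 / log 2 n \<le> (real r + 1) / m" .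
    qed auto
    ultimately have "\<gamma> \<le> 2 powr (2 * L) * (3 / 4) powr (n / 250000 / log 2 n)"
      unfolding \<gamma>_def by (simp add: mult_left_mono)
    then show "\<gamma> \<le> 1 / 2" using E4 by linarith
    show "0 \<le> \<gamma>" unfolding \<gamma>_def \<omega>_def by simp
  qed
  have \<delta>u: "2 * real d * \<delta> \<le> u"
  proof -
    have "2 * real d \<le> 2 * real n" using d by simp
    also have "\<dots> \<le> 2 powr (9 / 32 * (n / 250))" by (rule E2)
    also have "\<dots> \<le> 2 powr (9 / 32 * K)" using K3 by (intro powr_mono) auto
    finally have "2 * real d * \<delta> \<le> 2 powr (9 / 32 * K) * \<delta>" unfolding \<delta>_def by (intro mult_right_mono) auto
    also have "\<dots> = 2 powr (9 / 32 * K + - (5 / 16 * K))" unfolding \<delta>_def by (simp only: powr_add)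
    also have "\<dots> \<le> u" unfolding uL using LK by (intro powr_mono) auto
    finally show ?thesis .
  qed
  have six: "(6 :: real) ^ (2 ^ m) \<le> 6 powr (n / 100)"
  proof -
    have "(6 :: real) ^ (2 ^ m) = 6 powr K" unfolding K_def by (rule powr_realpow[symmetric]) simp
    also have "\<dots> \<le> 6 powr (n / 100)" using K1 by (intro powr_mono) auto
    finally show ?thesis .
  qed
  have six2: "(6 :: real) powr (n / 100) \<le> 2 powr (3 / 100 * n)"
  proof -
    have "(6 :: real) powr (n / 100) \<le> (2 powr 3) powr (n / 100)" by (intro powr_mono2) auto
    also have "\<dots> = 2 powr (3 / 100 * n)" by (simp only: powr_powr) simp
    finally show ?thesis .
  qed
  have E8: "6 powr (n / 100) * (1 / 2) powr (9 / 10 * n) \<le> 2 powr (- (L / 2))"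
  proof -
    have "6 powr (n / 100) * (1 / 2) powr (9 / 10 * n) \<le> 2 powr (3 / 100 * n) * 2 powr (- (9 / 10 * n))"
      unfolding half_powr by (rule mult_mono[OF six2]) simp_all
    also have "\<dots> = 2 powr (3 / 100 * n + - (9 / 10 * n))" by (simp only: powr_add)
    also have "\<dots> \<le> 2 powr (- (L / 2))" using E1 by (intro powr_mono) auto
    finally show ?thesis .
  qed
  have E3: "6 powr (n / 100) * (9 / 10) powr (9 / 10 * n) \<le> 2 powr (- (L / 2))"
  proof -
    \<comment> \<open>\<open>(9 / 10) ^ 7\<close> is below 1 / 2, so the gain is
      \<open>9 / 70 * n\<close> bits. The labels cost only \<open>3 / 100 * n\<close> bits, and the
      rest covers \<open>L / 2\<close>.\<close>
    have "(9 / 10 :: real) powr (9 / 10 * n) = ((9 / 10) powr 7) powr (9 / 70 * n)" by (simp only: powr_powr) simp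
    also have "(9 / 10 :: real) powr 7 = (9 / 10) ^ 7" by simp
    also have "((9 / 10 :: real) ^ 7) powr (9 / 70 * n) \<le> (1 / 2) powr (9 / 70 * n)"
      by (intro powr_mono2) (auto simp: power_divide divide_le_eq)
    also have "\<dots> = 2 powr (- (9 / 70 * n))" by (rule half_powr)
    finally have "6 powr (n / 100) * (9 / 10) powr (9 / 10 * n) \<le> 2 powr (3 / 100 * n) * 2 powr (- (9 / 70 * n))"
      by (rule mult_mono[OF six2]) simp_all
    also have "\<dots> = 2 powr (3 / 100 * n + - (9 / 70 * n))" by (simp only: powr_add)
    also have "\<dots> \<le> 2 powr (- (L / 2))" using E1 by (intro powr_mono) auto
    finally show ?thesis .
  qed
  have pd: "x ^ d \<le> x powr (9 / 10 * n)" if "0 < x" "x \<le> 1" for x :: real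
  proof -
    have "x ^ d = x powr d" using that by (simp add: powr_realpow)
    also have "\<dots> \<le> x powr (9 / 10 * n)" using that d by (intro powr_mono') auto
    finally show ?thesis .
  qed
  have k1: "6 ^ (2 ^ m) * (9 / 10) ^ d \<le> u"
  proof -
    have "6 ^ (2 ^ m) * (9 / 10 :: real) ^ d \<le> 6 powr (n / 100) * (9 / 10) powr (9 / 10 * n)"
      by (intro mult_mono six pd) auto
    then show ?thesis using E3 unfolding uL by linarith
  qed
  have k2: "6 ^ (2 ^ m) * \<gamma> ^ d \<le> u"
  proof -
    have "\<gamma> ^ d \<le> (1 / 2) ^ d" using \<gamma> by (intro power_mono) auto
    also have "\<dots> \<le> (1 / 2) powr (9 / 10 * n)" by (intro pd) auto
    finally have "6 ^ (2 ^ m) * \<gamma> ^ d \<le> 6 powr (n / 100) * (1 / 2) powr (9 / 10 * n)"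
      using \<gamma> by (intro mult_mono six) auto
    then show ?thesis using E8 unfolding uL by linarith
  qed
  \<comment> \<open>The threshold at which the two counts meet, of order
    \<open>2 powr (n - L / 2)\<close>. With \<open>q = L / 4\<close> the polymer sum has a factor
    \<open>2 powr (L / 4)\<close> to spare for \<open>429 * n\<close>, where 429 is 3 * 143.\<close>
  define \<Theta> where "\<Theta> = nat \<lfloor>143 * 2 ^ n * u\<rfloor>"
  have u0: "u \<ge> 0" unfolding uL by simp
  have \<Theta>1: "real \<Theta> \<le> 143 * 2 ^ n * u" "143 * 2 ^ n * u < real \<Theta> + 1"
  proof -
    have "real \<Theta> = of_int \<lfloor>143 * 2 ^ n * u\<rfloor>" unfolding \<Theta>_def using u0 by simp
    then show "real \<Theta> \<le> 143 * 2 ^ n * u" "143 * 2 ^ n * u < real \<Theta> + 1" by linarith+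
  qed
  let ?X = "(2 :: real) ^ (2 ^ (n - 1))"
  let ?bad = "{c\<in>colourings {..<n}. \<forall>p a. card {x\<in>parity_class {..<n} p. c x \<noteq> a} > \<Theta>}"
  let ?sp = "\<lambda>P. {c\<in>colourings {..<n}. card {x\<in>parity_class {..<n} (fst P). c x \<noteq> snd P} \<le> \<Theta>}"
  have bad: "real (card ?bad) \<le> 7 * ?X"
  proof -
    have F: "real (card {\<sigma>\<in>colourings {..<m}. flat {..<m} r \<sigma>}) \<le> F"
      using card_flat_le[of "{..<m}" r] by (simp add: F_def)
    have hr: "real r + 1 \<le> 2 ^ m / 2"
    proof -
      have "real r + 1 \<le> K / 2" using r1 K3 by linarith
      then show ?thesis by (simp add: K_def)
    qed
    have "real (card {c\<in>colourings ({m..<n} \<union> {..<m}). \<forall>p a. card {x\<in>parity_class ({m..<n} \<union> {..<m}) p. c x \<noteq> a} > \<Theta>})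
      \<le> 7 * 2 ^ (2 ^ (card {m..<n} + card {..<m} - 1))"
    proof (rule dense_colourings_le[where \<omega> = \<omega> and u = u and F = F and \<delta> = \<delta> and \<gamma> = \<gamma> and r = r], unfold cD)
      show "\<omega> \<ge> 38416" using E5 by (simp add: \<omega>_def)
      show "\<omega> * \<omega> * (3 / 4) powr ((real r + 1) / m) \<le> \<gamma>" by (simp add: \<gamma>_def)
      show "\<delta> \<ge> 0" by (simp add: \<delta>_def)
      show "143 * 2 ^ (d + m) * u < real \<Theta> + 1" using \<Theta>1 d by simp
      show "real (2 * d) * \<delta> \<le> u" using \<delta>u by simp
    qed (fact hr r4 F h1 h2 u_def k1 k2)+
    then show ?thesis unfolding DM cD d(1) .
  qed
  have sp: "real (card (?sp P)) \<le> exp 10 * ?X" for P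
  proof -
    have "3 * real n * real \<Theta> \<le> 3 * real n * (143 * 2 ^ n * u)" using \<Theta>1 by (intro mult_left_mono) auto
    also have "\<dots> = (429 * real n) * (2 ^ n * u)" by simp
    also have "\<dots> \<le> 2 powr (L / 4) * (2 ^ n * u)" using E6 u0 by (intro mult_right_mono) auto
    also have "\<dots> = 2 powr (L / 4 + (n + - (L / 2)))" unfolding uL powr_add by (simp add: powr_realpow)
    also have "L / 4 + (real n + - (L / 2)) = real n - L / 4" by simp
    finally have T: "3 * real n * real \<Theta> \<le> 2 powr (real n - L / 4)" .
    show ?thesis
      by (rule sparse_colourings_le[where q = "L / 4"]) (use n S1 S2 S3 T in simp_all)
  qed
  have "colourings {..<n} \<subseteq> ?bad \<union> (\<Union>P\<in>UNIV. ?sp P)" by (force simp: not_le)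
  then have "card (colourings {..<n}) \<le> card (?bad \<union> (\<Union>P\<in>UNIV. ?sp P))"
    using finite_colourings[of "{..<n}"] by (intro card_mono) auto
  also have "\<dots> \<le> card ?bad + (\<Sum>P\<in>UNIV. card (?sp P))"
    using card_Un_le[of ?bad "\<Union>P\<in>UNIV. ?sp P"] card_UN_le[of UNIV ?sp] by simp
  finally have "real (card (colourings {..<n})) \<le> real (card ?bad + (\<Sum>P\<in>UNIV. card (?sp P)))" by (simp only: of_nat_le_iff)
  also have "\<dots> = real (card ?bad) + (\<Sum>P\<in>UNIV. real (card (?sp P)))" by simp
  also have "\<dots> \<le> 7 * ?X + (\<Sum>P\<in>(UNIV :: (bool \<times> 3) set). exp 10 * ?X)" by (intro add_mono bad sum_mono sp)
  also have "\<dots> = (7 + 6 * exp 10) * ?X" by (simp add: algebra_simps)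
  finally show ?thesis .
qed

text \<open>The difference eventually lies between 0 and the logarithm of
  \<open>7 + 6 * exp 10\<close>: 7 for the colourings far from every phase and \<open>exp 10\<close>
  for each of the six phases.\<close>

theorem theorem4p2:
  "(\<lambda>n. log 2 (real (num_admissible n)) - 2 ^ (n - 1)) \<in> O(\<lambda>_. 1)"
proof (rule bigoI)
  define C where "C = (7 + 6 * exp 10 :: real)"
  have C: "C \<ge> 1" unfolding C_def by (simp add: add_increasing2)
  have "eventually (\<lambda>n::nat. n \<ge> 50000) sequentially" by (rule eventually_ge_at_top)
  then show "eventually (\<lambda>n. norm (log 2 (real (num_admissible n)) - 2 ^ (n - 1)) \<le> log 2 C * norm (1::real)) sequentially"
    using log_bounds_eventually sparse_bounds_eventually
  proof eventually_elim
    case (elim n)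
    let ?a = "real (num_admissible n)" and ?X = "(2 :: real) ^ (2 ^ (n - 1))"
    have lower: "?X \<le> ?a"
    proof -
      have "2 ^ (2 ^ (n - 1)) \<le> num_admissible n" using elim by (intro num_admissible_ge) simp
      then have "real (2 ^ (2 ^ (n - 1))) \<le> ?a" by (simp only: of_nat_le_iff)
      then show ?thesis by simp
    qed
    have "real (card (colourings {..<n})) \<le> (7 + 6 * exp 10) * 2 ^ (2 ^ (n - 1))"
      by (rule card_colourings_le[OF elim])
    moreover have "?a \<le> real (card (colourings {..<n}))"
      using num_admissible_le[of n] by (simp only: of_nat_le_iff)
    ultimately have upper: "?a \<le> C * ?X" unfolding C_def by linarith
    have a: "?a > 0" using lower by (rule less_le_trans[rotated]) simp
    have "log 2 ?X \<le> log 2 ?a" using lower a by (subst log_le_cancel_iff) auto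
    moreover have "log 2 ?a \<le> log 2 (C * ?X)" using upper a C by (subst log_le_cancel_iff) auto
    moreover have "log 2 ?X = 2 ^ (n - 1)" by (simp add: log_nat_power)
    moreover have "log 2 (C * ?X) = log 2 C + log 2 ?X" using C by (intro log_mult_pos) auto
    ultimately show ?case by simp
  qed
qed

end
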